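(* Let $N$ be a smooth manifold of dimension $n\ge2$ and let $D$ be a torsion-free affine connection on $N$ preserving a volume form. Let $g$ be the associated Patterson--Walker metric on the $2n$-dimensional manifold $T^*N$. Then $g$ has vanishing $Q$-curvature: $Q_g=0$ on $T^*N$.
   Context: With local coordinates $x^A$ on $N$, induced canonical fibre coordinates $p_A$ on $T^*N$, and Christoffel symbols defined by $D_{\partial_A}\partial_B=\Gamma_A{}^C{}_B\,\partial_C$, the Patterson--Walker metric of $D$ is the globally defined signature $(n,n)$ metric $$g=2\,dx^A\odot dp_A-2\,\Gamma_A{}^C{}_B\,p_C\,dx^A\odot dx^B$$ on $T^*N$, where $\alpha\odot\beta=\tfrac12(\alpha\otimes\beta+\beta\otimes\alpha)$ and repeated indices are summed. $Q_g$ denotes Branson's (critical) $Q$-curvature of a pseudo-Riemannian metric $g$ on an even-dimensional manifold $M$ of dimension $m=2n$. It can be described as follows (Fefferman--Hirachi). Let $$\mathbf g=t^2g_{ij}(x,\rho)\,dx^i\odot dx^j+2\rho\,dt\odot dt+2t\,dt\odot d\rho,\qquad g_{ij}(x,0)\,dx^i\odot dx^j=g,$$ be a Fefferman--Graham ambient metric for $g$ on a neighbourhood of $\{\rho=0\}$ in $\mathbb R_+\times M\times\mathbb R$ with coordinates $(t,x,\rho)$, i.e. with $\mathrm{Ric}(\mathbf g)=O(\rho^{n-1})$ and $g^{ij}\mathrm{Ric}(\mathbf g)_{ij}=O(\rho^n)$ (trace over the $M$-directions); in particular any such $\mathbf g$ that is Ricci-flat is admissible. Let $\mathbf\Delta$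 be the Laplacian (trace of the Hessian) of $\mathbf g$. Then $$Q_g=\big(-\mathbf\Delta^{n}\log t\big)\big|_{\rho=0,\;t=1},$$ up to an overall sign depending on the sign convention for the Laplacian, and this is independent of the choice of $\mathbf g$. *)

theory Defs
  imports "HOL-Analysis.Analysis" "HOL-Library.Landau_Symbols"
begin

text \<open>Smoothness is only used on open sets \<open>S\<close>.\<close>

primrec k_smooth_on ::
  "nat \<Rightarrow> 'a::real_normed_vector set \<Rightarrow> ('a \<Rightarrow> 'b::real_normed_vector) \<Rightarrow> bool" where
  "k_smooth_on 0 S f \<longleftrightarrow> continuous_on S f"
| "k_smooth_on (Suc k) S f \<longleftrightarrow>
     (\<forall>x\<in>S. f differentiable (at x)) \<and>
     (\<forall>v. k_smooth_on k S (\<lambda>x. frechet_derivative f (at x) v))"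

definition smooth_on ::
  "'a::real_normed_vector set \<Rightarrow> ('a \<Rightarrow> 'b::real_normed_vector) \<Rightarrow> bool" where
  "smooth_on S f \<longleftrightarrow> (\<forall>k. k_smooth_on k S f)"

text \<open>
  A chart is a pair of its domain and its coordinate map. The topology of the manifold is the one
  determined by the atlas, and the dimension is \<open>CARD('n)\<close>.
\<close>

type_synonym ('a, 'n) chart = "'a set \<times> ('a \<Rightarrow> real^'n)"
type_synonym ('a, 'n) atlas = "('a, 'n) chart set"

abbreviation chart_inv :: "('a, 'n) chart \<Rightarrow> real^'n \<Rightarrow> 'a" where
  "chart_inv c \<equiv> inv_into (fst c) (snd c)"

abbreviation chart_image :: "('a, 'n) chart \<Rightarrow> 'a set \<Rightarrow> (real^'n) set" where
  "chart_image c S \<equiv> snd c ` (S \<inter> fst c)"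

definition transition :: "('a, 'n) chart \<Rightarrow> ('a, 'n) chart \<Rightarrow> real^'n \<Rightarrow> real^'n" where
  "transition c d = snd d \<circ> chart_inv c"

definition carrier_of :: "('a, 'n) atlas \<Rightarrow> 'a set" where
  "carrier_of A = (\<Union>c\<in>A. fst c)"

definition smooth_atlas :: "('a, 'n::finite) atlas \<Rightarrow> bool" where
  "smooth_atlas A \<longleftrightarrow>
     (\<forall>c\<in>A. inj_on (snd c) (fst c) \<and> open (snd c ` fst c)) \<and>
     (\<forall>c\<in>A. \<forall>d\<in>A. open (chart_image c (fst d)) \<and>
        smooth_on (chart_image c (fst d)) (transition c d))"

definition atlas_open :: "('a, 'n::finite) atlas \<Rightarrow> 'a set \<Rightarrow> bool" where
  "atlas_open A S \<longleftrightarrow> S \<subseteq> carrier_of A \<and> (\<forall>c\<in>A. open (chart_image c S))"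

definition atlas_topology :: "('a, 'n::finite) atlas \<Rightarrow> 'a topology" where
  "atlas_topology A = topology (atlas_open A)"

lemma istopology_atlas_open:
  assumes "smooth_atlas A"
  shows "istopology (atlas_open A)"
  unfolding istopology_def
proof (intro conjI allI impI)
  fix S T assume "atlas_open A S" "atlas_open A T"
  moreover have "chart_image c (S \<inter> T) = chart_image c S \<inter> chart_image c T" if "c \<in> A" for c
    using assms that unfolding smooth_atlas_def inj_on_def by blast
  ultimately show "atlas_open A (S \<inter> T)"
    by (auto simp: atlas_open_def)
next
  fix K assume K: "\<forall>S\<in>K. atlas_open A S"
  have "chart_image c (\<Union>K) = (\<Union>S\<in>K. chart_image c S)" for c :: "('a, 'b) chart"
    by blast
  with K show "atlas_open A (\<Union>K)"
    by (auto simp: atlas_open_def)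
qed

lemma openin_atlas_topology:
  "smooth_atlas A \<Longrightarrow> openin (atlas_topology A) S \<longleftrightarrow> atlas_open A S"
  by (simp add: atlas_topology_def istopology_atlas_open topology_inverse')

definition smooth_manifold :: "('a, 'n::finite) atlas \<Rightarrow> bool" where
  "smooth_manifold A \<longleftrightarrow>
     smooth_atlas A \<and> Hausdorff_space (atlas_topology A) \<and> second_countable (atlas_topology A)"

text \<open>
  A tangent vector at \<open>z\<close> is the family of its component vectors in all charts around \<open>z\<close>, which
  are related by the Jacobians of the transition maps; the components are set to 0 for the other
  (irrelevant) chart arguments.
\<close>

type_synonym ('a, 'n) tvec = "('a, 'n) chart \<Rightarrow> real^'n"
type_synonym ('a, 'n) vfield = "'a \<Rightarrow> ('a, 'n) tvec"

abbreviation tadd :: "('a, 'n::finite) tvec \<Rightarrow> ('a, 'n) tvec \<Rightarrow> ('a, 'n) tvec" where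
  "tadd u v \<equiv> (\<lambda>c. u c + v c)"

abbreviation tscale :: "real \<Rightarrow> ('a, 'n::finite) tvec \<Rightarrow> ('a, 'n) tvec" where
  "tscale r u \<equiv> (\<lambda>c. r *\<^sub>R u c)"

definition tangent_space :: "('a, 'n::finite) atlas \<Rightarrow> 'a \<Rightarrow> ('a, 'n) tvec set" where
  "tangent_space A z =
     {v. (\<forall>c\<in>A. \<forall>d\<in>A. z \<in> fst c \<longrightarrow> z \<in> fst d \<longrightarrow>
            v d = frechet_derivative (transition c d) (at (snd c z)) (v c)) \<and>
         (\<forall>c. \<not> (c \<in> A \<and> z \<in> fst c) \<longrightarrow> v c = 0)}"

text \<open>The coordinate vector field \<open>\<partial>\<^sub>i\<close> of the chart \<open>c\<close> (meaningful on the domain of \<open>c\<close>):\<close>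

definition coord_vec :: "('a, 'n::finite) atlas \<Rightarrow> ('a, 'n) chart \<Rightarrow> 'n \<Rightarrow> ('a, 'n) vfield" where
  "coord_vec A c i z =
     (\<lambda>d. if d \<in> A \<and> z \<in> fst d
          then frechet_derivative (transition c d) (at (snd c z)) (axis i 1) else 0)"

definition smooth_fun :: "('a, 'n::finite) atlas \<Rightarrow> 'a set \<Rightarrow> ('a \<Rightarrow> real) \<Rightarrow> bool" where
  "smooth_fun A U f \<longleftrightarrow> (\<forall>c\<in>A. smooth_on (chart_image c U) (f \<circ> chart_inv c))"

definition vector_fields :: "('a, 'n::finite) atlas \<Rightarrow> 'a set \<Rightarrow> ('a, 'n) vfield set" where
  "vector_fields A U =
     {X. (\<forall>z\<in>U. X z \<in> tangent_space A z) \<and>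
         (\<forall>c\<in>A. smooth_on (chart_image c U) (\<lambda>y. X (chart_inv c y) c))}"

text \<open>The derivative \<open>X f\<close> at \<open>z\<close>, computed in a chart \<open>c\<close> around \<open>z\<close>:\<close>

definition vderiv ::
  "('a, 'n::finite) chart \<Rightarrow> ('a, 'n) vfield \<Rightarrow> ('a \<Rightarrow> real) \<Rightarrow> 'a \<Rightarrow> real" where
  "vderiv c X f z = frechet_derivative (f \<circ> chart_inv c) (at (snd c z)) (X z c)"

definition lie_bracket ::
  "('a, 'n::finite) atlas \<Rightarrow> ('a, 'n) vfield \<Rightarrow> ('a, 'n) vfield \<Rightarrow> ('a, 'n) vfield" where
  "lie_bracket A X Y z =
     (\<lambda>c. if c \<in> A \<and> z \<in> fst c
          then frechet_derivative (\<lambda>y. Y (chart_inv c y) c) (at (snd c z)) (X z c)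
             - frechet_derivative (\<lambda>y. X (chart_inv c y) c) (at (snd c z)) (Y z c)
          else 0)"

definition cotangent_space ::
  "('a, 'n::finite) atlas \<Rightarrow> 'a \<Rightarrow> (('a, 'n) tvec \<Rightarrow> real) set" where
  "cotangent_space A z =
     {\<alpha>. (\<forall>u\<in>tangent_space A z. \<forall>v\<in>tangent_space A z. \<alpha> (tadd u v) = \<alpha> u + \<alpha> v) \<and>
         (\<forall>r. \<forall>u\<in>tangent_space A z. \<alpha> (tscale r u) = r * \<alpha> u) \<and>
         (\<forall>u. u \<notin> tangent_space A z \<longrightarrow> \<alpha> u = 0)}"

text \<open>
  A connection acts on vector fields defined on arbitrary open subsets \<open>U\<close>. One total operator
  \<open>D\<close> suffices for all \<open>U\<close> because of the locality condition.
\<close>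

definition affine_connection ::
  "('a, 'n::finite) atlas \<Rightarrow> (('a, 'n) vfield \<Rightarrow> ('a, 'n) vfield \<Rightarrow> ('a, 'n) vfield) \<Rightarrow> bool" where
  "affine_connection A D \<longleftrightarrow>
     (\<forall>U. openin (atlas_topology A) U \<longrightarrow>
       (\<forall>X\<in>vector_fields A U. \<forall>Y\<in>vector_fields A U.
          D X Y \<in> vector_fields A U \<and>
          (\<forall>X'\<in>vector_fields A U. \<forall>z\<in>U.
             D (\<lambda>x. tadd (X x) (X' x)) Y z = tadd (D X Y z) (D X' Y z)) \<and>
          (\<forall>Y'\<in>vector_fields A U. \<forall>z\<in>U.
             D X (\<lambda>x. tadd (Y x) (Y' x)) z = tadd (D X Y z) (D X Y' z)) \<and>
          (\<forall>f. smooth_fun A U f \<longrightarrow>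
             (\<forall>z\<in>U. D (\<lambda>x. tscale (f x) (X x)) Y z = tscale (f z) (D X Y z)) \<and>
             (\<forall>c\<in>A. \<forall>z\<in>U \<inter> fst c.
                D X (\<lambda>x. tscale (f x) (Y x)) z =
                  tadd (tscale (f z) (D X Y z)) (tscale (vderiv c X f z) (Y z)))) \<and>
          (\<forall>X'\<in>vector_fields A U. \<forall>Y'\<in>vector_fields A U.
             (\<forall>z\<in>U. X z = X' z \<and> Y z = Y' z) \<longrightarrow> (\<forall>z\<in>U. D X Y z = D X' Y' z))))"

definition torsion_free ::
  "('a, 'n::finite) atlas \<Rightarrow> (('a, 'n) vfield \<Rightarrow> ('a, 'n) vfield \<Rightarrow> ('a, 'n) vfield) \<Rightarrow> bool" where
  "torsion_free A D \<longleftrightarrow>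
     (\<forall>U. openin (atlas_topology A) U \<longrightarrow>
       (\<forall>X\<in>vector_fields A U. \<forall>Y\<in>vector_fields A U. \<forall>z\<in>U.
          (\<lambda>c. D X Y z c - D Y X z c) = lie_bracket A X Y z))"

text \<open>\<open>christoffel_symbol A D c z i k j\<close> is the coefficient of \<open>\<partial>\<^sub>k\<close> in \<open>D\<^bsub>\<partial>\<^sub>i\<^esub> \<partial>\<^sub>j\<close>.\<close>

definition christoffel_symbol ::
  "('a, 'n::finite) atlas \<Rightarrow> (('a, 'n) vfield \<Rightarrow> ('a, 'n) vfield \<Rightarrow> ('a, 'n) vfield) \<Rightarrow>
    ('a, 'n) chart \<Rightarrow> 'a \<Rightarrow> 'n \<Rightarrow> 'n \<Rightarrow> 'n \<Rightarrow> real" where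
  "christoffel_symbol A D c z i k j = D (coord_vec A c i) (coord_vec A c j) z c $ k"

text \<open>
  The arguments of a top-degree form on an \<open>n\<close>-dimensional manifold are families of tangent vectors
  indexed by the type \<open>'n\<close>.
\<close>

definition volume_form ::
  "('a, 'n::finite) atlas \<Rightarrow> ('a \<Rightarrow> ('n \<Rightarrow> ('a, 'n) tvec) \<Rightarrow> real) \<Rightarrow> bool" where
  "volume_form A \<mu> \<longleftrightarrow>
     (\<forall>z\<in>carrier_of A.
        (\<forall>Y\<in>UNIV \<rightarrow> tangent_space A z.
           (\<forall>i. \<forall>u\<in>tangent_space A z. \<forall>v\<in>tangent_space A z.
              \<mu> z (Y(i := tadd u v)) = \<mu> z (Y(i := u)) + \<mu> z (Y(i := v))) \<and>
           (\<forall>i r. \<forall>u\<in>tangent_space A z. \<mu> z (Y(i := tscale r u)) = r * \<mu> z (Y(i := u))) \<and>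
           (\<forall>i j. i \<noteq> j \<and> Y i = Y j \<longrightarrow> \<mu> z Y = 0)) \<and>
        (\<exists>Y\<in>UNIV \<rightarrow> tangent_space A z. \<mu> z Y \<noteq> 0)) \<and>
     (\<forall>U. openin (atlas_topology A) U \<longrightarrow>
        (\<forall>Y\<in>UNIV \<rightarrow> vector_fields A U. smooth_fun A U (\<lambda>z. \<mu> z (\<lambda>i. Y i z))))"

text \<open>\<open>D \<mu> = 0\<close>, i.e. \<open>X (\<mu> (Y\<^sub>1, \<dots>, Y\<^sub>n)) = \<Sum>\<^sub>i \<mu> (Y\<^sub>1, \<dots>, D\<^sub>X Y\<^sub>i, \<dots>, Y\<^sub>n)\<close>:\<close>

definition preserves_volume ::
  "('a, 'n::finite) atlas \<Rightarrow> (('a, 'n) vfield \<Rightarrow> ('a, 'n) vfield \<Rightarrow> ('a, 'n) vfield) \<Rightarrow>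
    ('a \<Rightarrow> ('n \<Rightarrow> ('a, 'n) tvec) \<Rightarrow> real) \<Rightarrow> bool" where
  "preserves_volume A D \<mu> \<longleftrightarrow>
     (\<forall>U. openin (atlas_topology A) U \<longrightarrow>
       (\<forall>X\<in>vector_fields A U. \<forall>Y\<in>UNIV \<rightarrow> vector_fields A U. \<forall>c\<in>A. \<forall>z\<in>U \<inter> fst c.
          vderiv c X (\<lambda>x. \<mu> x (\<lambda>i. Y i x)) z =
            (\<Sum>i\<in>UNIV. \<mu> z ((\<lambda>j. Y j z)(i := D X (Y i) z)))))"

type_synonym ('a, 'n) metric = "'a \<Rightarrow> ('a, 'n) tvec \<Rightarrow> ('a, 'n) tvec \<Rightarrow> real"

definition metric_components ::
  "('a, 'n::finite) atlas \<Rightarrow> ('a, 'n) metric \<Rightarrow> ('a, 'n) chart \<Rightarrow> real^'n \<Rightarrow> real^'n^'n" where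
  "metric_components A g c y =
     (\<chi> i j. let z = chart_inv c y in g z (coord_vec A c i z) (coord_vec A c j z))"

definition pseudo_riemannian_metric :: "('a, 'n::finite) atlas \<Rightarrow> ('a, 'n) metric \<Rightarrow> bool" where
  "pseudo_riemannian_metric A g \<longleftrightarrow>
     (\<forall>z\<in>carrier_of A. \<forall>u\<in>tangent_space A z.
        (\<forall>v\<in>tangent_space A z. g z u v = g z v u) \<and>
        (\<forall>v\<in>tangent_space A z. \<forall>w\<in>tangent_space A z. g z u (tadd v w) = g z u v + g z u w) \<and>
        (\<forall>r. \<forall>v\<in>tangent_space A z. g z u (tscale r v) = r * g z u v) \<and>
        ((\<forall>v\<in>tangent_space A z. g z u v = 0) \<longrightarrow> u = (\<lambda>_. 0))) \<and>
     (\<forall>c\<in>A. smooth_on (snd c ` fst c) (metric_components A g c))"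

text \<open>
  The chart \<open>(x, p)\<close> of the cotangent bundle induced by a chart \<open>c\<close>: index \<open>Inl a\<close> stands for the
  coordinate \<open>x\<^sup>a\<close> and index \<open>Inr a\<close> for the fibre coordinate \<open>p\<^sub>a = \<alpha>(\<partial>\<^sub>a)\<close>.
\<close>

definition cotangent_chart ::
  "('a, 'n::finite) atlas \<Rightarrow> ('a, 'n) chart \<Rightarrow> ('a \<times> (('a, 'n) tvec \<Rightarrow> real), 'n + 'n) chart" where
  "cotangent_chart A c =
     ({(z, \<alpha>). z \<in> fst c \<and> \<alpha> \<in> cotangent_space A z},
      \<lambda>(z, \<alpha>). \<chi> I. case I of Inl a \<Rightarrow> snd c z $ a | Inr a \<Rightarrow> \<alpha> (coord_vec A c a z))"

definition cotangent_bundle ::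
  "('a, 'n::finite) atlas \<Rightarrow> ('a \<times> (('a, 'n) tvec \<Rightarrow> real), 'n + 'n) atlas" where
  "cotangent_bundle A = cotangent_chart A ` A"

text \<open>
  The component matrix of \<open>2 dx\<^sup>a \<odot> dp\<^sub>a - 2 \<Gamma>\<^sub>a\<^sup>k\<^sub>b p\<^sub>k dx\<^sup>a \<odot> dx\<^sup>b\<close>, where \<open>\<odot>\<close> includes the factor 1/2 and
  \<open>G a k b\<close> stands for \<open>\<Gamma>\<^sub>a\<^sup>k\<^sub>b\<close>:
\<close>

definition pw_matrix ::
  "('n::finite \<Rightarrow> 'n \<Rightarrow> 'n \<Rightarrow> real) \<Rightarrow> ('n \<Rightarrow> real) \<Rightarrow> 'n + 'n \<Rightarrow> 'n + 'n \<Rightarrow> real" where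
  "pw_matrix G p I J =
     (case (I, J) of
        (Inl a, Inl b) \<Rightarrow> - (\<Sum>k\<in>UNIV. (G a k b + G b k a) * p k)
      | (Inl a, Inr b) \<Rightarrow> if a = b then 1 else 0
      | (Inr a, Inl b) \<Rightarrow> if a = b then 1 else 0
      | (Inr a, Inr b) \<Rightarrow> 0)"

definition patterson_walker_metric ::
  "('a, 'n::finite) atlas \<Rightarrow> (('a, 'n) vfield \<Rightarrow> ('a, 'n) vfield \<Rightarrow> ('a, 'n) vfield) \<Rightarrow>
    ('a \<times> (('a, 'n) tvec \<Rightarrow> real), 'n + 'n) metric \<Rightarrow> bool" where
  "patterson_walker_metric A D g \<longleftrightarrow>
     pseudo_riemannian_metric (cotangent_bundle A) g \<and>
     (\<forall>c\<in>A. \<forall>(z, \<alpha>)\<in>fst (cotangent_chart A c). \<forall>I J.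
        g (z, \<alpha>) (coord_vec (cotangent_bundle A) (cotangent_chart A c) I (z, \<alpha>))
                 (coord_vec (cotangent_bundle A) (cotangent_chart A c) J (z, \<alpha>)) =
          pw_matrix (christoffel_symbol A D c z) (\<lambda>a. \<alpha> (coord_vec A c a z)) I J)"

abbreviation partial :: "'k::finite \<Rightarrow> (real^'k \<Rightarrow> real) \<Rightarrow> real^'k \<Rightarrow> real" where
  "partial i f x \<equiv> frechet_derivative f (at x) (axis i 1)"

definition levi_civita ::
  "(real^'k::finite \<Rightarrow> real^'k^'k) \<Rightarrow> 'k \<Rightarrow> 'k \<Rightarrow> 'k \<Rightarrow> real^'k \<Rightarrow> real" where
  "levi_civita G k i j x =
     (\<Sum>l\<in>UNIV. matrix_inv (G x) $ k $ l *
        (partial i (\<lambda>y. G y $ j $ l) x + partial j (\<lambda>y. G y $ i $ l) x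
          - partial l (\<lambda>y. G y $ i $ j) x)) / 2"

definition ricci :: "(real^'k::finite \<Rightarrow> real^'k^'k) \<Rightarrow> 'k \<Rightarrow> 'k \<Rightarrow> real^'k \<Rightarrow> real" where
  "ricci G i j x =
     (\<Sum>k\<in>UNIV. partial k (levi_civita G k i j) x - partial j (levi_civita G k i k) x +
       (\<Sum>l\<in>UNIV. levi_civita G k k l x * levi_civita G l i j x
                 - levi_civita G k j l x * levi_civita G l i k x))"

definition laplacian ::
  "(real^'k::finite \<Rightarrow> real^'k^'k) \<Rightarrow> (real^'k \<Rightarrow> real) \<Rightarrow> real^'k \<Rightarrow> real" where
  "laplacian G f x =
     (\<Sum>i\<in>UNIV. \<Sum>j\<in>UNIV. matrix_inv (G x) $ i $ j *
        (partial i (partial j f) x - (\<Sum>k\<in>UNIV. levi_civita G k i j x * partial k f x)))"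

datatype 'm ambient_index = TDir | MDir 'm | RhoDir

instance ambient_index :: (finite) finite
proof
  have "UNIV = {TDir, RhoDir} \<union> range (MDir :: 'a \<Rightarrow> 'a ambient_index)"
    by (auto intro: ambient_index.exhaust)
  moreover have "finite ({TDir, RhoDir} \<union> range (MDir :: 'a \<Rightarrow> 'a ambient_index))"
    by simp
  ultimately show "finite (UNIV :: 'a ambient_index set)"
    by (simp only:)
qed

definition ambient_point :: "real \<Rightarrow> real^'m \<Rightarrow> real \<Rightarrow> real^('m::finite) ambient_index" where
  "ambient_point t x \<rho> = (\<chi> I. case I of TDir \<Rightarrow> t | MDir i \<Rightarrow> x $ i | RhoDir \<Rightarrow> \<rho>)"

text \<open>The metric \<open>t\<^sup>2 \<gamma>\<^sub>i\<^sub>j(x, \<rho>) dx\<^sup>i \<odot> dx\<^sup>j + 2 \<rho> dt \<odot> dt + 2 t dt \<odot> d\<rho>\<close>:\<close>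

definition ambient_metric ::
  "(real^'m::finite \<Rightarrow> real \<Rightarrow> real^'m^'m) \<Rightarrow>
    real^'m ambient_index \<Rightarrow> real^'m ambient_index^'m ambient_index" where
  "ambient_metric \<gamma> P =
     (let t = P $ TDir; x = (\<chi> i. P $ MDir i); \<rho> = P $ RhoDir in
      \<chi> I J. case (I, J) of
          (MDir i, MDir j) \<Rightarrow> t\<^sup>2 * \<gamma> x \<rho> $ i $ j
        | (TDir, TDir) \<Rightarrow> 2 * \<rho>
        | (TDir, RhoDir) \<Rightarrow> t
        | (RhoDir, TDir) \<Rightarrow> t
        | _ \<Rightarrow> 0)"

text \<open>
  \<open>\<gamma>\<close> defines a Fefferman--Graham ambient metric, on a neighbourhood of \<open>\<rho> = 0\<close>, of the metric \<open>G\<close>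
  on the open set \<open>V\<close> of dimension \<open>CARD('m) = 2 n\<close>. The Ricci tensor is smooth, so the order
  of vanishing at \<open>\<rho> = 0\<close> can be tested for fixed \<open>t\<close> and \<open>x\<close>.
\<close>

definition fg_ambient ::
  "(real^'m::finite) set \<Rightarrow> (real^'m \<Rightarrow> real^'m^'m) \<Rightarrow>
    (real^'m \<Rightarrow> real \<Rightarrow> real^'m^'m) \<Rightarrow> bool" where
  "fg_ambient V G \<gamma> \<longleftrightarrow>
     (let n = CARD('m) div 2 in
      (\<exists>W. open W \<and> V \<times> {0} \<subseteq> W \<and> W \<subseteq> V \<times> UNIV \<and> smooth_on W (\<lambda>(x, \<rho>). \<gamma> x \<rho>) \<and>
         (\<forall>(x, \<rho>)\<in>W. transpose (\<gamma> x \<rho>) = \<gamma> x \<rho> \<and> invertible (\<gamma> x \<rho>))) \<and>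
      (\<forall>x\<in>V. \<gamma> x 0 = G x) \<and>
      (\<forall>t>0. \<forall>x\<in>V.
         (\<forall>I J. (\<lambda>\<rho>. ricci (ambient_metric \<gamma>) I J (ambient_point t x \<rho>))
                   \<in> O[at 0](\<lambda>\<rho>. \<rho> ^ (n - 1))) \<and>
         (\<lambda>\<rho>. \<Sum>i\<in>UNIV. \<Sum>j\<in>UNIV. matrix_inv (G x) $ i $ j *
                ricci (ambient_metric \<gamma>) (MDir i) (MDir j) (ambient_point t x \<rho>))
            \<in> O[at 0](\<lambda>\<rho>. \<rho> ^ n)))"

definition ambient_Q :: "(real^'m::finite \<Rightarrow> real \<Rightarrow> real^'m^'m) \<Rightarrow> real^'m \<Rightarrow> real" where
  "ambient_Q \<gamma> x =
     - (laplacian (ambient_metric \<gamma>) ^^ (CARD('m) div 2)) (\<lambda>P. ln (P $ TDir)) (ambient_point 1 x 0)"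

text \<open>
  The Q-curvature at \<open>w\<close> of a metric on an even-dimensional manifold: the common value of
  \<open>(- \<Delta>\<^sup>n log t)\<close> at \<open>\<rho> = 0\<close>, \<open>t = 1\<close> for all charts around \<open>w\<close> and all ambient metrics over
  coordinate neighbourhoods of \<open>w\<close> (the Q-curvature is a local invariant). To determine this
  number, one has to show both that such an ambient metric exists and that the value does not
  depend on the choices.
\<close>

definition Q_curvature :: "('b, 'm::finite) atlas \<Rightarrow> ('b, 'm) metric \<Rightarrow> 'b \<Rightarrow> real" where
  "Q_curvature B g w =
     (THE q. \<exists>c\<in>B. w \<in> fst c \<and>
        (\<exists>V \<gamma>. open V \<and> snd c w \<in> V \<and> V \<subseteq> snd c ` fst c \<and>
           fg_ambient V (metric_components B g c) \<gamma> \<and> q = ambient_Q \<gamma> (snd c w)))"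

end

theory Submission
  imports Defs
begin

text \<open>
  In coordinates \<open>(x, p)\<close> of the cotangent bundle an ambient metric of the Patterson--Walker metric
  is obtained by adding \<open>2 \<rho> / (n - 1) Ric\<^sub>a\<^sub>b dx\<^sup>a \<odot> dx\<^sup>b\<close> to it, where \<open>Ric\<close> is the (symmetrized) Ricci
  tensor of \<open>D\<close>: it is Ricci-flat, and its volume density does not depend on \<open>\<rho>\<close>. For an ambient
  metric given by \<open>\<gamma>\<close> one has \<open>\<Delta> log t = tr (\<gamma>\<inverse> \<partial>\<^sub>\<rho> \<gamma>) / (2 t\<^sup>2)\<close>, which therefore vanishes for the
  explicit one. An arbitrary ambient metric agrees with it to such an order in \<open>\<rho>\<close> (the Ricci
  condition determines the coefficients of \<open>\<rho>, \<dots>, \<rho>\<^bsup>n-1\<^esup>\<close> and the trace of that of \<open>\<rho>\<^sup>n\<close>) that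
  \<open>\<Delta> log t = O(\<rho>\<^sup>n)\<close>. Each further application of \<open>\<Delta>\<close> lowers the order of vanishing by at most one,
  because the component \<open>g\<^bsup>\<rho>\<rho>\<^esup> = - 2 \<rho> / t\<^sup>2\<close> of the inverse metric is itself \<open>O(\<rho>)\<close>, so that
  \<open>\<Delta>\<^sup>n log t = O(\<rho>)\<close>.
\<close>

section \<open>Smooth functions on open sets\<close>

text \<open>The obstacle is that an arbitrary ambient metric is not determined at order n: the Ricci
  condition leaves the trace-free part of that coefficient free. With m = 2n, suppose that two
  ambient metrics agree to order k. Modulo order k their Ricci tensors differ in the base directions
  by (k - m/2) E' - (T/2) h, where E' is the difference of the \<rho>-derivatives, T its trace and h
  the metric; the trace of this expression is (k - m) T. For k < n both factors are nonzero. At k =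
  n only the second one is, and T is exactly what \<Delta> log t sees. The explicit correction is 2
  \<rho> times the Schouten tensor of the Patterson--Walker metric, whose scalar curvature vanishes
  and whose Ricci tensor is twice the symmetrized one of D. The expansion stops after this term
  because it has only dx dx components, on which the inverse metric vanishes, so that products
  quadratic in it are zero. Orders in \<rho> are measured by iterated \<rho>-derivatives on \<rho> =
  0, which avoids dividing by powers of \<rho>.\<close>

lemma frechet_derivative_eq:
  "(f has_derivative f') (at x) \<Longrightarrow> frechet_derivative f (at x) = f'"
  using frechet_derivative_at by metis

text \<open>\<open>frechet_derivative\<close> is a choice among all derivatives at the point. Near x
  both functions admit the same ones, so the chosen values agree even where there is none.\<close>

lemma frechet_derivative_cong_open:
  assumes "open S" "x \<in> S" "\<And>y. y \<in> S \<Longrightarrow> f y = g y"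
  shows "frechet_derivative f (at x) = frechet_derivative g (at x)"
proof -
  have "(f has_derivative d) (at x) \<longleftrightarrow> (g has_derivative d) (at x)" for d
    using has_derivative_transform_within_open[OF _ assms(1,2), of f d UNIV g]
      has_derivative_transform_within_open[OF _ assms(1,2), of g d UNIV f] assms(3) by auto
  then show ?thesis
    unfolding frechet_derivative_def by simp
qed

lemma differentiable_cong_open:
  assumes "open S" "x \<in> S" "\<And>y. y \<in> S \<Longrightarrow> f y = g y"
  shows "f differentiable (at x) \<longleftrightarrow> g differentiable (at x)"
proof -
  have "(f has_derivative d) (at x) \<longleftrightarrow> (g has_derivative d) (at x)" for d
    using has_derivative_transform_within_open[OF _ assms(1,2), of f d UNIV g]
      has_derivative_transform_within_open[OF _ assms(1,2), of g d UNIV f] assms(3) by auto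
  then show ?thesis
    unfolding differentiable_def by simp
qed

lemma k_smooth_on_cong:
  assumes "open S" "\<And>x. x \<in> S \<Longrightarrow> f x = g x"
  shows "k_smooth_on k S f \<longleftrightarrow> k_smooth_on k S g"
  using assms(2)
proof (induction k arbitrary: f g)
  case 0
  then show ?case by (simp cong: continuous_on_cong)
next
  case (Suc k)
  have "k_smooth_on k S (\<lambda>x. frechet_derivative f (at x) v) \<longleftrightarrow>
      k_smooth_on k S (\<lambda>x. frechet_derivative g (at x) v)" for v
    by (rule Suc.IH) (use frechet_derivative_cong_open[OF assms(1) _ Suc.prems] in simp)
  moreover have "f differentiable (at x) \<longleftrightarrow> g differentiable (at x)" if "x \<in> S" for x
    using differentiable_cong_open[OF assms(1) that Suc.prems] .
  ultimately show ?case by simp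
qed

lemma smooth_on_cong:
  assumes "open S" "\<And>x. x \<in> S \<Longrightarrow> f x = g x"
  shows "smooth_on S f \<longleftrightarrow> smooth_on S g"
  using k_smooth_on_cong[OF assms] by (simp add: smooth_on_def)

text \<open>Order \<open>Suc k\<close> speaks only of differentiability and of the derivatives; that
  f itself has order k comes down to differentiability implying continuity.\<close>

lemma k_smooth_on_SucD: "k_smooth_on (Suc k) S f \<Longrightarrow> k_smooth_on k S f"
proof (induction k arbitrary: f)
  case 0
  then show ?case
    by (auto simp: differentiable_imp_continuous_within intro!: continuous_at_imp_continuous_on)
next
  case (Suc k)
  then show ?case by (metis k_smooth_on.simps(2))
qed

lemma smooth_on_differentiable: "smooth_on S f \<Longrightarrow> x \<in> S \<Longrightarrow> f differentiable (at x)"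
  unfolding smooth_on_def by (metis k_smooth_on.simps(2))

lemma smooth_on_has_derivative:
  "smooth_on S f \<Longrightarrow> x \<in> S \<Longrightarrow> (f has_derivative frechet_derivative f (at x)) (at x)"
  using smooth_on_differentiable frechet_derivative_works by blast

lemma smooth_on_continuous: "smooth_on S f \<Longrightarrow> continuous_on S f"
  unfolding smooth_on_def by (metis k_smooth_on.simps(1))

lemma smooth_on_frechet_derivative:
  "smooth_on S f \<Longrightarrow> smooth_on S (\<lambda>x. frechet_derivative f (at x) v)"
  unfolding smooth_on_def by (metis k_smooth_on.simps(2))

lemma k_smooth_on_has_derivative:
  "k_smooth_on (Suc k) S f \<Longrightarrow> x \<in> S \<Longrightarrow>
    (f has_derivative frechet_derivative f (at x)) (at x)"
  by (simp add: frechet_derivative_works)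

section \<open>Closure properties of smoothness\<close>

lemma k_smooth_on_const: "k_smooth_on k S (\<lambda>_. c)"
  by (induction k arbitrary: c) auto

lemma k_smooth_on_bounded_linear:
  assumes "open S" "bounded_linear L" "k_smooth_on k S f"
  shows "k_smooth_on k S (\<lambda>x. L (f x))"
  using assms(3)
proof (induction k arbitrary: f)
  case 0
  then show ?case using assms(2) by (simp add: bounded_linear.continuous_on)
next
  case (Suc k)
  have D: "((\<lambda>x. L (f x)) has_derivative (\<lambda>v. L (frechet_derivative f (at x) v))) (at x)"
    if "x \<in> S" for x
    using bounded_linear.has_derivative[OF assms(2) k_smooth_on_has_derivative[OF Suc.prems that]] .
  have "k_smooth_on k S (\<lambda>x. L (frechet_derivative f (at x) v))" for v
    using Suc by simp
  then have "k_smooth_on k S (\<lambda>x. frechet_derivative (\<lambda>x. L (f x)) (at x) v)" for v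
    by (subst k_smooth_on_cong[OF assms(1), where g = "\<lambda>x. L (frechet_derivative f (at x) v)"])
      (simp_all add: frechet_derivative_eq[OF D])
  then show ?case using D by (auto simp: differentiable_def)
qed

lemma k_smooth_on_add:
  assumes "open S" "k_smooth_on k S f" "k_smooth_on k S g"
  shows "k_smooth_on k S (\<lambda>x. f x + g x)"
  using assms(2,3)
proof (induction k arbitrary: f g)
  case 0
  then show ?case by (simp add: continuous_on_add)
next
  case (Suc k)
  have D: "((\<lambda>x. f x + g x) has_derivative
      (\<lambda>v. frechet_derivative f (at x) v + frechet_derivative g (at x) v)) (at x)"
    if "x \<in> S" for x
    using has_derivative_add[OF k_smooth_on_has_derivative[OF Suc.prems(1) that]
        k_smooth_on_has_derivative[OF Suc.prems(2) that]] .
  have "k_smooth_on k S (\<lambda>x. frechet_derivative f (at x) v + frechet_derivative g (at x) v)" for v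
    using Suc by simp
  then have "k_smooth_on k S (\<lambda>x. frechet_derivative (\<lambda>x. f x + g x) (at x) v)" for v
    by (subst k_smooth_on_cong[OF assms(1), where
          g = "\<lambda>x. frechet_derivative f (at x) v + frechet_derivative g (at x) v"])
      (simp_all add: frechet_derivative_eq[OF D])
  then show ?case using D by (auto simp: differentiable_def)
qed

lemma k_smooth_on_scaleR:
  fixes a :: "'a::real_normed_vector \<Rightarrow> real"
  assumes "open S" "k_smooth_on k S a" "k_smooth_on k S f"
  shows "k_smooth_on k S (\<lambda>x. a x *\<^sub>R f x)"
  using assms(2,3)
proof (induction k arbitrary: a f)
  case 0
  then show ?case by (simp add: continuous_on_scaleR)
next
  case (Suc k)
  have D: "((\<lambda>x. a x *\<^sub>R f x) has_derivative
      (\<lambda>v. a x *\<^sub>R frechet_derivative f (at x) v + frechet_derivative a (at x) v *\<^sub>R f x)) (at x)"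
    if "x \<in> S" for x
    using has_derivative_scaleR[OF k_smooth_on_has_derivative[OF Suc.prems(1) that]
        k_smooth_on_has_derivative[OF Suc.prems(2) that]] .
  have "k_smooth_on k S
      (\<lambda>x. a x *\<^sub>R frechet_derivative f (at x) v + frechet_derivative a (at x) v *\<^sub>R f x)" for v
    using Suc.prems k_smooth_on_SucD[OF Suc.prems(1)] k_smooth_on_SucD[OF Suc.prems(2)]
    by (intro k_smooth_on_add assms(1) Suc.IH) auto
  then have "k_smooth_on k S (\<lambda>x. frechet_derivative (\<lambda>x. a x *\<^sub>R f x) (at x) v)" for v
    by (subst k_smooth_on_cong[OF assms(1), where
          g = "\<lambda>x. a x *\<^sub>R frechet_derivative f (at x) v + frechet_derivative a (at x) v *\<^sub>R f x"])
      (simp_all add: frechet_derivative_eq[OF D])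
  then show ?case using D by (auto simp: differentiable_def)
qed

lemma k_smooth_on_sum:
  assumes "open S" "\<And>i. i \<in> I \<Longrightarrow> k_smooth_on k S (f i)"
  shows "k_smooth_on k S (\<lambda>x. \<Sum>i\<in>I. f i x)"
  using assms(2)
  by (induction I rule: infinite_finite_induct)
    (auto simp: k_smooth_on_const intro!: k_smooth_on_add assms(1))

text \<open>Only derivatives along a fixed vector are known to be smooth, whereas the chain rule
  applies the derivative of f to the moving vector h'(x) v. Expanding this vector in the basis
  separates the two dependences on x, which is why the middle space is Euclidean.\<close>

lemma k_smooth_on_compose:
  fixes h :: "'a::real_normed_vector \<Rightarrow> 'b::euclidean_space"
    and f :: "'b \<Rightarrow> 'c::real_normed_vector"
  assumes "open S" "open T" "h ` S \<subseteq> T" "k_smooth_on k S h" "k_smooth_on k T f"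
  shows "k_smooth_on k S (\<lambda>x. f (h x))"
  using assms(4,5)
proof (induction k arbitrary: f)
  case 0
  then show ?case using assms(3) by (auto intro: continuous_on_compose2)
next
  case (Suc k)
  have D: "((\<lambda>x. f (h x)) has_derivative
      (\<lambda>v. \<Sum>b\<in>Basis. (frechet_derivative h (at x) v \<bullet> b) *\<^sub>R frechet_derivative f (at (h x)) b)) (at x)"
    if "x \<in> S" for x
  proof -
    have f: "(f has_derivative frechet_derivative f (at (h x))) (at (h x))"
      using k_smooth_on_has_derivative[OF Suc.prems(2)] that assms(3) by blast
    have h: "(h has_derivative frechet_derivative h (at x)) (at x)"
      using k_smooth_on_has_derivative[OF Suc.prems(1) that] .
    note lin = has_derivative_linear[OF f]
    have expand: "frechet_derivative f (at (h x)) w =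
        (\<Sum>b\<in>Basis. (w \<bullet> b) *\<^sub>R frechet_derivative f (at (h x)) b)" for w
    proof -
      have "frechet_derivative f (at (h x)) w =
          frechet_derivative f (at (h x)) (\<Sum>b\<in>Basis. (w \<bullet> b) *\<^sub>R b)"
        by (simp only: euclidean_representation)
      then show ?thesis by (simp only: linear_sum[OF lin] linear_cmul[OF lin])
    qed
    have "frechet_derivative f (at (h x)) \<circ> frechet_derivative h (at x) =
      (\<lambda>v. \<Sum>b\<in>Basis. (frechet_derivative h (at x) v \<bullet> b) *\<^sub>R frechet_derivative f (at (h x)) b)"
      unfolding o_def by (rule ext) (rule expand)
    then show ?thesis
      using diff_chain_at[OF h f] by (simp only: o_def)
  qed
  have "k_smooth_on k S (\<lambda>x. \<Sum>b\<in>Basis.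
      (frechet_derivative h (at x) v \<bullet> b) *\<^sub>R frechet_derivative f (at (h x)) b)" for v
  proof (intro k_smooth_on_sum assms(1) k_smooth_on_scaleR)
    fix b :: 'b
    show "k_smooth_on k S (\<lambda>x. frechet_derivative h (at x) v \<bullet> b)"
      using Suc.prems(1)
      by (intro k_smooth_on_bounded_linear[where L = "\<lambda>w. w \<bullet> b"] assms(1) bounded_linear_inner_left) auto
    show "k_smooth_on k S (\<lambda>x. frechet_derivative f (at (h x)) b)"
      using k_smooth_on_SucD[OF Suc.prems(1)] Suc.prems(2)
      by (intro Suc.IH[where f = "\<lambda>y. frechet_derivative f (at y) b"]) auto
  qed
  then have "k_smooth_on k S (\<lambda>x. frechet_derivative (\<lambda>x. f (h x)) (at x) v)" for v
    by (subst k_smooth_on_cong[OF assms(1), where g = "\<lambda>x. \<Sum>b\<in>Basis.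
      (frechet_derivative h (at x) v \<bullet> b) *\<^sub>R frechet_derivative f (at (h x)) b"])
      (simp_all add: frechet_derivative_eq[OF D])
  then show ?case using D by (auto simp: differentiable_def)
qed

lemma smooth_on_const: "smooth_on S (\<lambda>_. c)"
  by (simp add: smooth_on_def k_smooth_on_const)

lemma smooth_on_bounded_linear:
  "open S \<Longrightarrow> bounded_linear L \<Longrightarrow> smooth_on S f \<Longrightarrow> smooth_on S (\<lambda>x. L (f x))"
  by (simp add: smooth_on_def k_smooth_on_bounded_linear)

lemma smooth_on_ident: "smooth_on S (\<lambda>x. x)"
proof -
  have "k_smooth_on k S (\<lambda>x. x)" for k
    by (cases k) (auto simp: k_smooth_on_const)
  then show ?thesis by (simp add: smooth_on_def)
qed

lemma smooth_on_linear_map: "open S \<Longrightarrow> bounded_linear L \<Longrightarrow> smooth_on S L"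
  using smooth_on_bounded_linear[OF _ _ smooth_on_ident] .

lemma smooth_on_add:
  "open S \<Longrightarrow> smooth_on S f \<Longrightarrow> smooth_on S g \<Longrightarrow> smooth_on S (\<lambda>x. f x + g x)"
  by (simp add: smooth_on_def k_smooth_on_add)

lemma smooth_on_scaleR:
  fixes a :: "'a::real_normed_vector \<Rightarrow> real"
  shows "open S \<Longrightarrow> smooth_on S a \<Longrightarrow> smooth_on S f \<Longrightarrow> smooth_on S (\<lambda>x. a x *\<^sub>R f x)"
  by (simp add: smooth_on_def k_smooth_on_scaleR)

lemma smooth_on_mult:
  fixes f g :: "'a::real_normed_vector \<Rightarrow> real"
  shows "open S \<Longrightarrow> smooth_on S f \<Longrightarrow> smooth_on S g \<Longrightarrow> smooth_on S (\<lambda>x. f x * g x)"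
  using smooth_on_scaleR[of S f g] by simp

lemma smooth_on_minus: "open S \<Longrightarrow> smooth_on S f \<Longrightarrow> smooth_on S (\<lambda>x. - f x)"
  using smooth_on_bounded_linear[OF _ bounded_linear_minus[OF bounded_linear_ident]] .

lemma smooth_on_diff:
  "open S \<Longrightarrow> smooth_on S f \<Longrightarrow> smooth_on S g \<Longrightarrow> smooth_on S (\<lambda>x. f x - g x)"
  using smooth_on_add[OF _ _ smooth_on_minus, of S f g] by simp

lemma smooth_on_sum:
  "open S \<Longrightarrow> (\<And>i. i \<in> I \<Longrightarrow> smooth_on S (f i)) \<Longrightarrow> smooth_on S (\<lambda>x. \<Sum>i\<in>I. f i x)"
  by (simp add: smooth_on_def k_smooth_on_sum)

lemma smooth_on_prod:
  fixes f :: "'i \<Rightarrow> 'a::real_normed_vector \<Rightarrow> real"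
  assumes "open S" "\<And>i. i \<in> I \<Longrightarrow> smooth_on S (f i)"
  shows "smooth_on S (\<lambda>x. \<Prod>i\<in>I. f i x)"
  using assms(2)
  by (induction I rule: infinite_finite_induct)
    (auto simp: smooth_on_const intro!: smooth_on_mult assms(1))

lemma smooth_on_compose:
  fixes h :: "'a::real_normed_vector \<Rightarrow> 'b::euclidean_space"
  shows "open S \<Longrightarrow> open T \<Longrightarrow> h ` S \<subseteq> T \<Longrightarrow> smooth_on S h \<Longrightarrow> smooth_on T f \<Longrightarrow>
    smooth_on S (\<lambda>x. f (h x))"
  by (simp add: smooth_on_def k_smooth_on_compose)

text \<open>The derivative of 1/f is -(1/f) f' (1/f), so order k of 1/f yields order k + 1, f' being
  smooth of every order.\<close>

lemma smooth_on_inverse: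
  fixes f :: "'a::real_normed_vector \<Rightarrow> real"
  assumes "open S" "smooth_on S f" "\<And>x. x \<in> S \<Longrightarrow> f x \<noteq> 0"
  shows "smooth_on S (\<lambda>x. inverse (f x))"
proof -
  have D: "((\<lambda>x. inverse (f x)) has_derivative
      (\<lambda>v. - (inverse (f x) * frechet_derivative f (at x) v * inverse (f x)))) (at x)"
    if "x \<in> S" for x
    using Deriv.has_derivative_inverse[OF assms(3) smooth_on_has_derivative[OF assms(2)], OF that that] .
  have "k_smooth_on k S (\<lambda>x. inverse (f x))" for k
  proof (induction k)
    case 0
    then show ?case
      using assms smooth_on_continuous by (auto intro!: continuous_on_inverse)
  next
    case (Suc k)
    have "k_smooth_on k S (\<lambda>x. frechet_derivative f (at x) v)" for v
      using smooth_on_frechet_derivative[OF assms(2)] by (simp add: smooth_on_def)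
    note * = k_smooth_on_scaleR[OF assms(1) k_smooth_on_scaleR[OF assms(1) Suc this] Suc]
    have "k_smooth_on k S (\<lambda>x. - (inverse (f x) * frechet_derivative f (at x) v * inverse (f x)))" for v
      using k_smooth_on_bounded_linear[OF assms(1) bounded_linear_minus[OF bounded_linear_ident] *[of v]]
      by simp
    then have "k_smooth_on k S (\<lambda>x. frechet_derivative (\<lambda>x. inverse (f x)) (at x) v)" for v
      by (subst k_smooth_on_cong[OF assms(1), where
            g = "\<lambda>x. - (inverse (f x) * frechet_derivative f (at x) v * inverse (f x))"])
        (simp_all add: frechet_derivative_eq[OF D])
    then show ?case using D by (auto simp: differentiable_def)
  qed
  then show ?thesis by (simp add: smooth_on_def)
qed

lemma smooth_on_divide:
  fixes f g :: "'a::real_normed_vector \<Rightarrow> real"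
  assumes "open S" "smooth_on S f" "smooth_on S g" "\<And>x. x \<in> S \<Longrightarrow> g x \<noteq> 0"
  shows "smooth_on S (\<lambda>x. f x / g x)"
  using smooth_on_mult[OF assms(1,2) smooth_on_inverse[OF assms(1,3,4)]]
  by (simp add: divide_inverse)

lemma smooth_on_power:
  fixes f :: "'a::real_normed_vector \<Rightarrow> real"
  shows "open S \<Longrightarrow> smooth_on S f \<Longrightarrow> smooth_on S (\<lambda>x. f x ^ k)"
  by (induction k) (auto intro: smooth_on_const smooth_on_mult)

lemma smooth_on_vec_nth: "open S \<Longrightarrow> smooth_on S f \<Longrightarrow> smooth_on S (\<lambda>x. f x $ i)"
  using smooth_on_bounded_linear[OF _ bounded_linear_vec_nth] .

lemma smooth_on_coord: "open S \<Longrightarrow> smooth_on S (\<lambda>x. x $ i)"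
  by (rule smooth_on_linear_map[OF _ bounded_linear_vec_nth])

lemma smooth_on_vec:
  fixes f :: "'a::real_normed_vector \<Rightarrow> 'b::euclidean_space^'n"
  assumes "open S" "\<And>i. smooth_on S (\<lambda>x. f x $ i)"
  shows "smooth_on S f"
proof -
  have "bounded_linear (axis i :: 'b \<Rightarrow> 'b^'n)" for i
    unfolding linear_conv_bounded_linear[symmetric]
    by (rule linearI) (auto simp: vec_eq_iff axis_def)
  then have "smooth_on S (\<lambda>x. \<Sum>i\<in>UNIV. axis i (f x $ i))"
    by (intro smooth_on_sum smooth_on_bounded_linear[where L = "axis _"] assms)
  moreover have "(\<Sum>i\<in>UNIV. axis i (f x $ i)) = f x" for x
    by (simp add: vec_eq_iff axis_def)
  ultimately show ?thesis by simp
qed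

lemma smooth_on_det:
  fixes A :: "'a::real_normed_vector \<Rightarrow> real^'n^'n"
  assumes "open S" "\<And>i j. smooth_on S (\<lambda>x. A x $ i $ j)"
  shows "smooth_on S (\<lambda>x. det (A x))"
  unfolding det_def
  by (intro smooth_on_sum smooth_on_mult smooth_on_const smooth_on_prod assms)

section \<open>Inverse matrices depend smoothly on their entries\<close>

lemma
  fixes A :: "real^'n^'n"
  assumes "invertible A"
  shows matrix_inv_right: "A ** matrix_inv A = mat 1"
    and matrix_inv_left: "matrix_inv A ** A = mat 1"
  using assms unfolding invertible_def matrix_inv_def by (metis (mono_tags, lifting) someI_ex)+

text \<open>Cramer's rule makes each entry of the inverse a rational function of the entries of the
  matrix, which gives its smoothness.\<close>

lemma matrix_inv_entry:
  fixes A :: "real^'n^'n"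
  assumes "invertible A"
  shows "matrix_inv A $ i $ j =
    det (\<chi> a b. if b = i then axis j 1 $ a else A $ a $ b) / det A"
proof -
  have "A *v (matrix_inv A *v axis j 1) = axis j 1"
    using matrix_inv_right[OF assms] by (simp add: matrix_vector_mul_assoc)
  then have "matrix_inv A *v axis j 1 =
      (\<chi> k. det (\<chi> a b. if b = k then axis j 1 $ a else A $ a $ b) / det A)"
    using assms unfolding invertible_det_nz by (subst (asm) cramer)
  moreover have "(matrix_inv A *v axis j 1) $ i = matrix_inv A $ i $ j"
    by (simp add: matrix_vector_mul_component inner_axis)
  ultimately show ?thesis by simp
qed

lemma smooth_on_matrix_inv:
  fixes A :: "'a::real_normed_vector \<Rightarrow> real^'n^'n"
  assumes "open S" "\<And>i j. smooth_on S (\<lambda>x. A x $ i $ j)" "\<And>x. x \<in> S \<Longrightarrow> invertible (A x)"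
  shows "smooth_on S (\<lambda>x. matrix_inv (A x) $ i $ j)"
proof -
  have "smooth_on S (\<lambda>x. det (\<chi> a b. if b = i then axis j 1 $ a else A x $ a $ b) / det (A x))"
  proof (intro smooth_on_divide smooth_on_det assms)
    fix a b
    show "smooth_on S (\<lambda>x. (\<chi> a b. if b = i then axis j 1 $ a else A x $ a $ b) $ a $ b)"
      by (cases "b = i") (auto intro: smooth_on_const assms)
  qed (use assms(3) in \<open>auto simp: invertible_det_nz\<close>)
  then show ?thesis
    by (subst smooth_on_cong[OF assms(1) matrix_inv_entry[OF assms(3)]])
qed

section \<open>Symmetry of second derivatives\<close>

lemma bounded_vector_segment:
  fixes x u v :: "'a::real_normed_vector"
  assumes "e > 0"
  shows "\<exists>s>0. \<forall>a b. \<bar>a\<bar> \<le> s \<longrightarrow> \<bar>b\<bar> \<le> s \<longrightarrow> dist x (x + a *\<^sub>R u + b *\<^sub>R v) < e"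
proof -
  \<comment> \<open>The \<open>+ 1\<close> keeps the denominator positive also for u = v =
    0.\<close>
  define s where "s = e / (2 * (norm u + norm v + 1))"
  have n: "norm u + norm v + 1 > 0"
    using norm_ge_zero[of u] norm_ge_zero[of v] by linarith
  have s: "s > 0" using assms n by (simp add: s_def)
  have se: "s * (norm u + norm v + 1) = e / 2"
    using n by (simp add: s_def field_simps)
  have "dist x (x + a *\<^sub>R u + b *\<^sub>R v) < e" if "\<bar>a\<bar> \<le> s" "\<bar>b\<bar> \<le> s" for a b
  proof -
    have "dist x (x + a *\<^sub>R u + b *\<^sub>R v) = norm (a *\<^sub>R u + b *\<^sub>R v)"
      unfolding dist_norm by (subst norm_minus_commute) (simp add: add.assoc)
    also have "\<dots> \<le> \<bar>a\<bar> * norm u + \<bar>b\<bar> * norm v"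
      by (metis norm_scaleR norm_triangle_ineq)
    also have "\<dots> \<le> s * norm u + s * norm v"
      using that by (intro add_mono mult_right_mono) auto
    also have "\<dots> \<le> e / 2" using se s by (simp add: algebra_simps)
    finally show ?thesis using assms by simp
  qed
  with s show ?thesis by blast
qed

text \<open>The second difference is symmetric in u and v, the mixed derivative is not visibly so.
  Two applications of the mean value theorem, along u and then along v, connect them; the same with
  exchanged roles gives the other mixed derivative.\<close>

lemma second_difference_mvt:
  fixes f :: "'a::real_normed_vector \<Rightarrow> real"
  assumes "open S" "smooth_on S f" "s > 0"
    and seg: "\<And>a b. \<bar>a\<bar> \<le> s \<Longrightarrow> \<bar>b\<bar> \<le> s \<Longrightarrow> x + a *\<^sub>R u + b *\<^sub>R v \<in> S"
  obtains a b where "\<bar>a\<bar> \<le> s" "\<bar>b\<bar> \<le> s"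
    "f (x + s *\<^sub>R u + s *\<^sub>R v) - f (x + s *\<^sub>R u) - f (x + s *\<^sub>R v) + f x =
      s * s * frechet_derivative (\<lambda>y. frechet_derivative f (at y) u) (at (x + a *\<^sub>R u + b *\<^sub>R v)) v"
proof -
  have D: "((\<lambda>a. f (x + a *\<^sub>R u + b *\<^sub>R v)) has_real_derivative
      frechet_derivative f (at (x + a *\<^sub>R u + b *\<^sub>R v)) u) (at a)"
    if "\<bar>a\<bar> \<le> s" "\<bar>b\<bar> \<le> s" for a b
  proof -
    have f: "(f has_derivative frechet_derivative f (at (x + a *\<^sub>R u + b *\<^sub>R v)))
        (at (x + a *\<^sub>R u + b *\<^sub>R v))"
      using smooth_on_has_derivative[OF assms(2) seg[OF that]] .
    have "((\<lambda>a. x + a *\<^sub>R u + b *\<^sub>R v) has_derivative (\<lambda>r. r *\<^sub>R u)) (at a)"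
      by (auto intro!: derivative_eq_intros)
    from diff_chain_at[OF this f]
    show ?thesis
      using linear_cmul[OF has_derivative_linear[OF f]]
      by (simp add: has_field_derivative_def o_def mult_commute_abs)
  qed
  \<comment> \<open>The increment along v as a function of the position along u. The summand
    \<open>0 *\<^sub>R v\<close> is kept so that \<open>D\<close> applies to both terms.\<close>
  let ?g = "\<lambda>a. f (x + a *\<^sub>R u + s *\<^sub>R v) - f (x + a *\<^sub>R u + 0 *\<^sub>R v)"
  let ?g' = "\<lambda>a. frechet_derivative f (at (x + a *\<^sub>R u + s *\<^sub>R v)) u -
    frechet_derivative f (at (x + a *\<^sub>R u + 0 *\<^sub>R v)) u"
  have "\<exists>a>0. a < s \<and> ?g s - ?g 0 = (s - 0) * ?g' a"
    using assms(3) by (intro MVT2 DERIV_diff D) auto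
  then obtain a where a: "0 < a" "a < s" "?g s - ?g 0 = s * ?g' a"
    by auto
  let ?h = "\<lambda>b. frechet_derivative f (at (x + a *\<^sub>R u + b *\<^sub>R v)) u"
  let ?h' = "\<lambda>b. frechet_derivative (\<lambda>y. frechet_derivative f (at y) u) (at (x + a *\<^sub>R u + b *\<^sub>R v)) v"
  have "\<exists>b>0. b < s \<and> ?h s - ?h 0 = (s - 0) * ?h' b"
  proof (intro MVT2 assms(3))
    fix b assume b: "0 \<le> b" "b \<le> s"
    let ?F = "\<lambda>y. frechet_derivative f (at y) u"
    have f: "(?F has_derivative frechet_derivative ?F (at (x + a *\<^sub>R u + b *\<^sub>R v)))
        (at (x + a *\<^sub>R u + b *\<^sub>R v))"
      using smooth_on_has_derivative[OF smooth_on_frechet_derivative[OF assms(2)] seg] a b by simp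
    have "((\<lambda>b. x + a *\<^sub>R u + b *\<^sub>R v) has_derivative (\<lambda>r. r *\<^sub>R v)) (at b)"
      by (auto intro!: derivative_eq_intros)
    from diff_chain_at[OF this f]
    show "(?h has_real_derivative ?h' b) (at b)"
      using linear_cmul[OF has_derivative_linear[OF f]]
      by (simp add: has_field_derivative_def o_def mult_commute_abs)
  qed
  then obtain b where b: "0 < b" "b < s" "?h s - ?h 0 = s * ?h' b"
    by auto
  have "?g s - ?g 0 = s * (s * ?h' b)"
    using a(3) b(3) by simp
  then show ?thesis
    using that[of a b] a b by (simp add: algebra_simps)
qed

text \<open>If the mixed derivatives differed at x, continuity would keep their values apart on a
  small parallelogram around x; but there each of them attains somewhere the same second difference
  divided by s^2.\<close>

lemma frechet_derivative_commute:
  fixes f :: "'a::real_normed_vector \<Rightarrow> real"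
  assumes "open S" "smooth_on S f" "x \<in> S"
  shows "frechet_derivative (\<lambda>y. frechet_derivative f (at y) u) (at x) v =
    frechet_derivative (\<lambda>y. frechet_derivative f (at y) v) (at x) u"
proof (rule ccontr)
  let ?A = "\<lambda>y. frechet_derivative (\<lambda>y. frechet_derivative f (at y) u) (at y) v"
  let ?B = "\<lambda>y. frechet_derivative (\<lambda>y. frechet_derivative f (at y) v) (at y) u"
  assume "?A x \<noteq> ?B x"
  define e where "e = \<bar>?A x - ?B x\<bar> / 2"
  have e: "e > 0" using \<open>?A x \<noteq> ?B x\<close> by (simp add: e_def)
  have "isCont ?A x" "isCont ?B x"
    using smooth_on_continuous[OF smooth_on_frechet_derivative[OF smooth_on_frechet_derivative[OF assms(2)]]]
      assms(1,3) continuous_on_eq_continuous_at by blast+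
  then obtain d1 d2 where d: "d1 > 0" "\<And>y. dist y x < d1 \<Longrightarrow> dist (?A y) (?A x) < e"
    "d2 > 0" "\<And>y. dist y x < d2 \<Longrightarrow> dist (?B y) (?B x) < e"
    using e unfolding continuous_at_eps_delta by metis
  obtain d3 where d3: "d3 > 0" "ball x d3 \<subseteq> S"
    using assms(1,3) open_contains_ball by blast
  obtain s where s: "s > 0"
    "\<And>a b. \<bar>a\<bar> \<le> s \<Longrightarrow> \<bar>b\<bar> \<le> s \<Longrightarrow> dist x (x + a *\<^sub>R u + b *\<^sub>R v) < min d1 (min d2 d3)"
    using bounded_vector_segment[of "min d1 (min d2 d3)" x u v] d d3 by auto
  have S: "x + a *\<^sub>R u + b *\<^sub>R v \<in> S" if "\<bar>a\<bar> \<le> s" "\<bar>b\<bar> \<le> s" for a b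
    using s(2)[OF that] d3 by (auto simp: subset_iff)
  obtain a b where ab: "\<bar>a\<bar> \<le> s" "\<bar>b\<bar> \<le> s"
    "f (x + s *\<^sub>R u + s *\<^sub>R v) - f (x + s *\<^sub>R u) - f (x + s *\<^sub>R v) + f x =
      s * s * ?A (x + a *\<^sub>R u + b *\<^sub>R v)"
    using second_difference_mvt[OF assms(1,2) s(1) S] by blast
  have S': "x + b *\<^sub>R v + a *\<^sub>R u \<in> S" if "\<bar>b\<bar> \<le> s" "\<bar>a\<bar> \<le> s" for a b
    using S[of a b] that by (simp add: algebra_simps)
  obtain b' a' where ab': "\<bar>b'\<bar> \<le> s" "\<bar>a'\<bar> \<le> s"
    "f (x + s *\<^sub>R v + s *\<^sub>R u) - f (x + s *\<^sub>R v) - f (x + s *\<^sub>R u) + f x =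
      s * s * ?B (x + b' *\<^sub>R v + a' *\<^sub>R u)"
    using second_difference_mvt[OF assms(1,2) s(1) S'] by blast
  have "s * s * ?A (x + a *\<^sub>R u + b *\<^sub>R v) = s * s * ?B (x + a' *\<^sub>R u + b' *\<^sub>R v)"
    using ab(3) ab'(3) by (simp add: algebra_simps)
  then have eq: "?A (x + a *\<^sub>R u + b *\<^sub>R v) = ?B (x + a' *\<^sub>R u + b' *\<^sub>R v)"
    using s(1) by simp
  have "dist (?A (x + a *\<^sub>R u + b *\<^sub>R v)) (?A x) < e" "dist (?B (x + a' *\<^sub>R u + b' *\<^sub>R v)) (?B x) < e"
    using d(2)[of "x + a *\<^sub>R u + b *\<^sub>R v"] d(4)[of "x + a' *\<^sub>R u + b' *\<^sub>R v"]
      s(2)[OF ab(1,2)] s(2)[OF ab'(2,1)] by (simp_all add: dist_commute)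
  with eq show False
    unfolding e_def dist_real_def by (auto simp: abs_if split: if_splits)
qed

section \<open>Partial derivatives and order of vanishing\<close>

lemma partial_cong:
  assumes "open S" "x \<in> S" "\<And>y. y \<in> S \<Longrightarrow> f y = g y"
  shows "partial i f x = partial i g x"
  using frechet_derivative_cong_open[OF assms] by simp

lemma partial_add:
  assumes "smooth_on S f" "smooth_on S g" "x \<in> S"
  shows "partial i (\<lambda>y. f y + g y) x = partial i f x + partial i g x"
  by (simp add: frechet_derivative_eq[OF has_derivative_add[OF
        smooth_on_has_derivative[OF assms(1,3)] smooth_on_has_derivative[OF assms(2,3)]]])

lemma partial_diff:
  assumes "smooth_on S f" "smooth_on S g" "x \<in> S"
  shows "partial i (\<lambda>y. f y - g y) x = partial i f x - partial i g x"
  by (simp add: frechet_derivative_eq[OF has_derivative_diff[OF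
        smooth_on_has_derivative[OF assms(1,3)] smooth_on_has_derivative[OF assms(2,3)]]])

lemma partial_minus:
  assumes "smooth_on S f" "x \<in> S"
  shows "partial i (\<lambda>y. - f y) x = - partial i f x"
  by (simp add: frechet_derivative_eq[OF has_derivative_minus[OF smooth_on_has_derivative[OF assms]]])

lemma partial_mult:
  fixes f g :: "real^'k::finite \<Rightarrow> real"
  assumes "smooth_on S f" "smooth_on S g" "x \<in> S"
  shows "partial i (\<lambda>y. f y * g y) x = partial i f x * g x + f x * partial i g x"
  by (simp add: frechet_derivative_eq[OF has_derivative_mult[OF
        smooth_on_has_derivative[OF assms(1,3)] smooth_on_has_derivative[OF assms(2,3)]]])

lemma partial_cmult:
  fixes f :: "real^'k::finite \<Rightarrow> real"
  assumes "smooth_on S f" "x \<in> S"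
  shows "partial i (\<lambda>y. c * f y) x = c * partial i f x"
  using partial_mult[OF smooth_on_const assms] by simp

lemma partial_sum:
  assumes "\<And>a. a \<in> A \<Longrightarrow> smooth_on S (f a)" "x \<in> S"
  shows "partial i (\<lambda>y. \<Sum>a\<in>A. f a y) x = (\<Sum>a\<in>A. partial i (f a) x)"
  by (simp add: frechet_derivative_eq[OF has_derivative_sum[OF
        smooth_on_has_derivative[OF assms]]])

lemma partial_coord: "partial i (\<lambda>y. y $ j) x = (if i = j then 1 else 0)"
proof -
  have "((\<lambda>y. y $ j) has_derivative (\<lambda>y. y $ j)) (at x)"
    by (rule bounded_linear_imp_has_derivative[OF bounded_linear_vec_nth])
  from frechet_derivative_eq[OF this] show ?thesis
    by (simp add: axis_def)
qed

lemma partial_inverse: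
  fixes f :: "real^'k::finite \<Rightarrow> real"
  assumes "smooth_on S f" "x \<in> S" "f x \<noteq> 0"
  shows "partial i (\<lambda>y. inverse (f y)) x = - partial i f x / (f x)\<^sup>2"
  using frechet_derivative_eq[OF Deriv.has_derivative_inverse[OF assms(3)
      smooth_on_has_derivative[OF assms(1,2)]]]
  by (simp add: power2_eq_square field_simps)

lemma partial_ln:
  fixes f :: "real^'k::finite \<Rightarrow> real"
  assumes "smooth_on S f" "x \<in> S" "f x > 0"
  shows "partial i (\<lambda>y. ln (f y)) x = partial i f x / f x"
  using frechet_derivative_eq[OF has_derivative_ln[OF assms(3)
      smooth_on_has_derivative[OF assms(1,2)]]]
  by (simp add: field_simps)

lemma smooth_on_partial: "smooth_on S f \<Longrightarrow> smooth_on S (\<lambda>x. partial i f x)"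
  by (rule smooth_on_frechet_derivative)

lemma partial_commute:
  assumes "open S" "smooth_on S f" "x \<in> S"
  shows "partial i (\<lambda>y. partial j f y) x = partial j (\<lambda>y. partial i f y) x"
  by (rule frechet_derivative_commute[OF assms])

lemma partial_has_derivative_line:
  fixes f :: "real^'k::finite \<Rightarrow> real"
  assumes "smooth_on S f" "x + s *\<^sub>R axis i 1 \<in> S"
  shows "((\<lambda>s. f (x + s *\<^sub>R axis i 1)) has_real_derivative partial i f (x + s *\<^sub>R axis i 1)) (at s)"
proof -
  note f = smooth_on_has_derivative[OF assms]
  have "((\<lambda>s. x + s *\<^sub>R axis i 1) has_derivative (\<lambda>r. r *\<^sub>R axis i (1::real))) (at s)"
    by (auto intro!: derivative_eq_intros)
  from diff_chain_at[OF this f] show ?thesis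
    using linear_cmul[OF has_derivative_linear[OF f]]
    by (simp add: has_field_derivative_def o_def mult_commute_abs)
qed

section \<open>Order of vanishing along a coordinate hyperplane\<close>

text \<open>For smooth f this encodes divisibility by the k-th power of the coordinate r, without
  producing the quotient. Smoothness is part of every level, so order 0 means just that.\<close>

primrec vanishes ::
  "nat \<Rightarrow> (real^'k::finite) set \<Rightarrow> 'k \<Rightarrow> (real^'k \<Rightarrow> real) \<Rightarrow> bool" where
  "vanishes 0 S r f \<longleftrightarrow> smooth_on S f"
| "vanishes (Suc k) S r f \<longleftrightarrow>
     smooth_on S f \<and> (\<forall>x\<in>S. x $ r = 0 \<longrightarrow> f x = 0) \<and> vanishes k S r (\<lambda>x. partial r f x)"

lemma vanishes_smooth_on: "vanishes k S r f \<Longrightarrow> smooth_on S f"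
  by (cases k) auto

lemma vanishes_SucD: "vanishes (Suc k) S r f \<Longrightarrow> vanishes k S r f"
  by (induction k arbitrary: f) auto

lemma vanishes_mono: "vanishes k S r f \<Longrightarrow> l \<le> k \<Longrightarrow> vanishes l S r f"
  by (induction k) (auto simp: le_Suc_eq simp del: vanishes.simps(2) dest: vanishes_SucD)

lemma vanishes_cong:
  assumes "open S" "\<And>x. x \<in> S \<Longrightarrow> f x = g x"
  shows "vanishes k S r f \<longleftrightarrow> vanishes k S r g"
  using assms(2)
proof (induction k arbitrary: f g)
  case 0
  then show ?case using smooth_on_cong[OF assms(1), of f g] by simp
next
  case (Suc k)
  have "vanishes k S r (\<lambda>x. partial r f x) \<longleftrightarrow> vanishes k S r (\<lambda>x. partial r g x)"
    by (rule Suc.IH) (use partial_cong[OF assms(1) _ Suc.prems] in simp)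
  moreover have "smooth_on S f \<longleftrightarrow> smooth_on S g"
    using smooth_on_cong[OF assms(1) Suc.prems] .
  ultimately show ?case using Suc.prems by simp
qed

lemma vanishes_0_fun: "vanishes k S r (\<lambda>_. 0)"
  by (induction k) (auto intro: smooth_on_const)

lemma vanishes_add:
  assumes "open S" "vanishes k S r f" "vanishes k S r g"
  shows "vanishes k S r (\<lambda>x. f x + g x)"
  using assms(2,3)
proof (induction k arbitrary: f g)
  case 0
  then show ?case using assms(1) by (simp add: smooth_on_add)
next
  case (Suc k)
  have "vanishes k S r (\<lambda>x. partial r f x + partial r g x)"
    using Suc by simp
  then have "vanishes k S r (\<lambda>x. partial r (\<lambda>x. f x + g x) x)"
    by (subst vanishes_cong[OF assms(1) partial_add])
      (use Suc.prems in \<open>auto intro: vanishes_smooth_on\<close>)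
  then show ?case using Suc.prems assms(1) by (auto intro: smooth_on_add)
qed

lemma vanishes_mult_smooth_on:
  assumes "open S" "smooth_on S a" "vanishes k S r f"
  shows "vanishes k S r (\<lambda>x. a x * f x)"
  using assms(2,3)
proof (induction k arbitrary: a f)
  case 0
  then show ?case using assms(1) by (simp add: smooth_on_mult)
next
  case (Suc k)
  have "vanishes k S r (\<lambda>x. partial r a x * f x + a x * partial r f x)"
    using Suc.prems vanishes_SucD[OF Suc.prems(2)]
    by (intro vanishes_add assms(1) Suc.IH smooth_on_partial) auto
  then have "vanishes k S r (\<lambda>x. partial r (\<lambda>x. a x * f x) x)"
    by (subst vanishes_cong[OF assms(1) partial_mult])
      (use Suc.prems in \<open>auto intro: vanishes_smooth_on\<close>)
  then show ?case using Suc.prems assms(1) by (auto intro: smooth_on_mult)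
qed

lemma vanishes_cmult:
  "open S \<Longrightarrow> vanishes k S r f \<Longrightarrow> vanishes k S r (\<lambda>x. c * f x)"
  by (intro vanishes_mult_smooth_on smooth_on_const)

lemma vanishes_minus: "open S \<Longrightarrow> vanishes k S r f \<Longrightarrow> vanishes k S r (\<lambda>x. - f x)"
  using vanishes_cmult[of S k r f "-1"] by simp

lemma vanishes_diff:
  "open S \<Longrightarrow> vanishes k S r f \<Longrightarrow> vanishes k S r g \<Longrightarrow> vanishes k S r (\<lambda>x. f x - g x)"
  using vanishes_add[OF _ _ vanishes_minus, of S k r f g] by simp

lemma vanishes_sum:
  assumes "open S" "\<And>i. i \<in> I \<Longrightarrow> vanishes k S r (f i)"
  shows "vanishes k S r (\<lambda>x. \<Sum>i\<in>I. f i x)"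
  using assms(2)
  by (induction I rule: infinite_finite_induct)
    (auto simp: vanishes_0_fun intro!: vanishes_add assms(1))

text \<open>The induction runs over the sum of the orders, because the product rule lowers the order
  of one factor at a time while the other keeps its own.\<close>

lemma vanishes_mult:
  assumes "open S" "vanishes j S r f" "vanishes k S r g"
  shows "vanishes (j + k) S r (\<lambda>x. f x * g x)"
  using assms(2,3)
proof (induction "j + k" arbitrary: j k f g)
  case 0
  then show ?case using assms(1) by (simp add: smooth_on_mult)
next
  case (Suc n)
  show ?case
  proof (cases "j = 0 \<or> k = 0")
    case True
    then show ?thesis
      using Suc.prems vanishes_mult_smooth_on[OF assms(1) vanishes_smooth_on[OF Suc.prems(1)] Suc.prems(2)]
        vanishes_mult_smooth_on[OF assms(1) vanishes_smooth_on[OF Suc.prems(2)] Suc.prems(1)]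
      by (auto simp: mult.commute)
  next
    case False
    then obtain j' k' where jk: "j = Suc j'" "k = Suc k'"
      by (metis not0_implies_Suc)
    have "vanishes (j' + k) S r (\<lambda>x. partial r f x * g x)"
      using Suc.prems jk Suc.hyps(2) by (intro Suc.hyps(1)) auto
    moreover have "vanishes (j + k') S r (\<lambda>x. f x * partial r g x)"
      using Suc.prems jk Suc.hyps(2) by (intro Suc.hyps(1)) auto
    ultimately have "vanishes n S r (\<lambda>x. partial r f x * g x + f x * partial r g x)"
      using Suc.hyps(2) jk by (intro vanishes_add assms(1)) auto
    then have "vanishes n S r (\<lambda>x. partial r (\<lambda>x. f x * g x) x)"
      by (subst vanishes_cong[OF assms(1) partial_mult])
        (use Suc.prems in \<open>auto intro: vanishes_smooth_on\<close>)
    moreover have "smooth_on S (\<lambda>x. f x * g x)"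
      using Suc.prems assms(1) by (auto intro: smooth_on_mult vanishes_smooth_on)
    ultimately show ?thesis
      using Suc.prems jk unfolding Suc.hyps(2)[symmetric] by auto
  qed
qed

lemma vanishes_coord_mult:
  assumes "open S" "vanishes k S r f"
  shows "vanishes (Suc k) S r (\<lambda>x. x $ r * f x)"
proof -
  have "vanishes 1 S r (\<lambda>x. x $ r)"
    using assms(1) by (auto intro: smooth_on_coord smooth_on_partial)
  from vanishes_mult[OF assms(1) this assms(2)] show ?thesis by simp
qed

lemma partial_eq_0_slice:
  fixes f :: "real^'k::finite \<Rightarrow> real"
  assumes "open S" "smooth_on S f" "\<And>y. y \<in> S \<Longrightarrow> y $ r = 0 \<Longrightarrow> f y = 0"
    and "i \<noteq> r" "x \<in> S" "x $ r = 0"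
  shows "partial i f x = 0"
proof -
  have "((\<lambda>s. f (x + s *\<^sub>R axis i 1)) has_real_derivative partial i f (x + 0 *\<^sub>R axis i 1)) (at 0)"
    by (rule partial_has_derivative_line[OF assms(2)]) (simp add: assms(5))
  moreover have "open ((\<lambda>s. x + s *\<^sub>R axis i 1) -` S)"
    by (intro open_vimage assms(1) continuous_intros)
  moreover have "f (x + s *\<^sub>R axis i 1) = 0" if "s \<in> (\<lambda>s. x + s *\<^sub>R axis i 1) -` S" for s
    using that assms(3,4,6) by (simp add: axis_def)
  ultimately have "((\<lambda>s. 0) has_real_derivative partial i f x) (at 0)"
    using has_field_derivative_transform_within_open[of "\<lambda>s. f (x + s *\<^sub>R axis i 1)" "partial i f x" 0
        "(\<lambda>s. x + s *\<^sub>R axis i 1) -` S" "\<lambda>_. 0"] assms(5) by simp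
  from DERIV_unique[OF this DERIV_const] show ?thesis .
qed

text \<open>Derivatives along the hyperplane keep the order, while those across it cost one; all
  later order counts rest on this asymmetry. The reason is that partial derivatives commute and that
  a function vanishing on the hyperplane has zero tangential derivatives there.\<close>

lemma vanishes_partial:
  assumes "open S" "vanishes k S r f" "i \<noteq> r"
  shows "vanishes k S r (\<lambda>x. partial i f x)"
  using assms(2)
proof (induction k arbitrary: f)
  case 0
  then show ?case by (simp add: smooth_on_partial)
next
  case (Suc k)
  have "vanishes k S r (\<lambda>x. partial i (\<lambda>x. partial r f x) x)"
    using Suc by simp
  then have "vanishes k S r (\<lambda>x. partial r (\<lambda>x. partial i f x) x)"
    by (subst vanishes_cong[OF assms(1) partial_commute[OF assms(1)]])
      (use Suc.prems in auto)
  moreover have "partial i f x = 0" if "x \<in> S" "x $ r = 0" for x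
    using partial_eq_0_slice[OF assms(1) _ _ assms(3) that, of f] Suc.prems by auto
  ultimately show ?case
    using Suc.prems by (auto intro: smooth_on_partial)
qed

lemma vanishes_partial_any:
  "open S \<Longrightarrow> vanishes (Suc k) S r f \<Longrightarrow> vanishes k S r (\<lambda>x. partial i f x)"
  by (cases "i = r", simp, intro vanishes_partial[OF _ vanishes_SucD])

text \<open>The Euler operator minus k kills the leading term of a function of order k. The normal
  derivative of this expression is the same expression for f' with k lowered by one, which is what
  the induction uses.\<close>

lemma vanishes_euler:
  assumes "open S" "vanishes k S r f"
  shows "vanishes (Suc k) S r (\<lambda>x. x $ r * partial r f x - real k * f x)"
  using assms(2)
proof (induction k arbitrary: f)
  case 0
  then show ?case
    using assms(1)
    by (auto intro!: smooth_on_mult smooth_on_coord smooth_on_partial)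
next
  case (Suc k)
  let ?f' = "\<lambda>x. partial r f x"
  let ?F = "\<lambda>x. x $ r * ?f' x - real (Suc k) * f x"
  note sm = vanishes_smooth_on[OF Suc.prems] smooth_on_partial[OF vanishes_smooth_on[OF Suc.prems]]
  have smF: "smooth_on S ?F"
    by (intro smooth_on_diff smooth_on_mult smooth_on_const smooth_on_coord sm assms(1))
  have "partial r ?F x = x $ r * partial r ?f' x - real k * ?f' x" if "x \<in> S" for x
  proof -
    have "partial r ?F x = partial r (\<lambda>x. x $ r * ?f' x) x - partial r (\<lambda>x. real (Suc k) * f x) x"
      by (rule partial_diff[OF _ _ that])
        (intro smooth_on_mult smooth_on_const smooth_on_coord sm assms(1))+
    also have "partial r (\<lambda>x. real (Suc k) * f x) x = real (Suc k) * ?f' x"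
      by (rule partial_cmult[OF sm(1) that])
    also have "partial r (\<lambda>x. x $ r * ?f' x) x = ?f' x + x $ r * partial r ?f' x"
      using partial_mult[OF smooth_on_coord[OF assms(1)] sm(2) that] by (simp add: partial_coord)
    finally show ?thesis by (simp add: algebra_simps)
  qed
  moreover have "vanishes (Suc k) S r (\<lambda>x. x $ r * partial r ?f' x - real k * ?f' x)"
    by (rule Suc.IH) (use Suc.prems in simp)
  ultimately have "vanishes (Suc k) S r (\<lambda>x. partial r ?F x)"
    by (subst vanishes_cong[OF assms(1)])
  moreover have "?F x = 0" if "x \<in> S" "x $ r = 0" for x
    using Suc.prems that by simp
  ultimately show ?case
    using smF unfolding vanishes.simps(2)[of "Suc k"] by blast
qed

definition iter_partial :: "'k::finite \<Rightarrow> nat \<Rightarrow> (real^'k \<Rightarrow> real) \<Rightarrow> real^'k \<Rightarrow> real" where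
  "iter_partial r k = (\<lambda>f x. partial r f x) ^^ k"

lemma iter_partial_0 [simp]: "iter_partial r 0 f = f"
  by (simp add: iter_partial_def)

lemma iter_partial_Suc: "iter_partial r (Suc k) f = (\<lambda>x. partial r (iter_partial r k f) x)"
  by (simp only: iter_partial_def funpow.simps o_apply)

lemma iter_partial_Suc2: "iter_partial r (Suc k) f = iter_partial r k (\<lambda>x. partial r f x)"
  by (simp only: iter_partial_def funpow_Suc_right o_apply)

lemma smooth_on_iter_partial: "smooth_on S f \<Longrightarrow> smooth_on S (iter_partial r k f)"
proof (induction k)
  case (Suc k)
  then show ?case unfolding iter_partial_Suc by (intro smooth_on_partial)
qed simp

lemma vanishes_iff_iter_partial:
  "vanishes k S r f \<longleftrightarrow>
    smooth_on S f \<and> (\<forall>j<k. \<forall>x\<in>S. x $ r = 0 \<longrightarrow> iter_partial r j f x = 0)"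
proof (induction k arbitrary: f)
  case (Suc k)
  have "(\<forall>j<Suc k. \<forall>x\<in>S. x $ r = 0 \<longrightarrow> iter_partial r j f x = 0) \<longleftrightarrow>
      (\<forall>x\<in>S. x $ r = 0 \<longrightarrow> f x = 0) \<and>
      (\<forall>j<k. \<forall>x\<in>S. x $ r = 0 \<longrightarrow> iter_partial r (Suc j) f x = 0)"
    by (auto simp: less_Suc_eq_0_disj)
  moreover have "smooth_on S (\<lambda>x. partial r f x)" if "smooth_on S f"
    using smooth_on_partial[OF that] .
  ultimately show ?case
    unfolding vanishes.simps(2) Suc.IH iter_partial_Suc2 by blast
qed simp

text \<open>Once the derivatives below j vanish at x, Taylor's formula leaves only the j-th
  derivative at some t times s^j / j!. The bound C s^k with k > j makes that derivative O(s), so by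
  continuity it is 0 at x. The constant C may depend on x.\<close>

lemma vanishes_bigo:
  fixes f :: "real^'k::finite \<Rightarrow> real"
  assumes "open S" "smooth_on S f"
    and bigo: "\<And>x. x \<in> S \<Longrightarrow> x $ r = 0 \<Longrightarrow>
      (\<lambda>s. f (x + s *\<^sub>R axis r 1)) \<in> O[at 0](\<lambda>s. s ^ k)"
  shows "vanishes k S r f"
proof -
  have "iter_partial r j f x = 0" if j: "j < k" and x: "x \<in> S" "x $ r = 0" for j x
    using j
  proof (induction j rule: less_induct)
    case (less j)
    let ?d = "\<lambda>m s. iter_partial r m f (x + s *\<^sub>R axis r 1)"
    have "open ((\<lambda>s. x + s *\<^sub>R axis r 1) -` S)"
      by (intro open_vimage assms(1) continuous_intros)
    moreover have "0 \<in> (\<lambda>s. x + s *\<^sub>R axis r 1) -` S"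
      using x by simp
    ultimately obtain e where e: "e > 0" "\<And>s. \<bar>s\<bar> < e \<Longrightarrow> x + s *\<^sub>R axis r 1 \<in> S"
    proof -
      assume *: "\<And>e. e > 0 \<Longrightarrow> (\<And>s. \<bar>s\<bar> < e \<Longrightarrow> x + s *\<^sub>R axis r 1 \<in> S) \<Longrightarrow> thesis"
      assume "open ((\<lambda>s. x + s *\<^sub>R axis r 1) -` S)" "0 \<in> (\<lambda>s. x + s *\<^sub>R axis r 1) -` S"
      then obtain e where "e > 0" "ball 0 e \<subseteq> (\<lambda>s. x + s *\<^sub>R axis r 1) -` S"
        using open_contains_ball by blast
      then show thesis
        by (intro *[of e]) (auto simp: subset_iff)
    qed
    obtain C where C: "C > 0" "eventually (\<lambda>s. norm (f (x + s *\<^sub>R axis r 1)) \<le> C * norm (s ^ k)) (at 0)"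
      using landau_o.bigE[OF bigo[OF x]] .
    then obtain e' where e': "e' > 0"
      "\<And>s. s \<noteq> 0 \<Longrightarrow> \<bar>s\<bar> < e' \<Longrightarrow> \<bar>f (x + s *\<^sub>R axis r 1)\<bar> \<le> C * \<bar>s\<bar> ^ k"
      by (auto simp: eventually_at power_abs)
    have cont: "isCont (?d j) 0"
      using DERIV_isCont[OF partial_has_derivative_line[OF smooth_on_iter_partial[OF assms(2)], of x 0 r r j]]
        x by simp
    show ?case
    proof (rule ccontr)
      assume nz: "iter_partial r j f x \<noteq> 0"
      define d where "d = \<bar>iter_partial r j f x\<bar> / 2"
      have d: "d > 0" using nz by (simp add: d_def)
      obtain e'' where e'': "e'' > 0" "\<And>s. \<bar>s\<bar> < e'' \<Longrightarrow> \<bar>?d j s - ?d j 0\<bar> < d"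
        using cont d unfolding continuous_at_eps_delta dist_real_def by (metis diff_zero)
      \<comment> \<open>In order, the bounds serve to stay in S, to use the O-estimate, to use
        continuity of the j-th derivative, to have s^k at most s^(j+1), and to make C j! s at most d
        / 2.\<close>
      define s where "s = min (min (e / 2) (e' / 2)) (min (e'' / 2) (min 1 (d / (2 * C * fact j))))"
      have s: "s > 0" "s < e" "s < e'" "s < e''" "s \<le> 1" "s \<le> d / (2 * C * fact j)"
      proof -
        have "d / (2 * C * fact j) > 0" using d C(1) by simp
        then show "s > 0" unfolding s_def using e(1) e'(1) e''(1) by simp
        have "s \<le> e / 2" "s \<le> e' / 2" "s \<le> e'' / 2" by (simp_all add: s_def)
        then show "s < e" "s < e'" "s < e''" using e(1) e'(1) e''(1) by simp_all
        show "s \<le> 1" "s \<le> d / (2 * C * fact j)" by (simp_all add: s_def)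
      qed
      have "\<exists>t. \<bar>t\<bar> \<le> \<bar>s\<bar> \<and> f (x + s *\<^sub>R axis r 1) =
          (\<Sum>m<j. ?d m 0 / fact m * s ^ m) + ?d j t / fact j * s ^ j"
      proof (rule Maclaurin_bi_le)
        show "\<forall>m t. m < j \<and> \<bar>t\<bar> \<le> \<bar>s\<bar> \<longrightarrow> (?d m has_real_derivative ?d (Suc m) t) (at t)"
          unfolding iter_partial_Suc
          using s by (intro allI impI partial_has_derivative_line[OF smooth_on_iter_partial[OF assms(2)]] e(2)) auto
      qed simp
      moreover have "(\<Sum>m<j. ?d m 0 / fact m * s ^ m) = 0"
        using less by (intro sum.neutral) auto
      ultimately obtain t where t: "\<bar>t\<bar> \<le> s" "f (x + s *\<^sub>R axis r 1) = ?d j t / fact j * s ^ j"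
        using s(1) by auto
      have "\<bar>?d j t\<bar> / fact j * s ^ j \<le> C * s ^ k"
        using e'(2)[of s] s t by (simp add: abs_mult)
      also have "\<dots> \<le> C * s ^ Suc j"
        using less.prems s C(1) by (intro mult_left_mono power_decreasing) auto
      finally have "\<bar>?d j t\<bar> \<le> C * fact j * s"
        using s(1) by (simp add: field_simps)
      also have "\<dots> \<le> d / 2"
        using s(6) C(1) by (simp add: field_simps)
      finally have "\<bar>?d j t\<bar> \<le> d / 2" .
      moreover have "\<bar>?d j t - ?d j 0\<bar> < d"
        using e''(2) t(1) s(4) by simp
      ultimately show False
        using d unfolding d_def by (simp add: abs_if split: if_splits)
    qed
  qed
  then show ?thesis
    using assms(2) by (auto simp: vanishes_iff_iter_partial)
qed

text \<open>Freezing a smooth coefficient at its value on \<rho> = 0 costs only an error of first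
  order.\<close>

lemma bigo_line_diff:
  fixes a :: "real^'k::finite \<Rightarrow> real"
  assumes "smooth_on S a" "x \<in> S"
  shows "(\<lambda>s. a (x + s *\<^sub>R axis r 1) - a x) \<in> O[at 0](\<lambda>s. s)"
proof (rule bigoI_tendsto)
  have "((\<lambda>s. a (x + s *\<^sub>R axis r 1)) has_real_derivative partial r a (x + 0 *\<^sub>R axis r 1)) (at 0)"
    by (rule partial_has_derivative_line[OF assms(1)]) (simp add: assms(2))
  then show "((\<lambda>s. (a (x + s *\<^sub>R axis r 1) - a x) / s) \<longlongrightarrow> partial r a x) (at 0)"
    by (simp add: has_field_derivative_iff)
qed (simp add: eventually_at_filter)

section \<open>The Levi-Civita connection of an ambient metric\<close>

lemma partial_eq_0_invariant:
  fixes f :: "real^'k::finite \<Rightarrow> real"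
  assumes "smooth_on S f" "x \<in> S" "\<And>s. f (x + s *\<^sub>R axis i 1) = f x"
  shows "partial i f x = 0"
proof -
  have "((\<lambda>s. f (x + s *\<^sub>R axis i 1)) has_real_derivative partial i f (x + 0 *\<^sub>R axis i 1)) (at 0)"
    by (rule partial_has_derivative_line[OF assms(1)]) (simp add: assms(2))
  then have "((\<lambda>s. f x) has_real_derivative partial i f x) (at 0)"
    by (simp add: assms(3))
  from DERIV_unique[OF this DERIV_const] show ?thesis .
qed

lemma has_derivative_translate:
  assumes "\<And>y. f (y + v) = f y" "(f has_derivative D) (at (x + v))"
  shows "(f has_derivative D) (at x)"
proof -
  have "((\<lambda>y. y + v) has_derivative (\<lambda>h. h)) (at x)"
    by (auto intro!: derivative_eq_intros)
  from diff_chain_at[OF this assms(2)] show ?thesis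
    by (simp add: o_def assms(1))
qed

lemma frechet_derivative_translate:
  assumes "\<And>y. f (y + v) = f y"
  shows "frechet_derivative f (at (x + v)) = frechet_derivative f (at x)"
proof -
  have "f (y + - v) = f y" for y
    using assms[of "y + - v"] by simp
  then have "(f has_derivative D) (at (x + v)) \<longleftrightarrow> (f has_derivative D) (at x)" for D
    using has_derivative_translate[of f v D x, OF assms] has_derivative_translate[of f "- v" D "x + v"]
    by auto
  then show ?thesis
    unfolding frechet_derivative_def by simp
qed

lemma matrix_inv_unique:
  fixes A B :: "real^'n^'n"
  assumes "A ** B = mat 1"
  shows "invertible A" "matrix_inv A = B"
proof -
  have "B ** A = mat 1"
    using assms matrix_left_right_inverse by blast
  then show *: "invertible A"
    using assms unfolding invertible_def by blast
  have "matrix_inv A = matrix_inv A ** (A ** B)"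
    by (simp add: assms)
  also have "\<dots> = B"
    by (simp add: matrix_mul_assoc matrix_inv_left[OF *])
  finally show "matrix_inv A = B" .
qed

lemma smooth_on_levi_civita:
  fixes G :: "real^'k::finite \<Rightarrow> real^'k^'k"
  assumes "open S" "\<And>i j. smooth_on S (\<lambda>x. G x $ i $ j)" "\<And>x. x \<in> S \<Longrightarrow> invertible (G x)"
  shows "smooth_on S (\<lambda>x. levi_civita G k i j x)"
  unfolding levi_civita_def
  by (intro smooth_on_divide smooth_on_sum smooth_on_mult smooth_on_diff smooth_on_add
      smooth_on_matrix_inv smooth_on_partial smooth_on_const assms) auto

lemma smooth_on_ricci:
  fixes G :: "real^'k::finite \<Rightarrow> real^'k^'k"
  assumes "open S" "\<And>i j. smooth_on S (\<lambda>x. G x $ i $ j)" "\<And>x. x \<in> S \<Longrightarrow> invertible (G x)"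
  shows "smooth_on S (\<lambda>x. ricci G i j x)"
  unfolding ricci_def
  by (intro smooth_on_sum smooth_on_mult smooth_on_diff smooth_on_add
      smooth_on_partial smooth_on_levi_civita assms)

section \<open>Coordinates of the ambient space\<close>

lemma sum_ambient_index:
  "(\<Sum>I\<in>UNIV. f I) = f TDir + (\<Sum>i\<in>UNIV. f (MDir i)) + f RhoDir"
  for f :: "'m::finite ambient_index \<Rightarrow> real"
proof -
  have U: "UNIV = insert TDir (insert RhoDir (range (MDir :: 'm \<Rightarrow> _)))"
    by (auto intro: ambient_index.exhaust)
  have "inj (MDir :: 'm \<Rightarrow> _)"
    by (auto intro: injI)
  then have "sum f (range MDir) = (\<Sum>i\<in>UNIV. f (MDir i))"
    by (simp add: sum.reindex)
  then show ?thesis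
    by (subst U) (subst sum.insert; auto)+
qed

definition base_point :: "real^'m::finite ambient_index \<Rightarrow> real^'m" where
  "base_point P = (\<chi> i. P $ MDir i)"

definition ambient_domain ::
  "((real^'m::finite) \<times> real) set \<Rightarrow> (real^'m ambient_index) set" where
  "ambient_domain W = {P. P $ TDir > 0 \<and> (base_point P, P $ RhoDir) \<in> W}"

lemma bounded_linear_base_point: "bounded_linear base_point"
  unfolding linear_conv_bounded_linear[symmetric]
  by (rule linearI) (auto simp: base_point_def vec_eq_iff)

lemma bounded_linear_base_point_rho: "bounded_linear (\<lambda>P. (base_point P, P $ RhoDir))"
  by (intro bounded_linear_Pair bounded_linear_base_point bounded_linear_vec_nth)

lemma open_ambient_domain:
  fixes W :: "((real^'m::finite) \<times> real) set"
  assumes "open W"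
  shows "open (ambient_domain W)"
proof -
  have "ambient_domain W = {P. 0 < P $ TDir} \<inter> (\<lambda>P. (base_point P, P $ RhoDir)) -` W"
    by (auto simp: ambient_domain_def)
  moreover have "open {P :: real^'m ambient_index. 0 < P $ TDir}"
    by (intro open_Collect_less continuous_intros)
  moreover have "open ((\<lambda>P. (base_point P, P $ RhoDir)) -` W)"
    by (intro open_vimage assms linear_continuous_on bounded_linear_base_point_rho)
  ultimately show ?thesis by auto
qed

lemma base_point_add_axis [simp]:
  "base_point (P + s *\<^sub>R axis TDir 1) = base_point P"
  "base_point (P + s *\<^sub>R axis RhoDir 1) = base_point P"
  by (auto simp: base_point_def vec_eq_iff axis_def)

lemma add_axis_nth:
  "(P + s *\<^sub>R axis i 1) $ j = (if i = j then P $ j + s else P $ j)"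
  by (auto simp: axis_def)

text \<open>Only the shape of an ambient metric is fixed here, without a Ricci condition, so that
  the explicit metric and an arbitrary competitor are both instances.\<close>

locale ambient =
  fixes \<gamma> :: "real^'m::finite \<Rightarrow> real \<Rightarrow> real^'m^'m"
    and W :: "((real^'m) \<times> real) set"
  assumes open_W: "open W"
    and smooth_\<gamma>: "smooth_on W (\<lambda>(x, \<rho>). \<gamma> x \<rho>)"
    and symmetric_\<gamma>: "(x, \<rho>) \<in> W \<Longrightarrow> transpose (\<gamma> x \<rho>) = \<gamma> x \<rho>"
    and invertible_\<gamma>: "(x, \<rho>) \<in> W \<Longrightarrow> invertible (\<gamma> x \<rho>)"
begin

abbreviation \<Omega> where "\<Omega> \<equiv> ambient_domain W"

abbreviation G where "G \<equiv> ambient_metric \<gamma>"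

definition h :: "'m \<Rightarrow> 'm \<Rightarrow> real^'m ambient_index \<Rightarrow> real" where
  "h i j P = \<gamma> (base_point P) (P $ RhoDir) $ i $ j"

definition hi :: "'m \<Rightarrow> 'm \<Rightarrow> real^'m ambient_index \<Rightarrow> real" where
  "hi i j P = matrix_inv (\<gamma> (base_point P) (P $ RhoDir)) $ i $ j"

definition h' :: "'m \<Rightarrow> 'm \<Rightarrow> real^'m ambient_index \<Rightarrow> real" where
  "h' i j P = partial RhoDir (h i j) P"

text \<open>The Christoffel symbols of the slice metric obtained by fixing \<rho>.\<close>

definition C :: "'m \<Rightarrow> 'm \<Rightarrow> 'm \<Rightarrow> real^'m ambient_index \<Rightarrow> real" where
  "C k i j P = (\<Sum>l\<in>UNIV. hi k l P *
     (partial (MDir i) (h j l) P + partial (MDir j) (h i l) P - partial (MDir l) (h i j) P)) / 2"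

text \<open>Half of the endomorphism formed from the inverse metric and the \<rho>-derivative of the
  metric. Its trace is the logarithmic \<rho>-derivative of the volume density of the
  slices.\<close>

definition A :: "'m \<Rightarrow> 'm \<Rightarrow> real^'m ambient_index \<Rightarrow> real" where
  "A k j P = (\<Sum>l\<in>UNIV. hi k l P * h' j l P) / 2"

lemma open_dom: "open \<Omega>"
  by (rule open_ambient_domain[OF open_W])

lemma smooth_h: "smooth_on \<Omega> (h i j)"
proof -
  have "smooth_on \<Omega> (\<lambda>P. (\<lambda>(x, \<rho>). \<gamma> x \<rho>) (base_point P, P $ RhoDir))"
    by (rule smooth_on_compose[OF open_dom open_W _
          smooth_on_linear_map[OF open_dom bounded_linear_base_point_rho] smooth_\<gamma>])
      (auto simp: ambient_domain_def)
  then have "smooth_on \<Omega> (\<lambda>P. \<gamma> (base_point P) (P $ RhoDir) $ i $ j)"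
    by (intro smooth_on_vec_nth open_dom) simp
  then show ?thesis
    unfolding h_def .
qed

lemma smooth_hi: "smooth_on \<Omega> (hi i j)"
  unfolding hi_def
proof (rule smooth_on_matrix_inv[OF open_dom])
  show "smooth_on \<Omega> (\<lambda>P. \<gamma> (base_point P) (P $ RhoDir) $ i $ j)" for i j
    using smooth_h unfolding h_def .
qed (auto simp: ambient_domain_def intro: invertible_\<gamma>)

lemma smooth_h': "smooth_on \<Omega> (h' i j)"
  unfolding h'_def by (intro smooth_on_partial smooth_h)

lemma smooth_C: "smooth_on \<Omega> (C k i j)"
  unfolding C_def
  by (intro smooth_on_divide smooth_on_sum smooth_on_mult smooth_on_diff smooth_on_add
      smooth_on_partial smooth_on_const smooth_h smooth_hi open_dom) auto

lemma smooth_A: "smooth_on \<Omega> (A k j)"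
  unfolding A_def
  by (intro smooth_on_divide smooth_on_sum smooth_on_mult
      smooth_on_const smooth_h' smooth_hi open_dom) auto

lemma h_symmetric: "P \<in> \<Omega> \<Longrightarrow> h i j P = h j i P"
  using arg_cong[OF symmetric_\<gamma>, of "base_point P" "P $ RhoDir" "\<lambda>M. M $ j $ i"]
  by (simp add: ambient_domain_def h_def transpose_def)

lemma partial_h_symmetric: "P \<in> \<Omega> \<Longrightarrow> partial I (h i j) P = partial I (h j i) P"
  by (rule partial_cong[OF open_dom]) (simp_all add: h_symmetric)

lemma h'_symmetric: "P \<in> \<Omega> \<Longrightarrow> h' i j P = h' j i P"
  unfolding h'_def by (rule partial_h_symmetric)

lemma hi_h: "P \<in> \<Omega> \<Longrightarrow> (\<Sum>l\<in>UNIV. hi k l P * h l j P) = (if k = j then 1 else 0)"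
  using arg_cong[OF matrix_inv_left[OF invertible_\<gamma>], of "base_point P" "P $ RhoDir" "\<lambda>M. M $ k $ j"]
  by (simp add: ambient_domain_def hi_def h_def matrix_matrix_mult_def mat_def)

lemma h_hi: "P \<in> \<Omega> \<Longrightarrow> (\<Sum>l\<in>UNIV. h k l P * hi l j P) = (if k = j then 1 else 0)"
  using arg_cong[OF matrix_inv_right[OF invertible_\<gamma>], of "base_point P" "P $ RhoDir" "\<lambda>M. M $ k $ j"]
  by (simp add: ambient_domain_def hi_def h_def matrix_matrix_mult_def mat_def)

lemma C_symmetric: "P \<in> \<Omega> \<Longrightarrow> C k i j P = C k j i P"
  unfolding C_def by (simp add: partial_h_symmetric[of P i j] add.commute)

lemma translate_TDir:
  "h i j (P + s *\<^sub>R axis TDir 1) = h i j P"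
  "hi i j (P + s *\<^sub>R axis TDir 1) = hi i j P"
  "partial I (h i j) (P + s *\<^sub>R axis TDir 1) = partial I (h i j) P"
proof -
  show *: "h i j (P + s *\<^sub>R axis TDir 1) = h i j P" for P
    by (simp add: h_def add_axis_nth del: vector_add_component)
  show "hi i j (P + s *\<^sub>R axis TDir 1) = hi i j P"
    by (simp add: hi_def add_axis_nth del: vector_add_component)
  show "partial I (h i j) (P + s *\<^sub>R axis TDir 1) = partial I (h i j) P"
    by (subst frechet_derivative_translate[of "h i j", OF *]) (rule refl)
qed

lemma partial_TDir:
  assumes "P \<in> \<Omega>"
  shows "partial TDir (h i j) P = 0" "partial TDir (h' i j) P = 0"
    "partial TDir (C k i j) P = 0" "partial TDir (A k j) P = 0"
proof -
  show "partial TDir (h i j) P = 0"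
    by (rule partial_eq_0_invariant[OF smooth_h assms]) (rule translate_TDir)
  show "partial TDir (h' i j) P = 0"
    by (rule partial_eq_0_invariant[OF smooth_h' assms]) (simp only: h'_def translate_TDir)
  show "partial TDir (C k i j) P = 0"
    by (rule partial_eq_0_invariant[OF smooth_C assms]) (simp only: C_def translate_TDir)
  show "partial TDir (A k j) P = 0"
    by (rule partial_eq_0_invariant[OF smooth_A assms]) (simp only: A_def h'_def translate_TDir)
qed

lemma G_entries:
  "G P $ TDir $ TDir = 2 * P $ RhoDir"
  "G P $ TDir $ MDir j = 0"
  "G P $ TDir $ RhoDir = P $ TDir"
  "G P $ MDir i $ TDir = 0"
  "G P $ MDir i $ MDir j = (P $ TDir)\<^sup>2 * h i j P"
  "G P $ MDir i $ RhoDir = 0"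
  "G P $ RhoDir $ TDir = P $ TDir"
  "G P $ RhoDir $ MDir j = 0"
  "G P $ RhoDir $ RhoDir = 0"
  by (simp_all add: ambient_metric_def h_def base_point_def Let_def)

lemma smooth_G: "smooth_on \<Omega> (\<lambda>P. G P $ I $ J)"
  by (cases I; cases J; simp add: G_entries)
    (intro smooth_on_const smooth_on_mult smooth_on_power smooth_on_coord smooth_h open_dom)+

lemma partial_G:
  assumes "P \<in> \<Omega>"
  shows "partial I (\<lambda>y. G y $ TDir $ TDir) P = (if I = RhoDir then 2 else 0)"
    "partial I (\<lambda>y. G y $ TDir $ MDir j) P = 0"
    "partial I (\<lambda>y. G y $ TDir $ RhoDir) P = (if I = TDir then 1 else 0)"
    "partial I (\<lambda>y. G y $ MDir i $ TDir) P = 0"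
    "partial TDir (\<lambda>y. G y $ MDir i $ MDir j) P = 2 * P $ TDir * h i j P"
    "partial (MDir k) (\<lambda>y. G y $ MDir i $ MDir j) P = (P $ TDir)\<^sup>2 * partial (MDir k) (h i j) P"
    "partial RhoDir (\<lambda>y. G y $ MDir i $ MDir j) P = (P $ TDir)\<^sup>2 * h' i j P"
    "partial I (\<lambda>y. G y $ MDir i $ RhoDir) P = 0"
    "partial I (\<lambda>y. G y $ RhoDir $ TDir) P = (if I = TDir then 1 else 0)"
    "partial I (\<lambda>y. G y $ RhoDir $ MDir j) P = 0"
    "partial I (\<lambda>y. G y $ RhoDir $ RhoDir) P = 0"
proof -
  have sq: "partial I (\<lambda>y. (y $ TDir)\<^sup>2) P = (if I = TDir then 2 * P $ TDir else 0)" for I :: "'m ambient_index"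
  proof -
    have "smooth_on \<Omega> (\<lambda>y. y $ TDir)"
      by (rule smooth_on_coord[OF open_dom])
    from partial_mult[OF this this assms, of I] show ?thesis
      by (auto simp: partial_coord power2_eq_square)
  qed
  have MM: "partial I (\<lambda>y. G y $ MDir i $ MDir j) P =
      (if I = TDir then 2 * P $ TDir * h i j P else (P $ TDir)\<^sup>2 * partial I (h i j) P)" for I
    unfolding G_entries
    using partial_mult[OF smooth_on_power[OF open_dom smooth_on_coord[OF open_dom], of TDir 2] smooth_h assms]
    by (simp add: sq partial_TDir[OF assms])
  show "partial TDir (\<lambda>y. G y $ MDir i $ MDir j) P = 2 * P $ TDir * h i j P"
    "partial (MDir k) (\<lambda>y. G y $ MDir i $ MDir j) P = (P $ TDir)\<^sup>2 * partial (MDir k) (h i j) P"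
    "partial RhoDir (\<lambda>y. G y $ MDir i $ MDir j) P = (P $ TDir)\<^sup>2 * h' i j P"
    unfolding MM by (simp_all add: h'_def)
  show "partial I (\<lambda>y. G y $ TDir $ TDir) P = (if I = RhoDir then 2 else 0)"
    unfolding G_entries
    by (subst partial_cmult[OF smooth_on_coord[OF open_dom] assms]) (simp add: partial_coord)
qed (simp_all add: G_entries partial_coord)

section \<open>Inverse metric and Christoffel symbols in closed form\<close>

definition ginv :: "real^'m ambient_index \<Rightarrow> 'm ambient_index \<Rightarrow> 'm ambient_index \<Rightarrow> real" where
  "ginv P I J = (case (I, J) of
      (MDir i, MDir j) \<Rightarrow> hi i j P / (P $ TDir)\<^sup>2
    | (TDir, RhoDir) \<Rightarrow> 1 / P $ TDir
    | (RhoDir, TDir) \<Rightarrow> 1 / P $ TDir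
    | (RhoDir, RhoDir) \<Rightarrow> - (2 * P $ RhoDir) / (P $ TDir)\<^sup>2
    | _ \<Rightarrow> 0)"

lemma dom_pos: "P \<in> \<Omega> \<Longrightarrow> P $ TDir > 0"
  by (simp add: ambient_domain_def)

lemma matrix_inv_G:
  assumes "P \<in> \<Omega>"
  shows "invertible (G P)" "matrix_inv (G P) $ I $ J = ginv P I J"
proof -
  have "(\<Sum>L\<in>UNIV. G P $ I $ L * ginv P L J) = (if I = J then 1 else 0)" for I J
    using dom_pos[OF assms] h_hi[OF assms]
    by (cases I; cases J) (simp_all add: sum_ambient_index G_entries ginv_def power2_eq_square field_simps)
  then have "G P ** (\<chi> I J. ginv P I J) = mat 1"
    by (simp add: matrix_matrix_mult_def mat_def vec_eq_iff)
  from matrix_inv_unique[OF this]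
  show "invertible (G P)" "matrix_inv (G P) $ I $ J = ginv P I J"
    by simp_all
qed

text \<open>The point is the last argument, inside the case distinction, so that every component is
  a function to which \<open>partial\<close> applies directly.\<close>

definition christoffel :: "'m ambient_index \<Rightarrow> 'm ambient_index \<Rightarrow> 'm ambient_index \<Rightarrow>
    real^'m ambient_index \<Rightarrow> real" where
  "christoffel K I J = (case (K, I, J) of
      (TDir, MDir i, MDir j) \<Rightarrow> (\<lambda>P. - (P $ TDir * h' i j P) / 2)
    | (MDir k, MDir i, MDir j) \<Rightarrow> C k i j
    | (MDir k, TDir, MDir j) \<Rightarrow> (\<lambda>P. if k = j then inverse (P $ TDir) else 0)
    | (MDir k, MDir j, TDir) \<Rightarrow> (\<lambda>P. if k = j then inverse (P $ TDir) else 0)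
    | (MDir k, RhoDir, MDir j) \<Rightarrow> A k j
    | (MDir k, MDir j, RhoDir) \<Rightarrow> A k j
    | (RhoDir, MDir i, MDir j) \<Rightarrow> (\<lambda>P. P $ RhoDir * h' i j P - h i j P)
    | (RhoDir, TDir, RhoDir) \<Rightarrow> (\<lambda>P. inverse (P $ TDir))
    | (RhoDir, RhoDir, TDir) \<Rightarrow> (\<lambda>P. inverse (P $ TDir))
    | _ \<Rightarrow> (\<lambda>_. 0))"

lemma christoffel_simps:
  "christoffel TDir TDir J = (\<lambda>_. 0)" "christoffel TDir RhoDir J = (\<lambda>_. 0)"
  "christoffel TDir I TDir = (\<lambda>_. 0)" "christoffel TDir I RhoDir = (\<lambda>_. 0)"
  "christoffel TDir (MDir i) (MDir j) = (\<lambda>P. - (P $ TDir * h' i j P) / 2)"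
  "christoffel (MDir k) (MDir i) (MDir j) = C k i j"
  "christoffel (MDir k) TDir (MDir j) = (\<lambda>P. if k = j then inverse (P $ TDir) else 0)"
  "christoffel (MDir k) (MDir j) TDir = (\<lambda>P. if k = j then inverse (P $ TDir) else 0)"
  "christoffel (MDir k) RhoDir (MDir j) = A k j"
  "christoffel (MDir k) (MDir j) RhoDir = A k j"
  "christoffel (MDir k) TDir TDir = (\<lambda>_. 0)" "christoffel (MDir k) RhoDir RhoDir = (\<lambda>_. 0)"
  "christoffel (MDir k) TDir RhoDir = (\<lambda>_. 0)" "christoffel (MDir k) RhoDir TDir = (\<lambda>_. 0)"
  "christoffel RhoDir (MDir i) (MDir j) = (\<lambda>P. P $ RhoDir * h' i j P - h i j P)"
  "christoffel RhoDir TDir RhoDir = (\<lambda>P. inverse (P $ TDir))"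
  "christoffel RhoDir RhoDir TDir = (\<lambda>P. inverse (P $ TDir))"
  "christoffel RhoDir TDir TDir = (\<lambda>_. 0)" "christoffel RhoDir RhoDir RhoDir = (\<lambda>_. 0)"
  "christoffel RhoDir TDir (MDir j) = (\<lambda>_. 0)" "christoffel RhoDir RhoDir (MDir j) = (\<lambda>_. 0)"
  "christoffel RhoDir (MDir j) TDir = (\<lambda>_. 0)" "christoffel RhoDir (MDir j) RhoDir = (\<lambda>_. 0)"
  by (simp_all add: christoffel_def split: ambient_index.split)

lemma hi_h2: "P \<in> \<Omega> \<Longrightarrow> (\<Sum>l\<in>UNIV. hi k l P * h j l P) = (if k = j then 1 else 0)"
  using hi_h[of P k j] h_symmetric[of P j] by simp

lemma levi_civita_G:
  assumes "P \<in> \<Omega>"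
  shows "levi_civita G K I J P = christoffel K I J P"
proof -
  have t: "P $ TDir \<noteq> 0"
    using dom_pos[OF assms] by simp
  \<comment> \<open>The inverse metric contracted with the t-derivative of t^2 \<open>h\<close>, the
    source of the entries 1/t.\<close>
  have contract: "(\<Sum>l\<in>UNIV. hi k l P * (2 * P $ TDir * h j l P) / (P $ TDir)\<^sup>2) =
      (if k = j then 2 / P $ TDir else 0)" for k j
  proof -
    have "(\<Sum>l\<in>UNIV. hi k l P * (2 * P $ TDir * h j l P) / (P $ TDir)\<^sup>2) =
        2 / P $ TDir * (\<Sum>l\<in>UNIV. hi k l P * h j l P)"
      unfolding sum_distrib_left using t by (intro sum.cong) (auto simp: power2_eq_square)
    then show ?thesis by (simp add: hi_h2[OF assms])
  qed
  note expand = levi_civita_def matrix_inv_G(2)[OF assms] sum_ambient_index partial_G[OF assms]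
  have M: "levi_civita G (MDir k) I J P = christoffel (MDir k) I J P" for k
    by (cases I; cases J)
      (simp_all add: expand ginv_def christoffel_simps C_def A_def contract inverse_eq_divide t
        flip: distrib_left right_diff_distrib)
  have T: "levi_civita G TDir I J P = christoffel TDir I J P"
    using t by (cases I; cases J) (simp_all add: expand ginv_def christoffel_simps power2_eq_square)
  have R: "levi_civita G RhoDir I J P = christoffel RhoDir I J P"
    using t by (cases I; cases J)
      (simp_all add: expand ginv_def christoffel_simps power2_eq_square field_simps)
  show ?thesis
    using M T R by (cases K) simp_all
qed

end

section \<open>Ricci tensor and Laplacian of an ambient metric\<close>

lemma smooth_on_if_const: "smooth_on S f \<Longrightarrow> smooth_on S (\<lambda>x. if b then f x else 0)"
  by (cases b) (simp_all add: smooth_on_const)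

context ambient
begin

lemma smooth_christoffel: "smooth_on \<Omega> (christoffel K I J)"
  by (cases K; cases I; cases J; simp add: christoffel_simps)
    (auto intro!: smooth_on_if_const smooth_on_const smooth_on_mult smooth_on_minus smooth_on_diff smooth_on_divide
      smooth_on_coord smooth_on_inverse smooth_h smooth_h' smooth_C smooth_A open_dom dest: dom_pos)

lemma ricci_G:
  assumes "P \<in> \<Omega>"
  shows "ricci G I J P = (\<Sum>K\<in>UNIV. partial K (christoffel K I J) P) - (\<Sum>K\<in>UNIV. partial J (christoffel K I K) P)
    + (\<Sum>L\<in>UNIV. (\<Sum>K\<in>UNIV. christoffel K K L P) * christoffel L I J P)
    - (\<Sum>K\<in>UNIV. \<Sum>L\<in>UNIV. christoffel K J L P * christoffel L I K P)"
proof -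
  have p: "partial M (levi_civita G K I J) P = partial M (christoffel K I J) P" for M K I J
    by (rule partial_cong[OF open_dom assms levi_civita_G])
  have "(\<Sum>K\<in>UNIV. \<Sum>L\<in>UNIV. christoffel K K L P * christoffel L I J P) =
      (\<Sum>L\<in>UNIV. (\<Sum>K\<in>UNIV. christoffel K K L P) * christoffel L I J P)"
    by (subst sum.swap) (simp add: sum_distrib_right)
  then show ?thesis
    unfolding ricci_def p levi_civita_G[OF assms]
    by (simp add: sum.distrib sum_subtractf)
qed

text \<open>These are the logarithmic derivatives of the ambient volume density, which is t^(m+1)
  times the density of the slice, where m is \<open>CARD('m)\<close>.\<close>

lemma trace_christoffel:
  "(\<Sum>K\<in>UNIV. christoffel K K TDir P) = (real CARD('m) + 1) * inverse (P $ TDir)"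
  "(\<Sum>K\<in>UNIV. christoffel K K (MDir l) P) = (\<Sum>k\<in>UNIV. C k k l P)"
  "(\<Sum>K\<in>UNIV. christoffel K K RhoDir P) = (\<Sum>k\<in>UNIV. A k k P)"
  by (simp_all add: sum_ambient_index christoffel_simps algebra_simps)

lemma partial_inverse_TDir:
  assumes "P \<in> \<Omega>"
  shows "partial I (\<lambda>y. inverse (y $ TDir)) P = (if I = TDir then - (inverse (P $ TDir))\<^sup>2 else 0)"
  using partial_inverse[OF smooth_on_coord[OF open_dom] assms, of TDir] dom_pos[OF assms]
  by (auto simp: partial_coord power2_eq_square divide_inverse)

lemma partial_christoffel:
  assumes "P \<in> \<Omega>"
  shows "partial TDir (\<lambda>P. - (P $ TDir * h' i j P) / 2) P = - h' i j P / 2"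
    "partial RhoDir (\<lambda>P. P $ RhoDir * h' i j P - h i j P) P = P $ RhoDir * partial RhoDir (h' i j) P"
proof -
  note coord = smooth_on_coord[OF open_dom]
  have "partial TDir (\<lambda>P. (- 1 / 2) * (P $ TDir * h' i j P)) P =
      (- 1 / 2) * partial TDir (\<lambda>P. P $ TDir * h' i j P) P"
    by (rule partial_cmult[OF smooth_on_mult[OF open_dom coord smooth_h'] assms])
  also have "partial TDir (\<lambda>P. P $ TDir * h' i j P) P = h' i j P"
    using partial_mult[OF coord smooth_h' assms] partial_TDir[OF assms] by (simp add: partial_coord)
  finally show "partial TDir (\<lambda>P. - (P $ TDir * h' i j P) / 2) P = - h' i j P / 2"
    by simp
  have "partial RhoDir (\<lambda>P. P $ RhoDir * h' i j P - h i j P) P =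
      partial RhoDir (\<lambda>P. P $ RhoDir * h' i j P) P - partial RhoDir (h i j) P"
    by (rule partial_diff[OF smooth_on_mult[OF open_dom coord smooth_h'] smooth_h assms])
  also have "partial RhoDir (\<lambda>P. P $ RhoDir * h' i j P) P = h' i j P + P $ RhoDir * partial RhoDir (h' i j) P"
    using partial_mult[OF coord smooth_h' assms] by (simp add: partial_coord)
  finally show "partial RhoDir (\<lambda>P. P $ RhoDir * h' i j P - h i j P) P =
      P $ RhoDir * partial RhoDir (h' i j) P"
    by (simp add: h'_def)
qed

lemma A_h:
  assumes "P \<in> \<Omega>"
  shows "(\<Sum>k\<in>UNIV. A k j P * h i k P) = h' j i P / 2"
proof -
  have "(\<Sum>k\<in>UNIV. A k j P * h i k P) =
      (\<Sum>k\<in>UNIV. \<Sum>l\<in>UNIV. h' j l P * (h i k P * hi k l P)) / 2"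
    by (simp add: A_def sum_distrib_left sum_distrib_right sum_divide_distrib mult_ac)
  also have "\<dots> = (\<Sum>l\<in>UNIV. h' j l P * (\<Sum>k\<in>UNIV. h i k P * hi k l P)) / 2"
    by (subst sum.swap) (simp add: sum_distrib_left)
  also have "\<dots> = h' j i P / 2"
    by (simp add: h_hi[OF assms] if_distrib cong: if_cong)
  finally show ?thesis .
qed

text \<open>The Ricci tensor of the slice metric, computed at fixed \<rho>.\<close>

definition RicC :: "'m \<Rightarrow> 'm \<Rightarrow> real^'m ambient_index \<Rightarrow> real" where
  "RicC i j P = (\<Sum>k\<in>UNIV. partial (MDir k) (C k i j) P) - (\<Sum>k\<in>UNIV. partial (MDir j) (C k i k) P)
    + (\<Sum>l\<in>UNIV. (\<Sum>k\<in>UNIV. C k k l P) * C l i j P)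
    - (\<Sum>k\<in>UNIV. \<Sum>l\<in>UNIV. C k j l P * C l i k P)"

text \<open>All powers of t cancel. The factor m/2 - 1 in front of \<open>h'\<close> is collected
  from 1/2 (the t-derivative), (m + 1)/2 (the trace of the symbols) and -2 (the products of two
  symbols).\<close>

lemma ricci_MM:
  assumes "P \<in> \<Omega>"
  shows "ricci G (MDir i) (MDir j) P =
    P $ RhoDir * partial RhoDir (h' i j) P - (real CARD('m) / 2 - 1) * h' i j P
    + (\<Sum>k\<in>UNIV. A k k P) * (P $ RhoDir * h' i j P - h i j P)
    - P $ RhoDir * (\<Sum>k\<in>UNIV. A k j P * h' i k P + A k i P * h' j k P)
    + RicC i j P"
proof -
  have t: "P $ TDir \<noteq> 0" using dom_pos[OF assms] by simp
  have 1: "(\<Sum>K\<in>UNIV. partial K (christoffel K (MDir i) (MDir j)) P) =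
      - h' i j P / 2 + (\<Sum>k\<in>UNIV. partial (MDir k) (C k i j) P) + P $ RhoDir * partial RhoDir (h' i j) P"
    unfolding sum_ambient_index christoffel_simps partial_christoffel[OF assms] ..
  have 2: "(\<Sum>K\<in>UNIV. partial (MDir j) (christoffel K (MDir i) K) P) = (\<Sum>k\<in>UNIV. partial (MDir j) (C k i k) P)"
    by (simp add: sum_ambient_index christoffel_simps)
  have 3: "(\<Sum>L\<in>UNIV. (\<Sum>K\<in>UNIV. christoffel K K L P) * christoffel L (MDir i) (MDir j) P) =
      - (real CARD('m) + 1) * h' i j P / 2 + (\<Sum>l\<in>UNIV. (\<Sum>k\<in>UNIV. C k k l P) * C l i j P)
      + (\<Sum>k\<in>UNIV. A k k P) * (P $ RhoDir * h' i j P - h i j P)"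
    unfolding sum_ambient_index[of "\<lambda>L. (\<Sum>K\<in>UNIV. christoffel K K L P) * christoffel L (MDir i) (MDir j) P"] trace_christoffel
    using t by (simp add: christoffel_simps field_simps)
  have "(\<Sum>k\<in>UNIV. A k j P * (P $ RhoDir * h' i k P - h i k P)) =
      P $ RhoDir * (\<Sum>k\<in>UNIV. A k j P * h' i k P) - h' j i P / 2" for i j
    using A_h[OF assms, of j i] by (simp add: right_diff_distrib sum_subtractf sum_distrib_left mult_ac)
  note this[of j i] this[of i j]
  moreover have "(\<Sum>K\<in>UNIV. \<Sum>L\<in>UNIV. christoffel K (MDir j) L P * christoffel L (MDir i) K P) =
      - h' j i P / 2 - h' i j P / 2 + (\<Sum>k\<in>UNIV. \<Sum>l\<in>UNIV. C k j l P * C l i k P)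
      + (\<Sum>k\<in>UNIV. A k j P * (P $ RhoDir * h' i k P - h i k P))
      + (\<Sum>l\<in>UNIV. A l i P * (P $ RhoDir * h' j l P - h j l P))"
    by (simp add: sum_ambient_index christoffel_simps sum.distrib mult.commute[of "A _ _ _"] if_distrib
        if_distribR cong: if_cong) (use t in \<open>simp add: field_simps\<close>)
  ultimately have 4: "(\<Sum>K\<in>UNIV. \<Sum>L\<in>UNIV. christoffel K (MDir j) L P * christoffel L (MDir i) K P) =
      - 2 * h' i j P + (\<Sum>k\<in>UNIV. \<Sum>l\<in>UNIV. C k j l P * C l i k P)
      + P $ RhoDir * (\<Sum>k\<in>UNIV. A k j P * h' i k P + A k i P * h' j k P)"
    using h'_symmetric[OF assms, of i j] by (simp add: sum.distrib algebra_simps)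
  show ?thesis
    unfolding ricci_G[OF assms] 1 2 3 4 RicC_def by (simp add: field_simps)
qed

lemma ricci_MR:
  assumes "P \<in> \<Omega>"
  shows "ricci G (MDir i) RhoDir P =
    (\<Sum>k\<in>UNIV. partial (MDir k) (A k i) P) - (\<Sum>k\<in>UNIV. partial RhoDir (C k i k) P)
    + (\<Sum>l\<in>UNIV. (\<Sum>k\<in>UNIV. C k k l P) * A l i P) - (\<Sum>k\<in>UNIV. \<Sum>l\<in>UNIV. A k l P * C l i k P)"
  unfolding ricci_G[OF assms]
  unfolding sum_ambient_index[of "\<lambda>L. (\<Sum>K\<in>UNIV. christoffel K K L P) * christoffel L (MDir i) RhoDir P"] trace_christoffel
  by (simp add: sum_ambient_index christoffel_simps)

lemma ricci_RM:
  assumes "P \<in> \<Omega>"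
  shows "ricci G RhoDir (MDir i) P =
    (\<Sum>k\<in>UNIV. partial (MDir k) (A k i) P) - (\<Sum>k\<in>UNIV. partial (MDir i) (A k k) P)
    + (\<Sum>l\<in>UNIV. (\<Sum>k\<in>UNIV. C k k l P) * A l i P) - (\<Sum>k\<in>UNIV. \<Sum>l\<in>UNIV. C k i l P * A l k P)"
  unfolding ricci_G[OF assms]
  unfolding sum_ambient_index[of "\<lambda>L. (\<Sum>K\<in>UNIV. christoffel K K L P) * christoffel L RhoDir (MDir i) P"] trace_christoffel
  by (simp add: sum_ambient_index christoffel_simps)

lemma ricci_RR:
  assumes "P \<in> \<Omega>"
  shows "ricci G RhoDir RhoDir P =
    - (\<Sum>k\<in>UNIV. partial RhoDir (A k k) P) - (\<Sum>k\<in>UNIV. \<Sum>l\<in>UNIV. A k l P * A l k P)"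
  unfolding ricci_G[OF assms]
  unfolding sum_ambient_index[of "\<lambda>L. (\<Sum>K\<in>UNIV. christoffel K K L P) * christoffel L RhoDir RhoDir P"] trace_christoffel
  by (simp add: sum_ambient_index christoffel_simps partial_inverse_TDir[OF assms])

lemma partial_if_inverse_TDir:
  assumes "P \<in> \<Omega>"
  shows "partial I (\<lambda>y. if b then inverse (y $ TDir) else 0) P =
    (if b \<and> I = TDir then - (inverse (P $ TDir))\<^sup>2 else 0)"
  by (cases b) (simp_all add: partial_inverse_TDir[OF assms])

text \<open>Behind the computation is the dilation field t d/dt: its covariant derivative is the
  identity, so the curvature operator annihilates it and the Ricci tensor vanishes on it, whatever
  \<gamma> is.\<close>

lemma ricci_T:
  assumes "P \<in> \<Omega>"
  shows "ricci G TDir I P = 0" "ricci G I TDir P = 0"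
proof -
  have TT: "ricci G TDir TDir P = 0"
    unfolding ricci_G[OF assms]
    unfolding sum_ambient_index[of "\<lambda>L. (\<Sum>K\<in>UNIV. christoffel K K L P) * christoffel L TDir TDir P"] trace_christoffel
    by (simp add: sum_ambient_index christoffel_simps partial_inverse_TDir[OF assms]
        partial_if_inverse_TDir[OF assms] power2_eq_square if_distrib cong: if_cong)
  have sC: "(\<Sum>k\<in>UNIV. C k k i P) = (\<Sum>k\<in>UNIV. C k i k P)" for i
    by (intro sum.cong refl C_symmetric[OF assms])
  have TM: "ricci G TDir (MDir i) P = 0" for i
    unfolding ricci_G[OF assms]
    unfolding sum_ambient_index[of "\<lambda>L. (\<Sum>K\<in>UNIV. christoffel K K L P) * christoffel L TDir (MDir i) P"] trace_christoffel
    using sC[of i]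
    by (simp add: sum_ambient_index christoffel_simps partial_inverse_TDir[OF assms]
        partial_if_inverse_TDir[OF assms] if_distrib sum_distrib_right[symmetric] cong: if_cong)
  have MT: "ricci G (MDir i) TDir P = 0" for i
    unfolding ricci_G[OF assms]
    unfolding sum_ambient_index[of "\<lambda>L. (\<Sum>K\<in>UNIV. christoffel K K L P) * christoffel L (MDir i) TDir P"] trace_christoffel
    using sC[of i]
    by (simp add: sum_ambient_index christoffel_simps partial_inverse_TDir[OF assms] partial_TDir[OF assms]
        partial_if_inverse_TDir[OF assms] if_distrib if_distribR sum_distrib_left[symmetric] sum_distrib_right[symmetric] cong: if_cong)
  have TR: "ricci G TDir RhoDir P = 0"
    unfolding ricci_G[OF assms]
    unfolding sum_ambient_index[of "\<lambda>L. (\<Sum>K\<in>UNIV. christoffel K K L P) * christoffel L TDir RhoDir P"] trace_christoffel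
    by (simp add: sum_ambient_index christoffel_simps partial_inverse_TDir[OF assms]
        partial_if_inverse_TDir[OF assms] if_distrib sum_distrib_left[symmetric] sum_distrib_right[symmetric] cong: if_cong)
  have RT: "ricci G RhoDir TDir P = 0"
    unfolding ricci_G[OF assms]
    unfolding sum_ambient_index[of "\<lambda>L. (\<Sum>K\<in>UNIV. christoffel K K L P) * christoffel L RhoDir TDir P"] trace_christoffel
    by (simp add: sum_ambient_index christoffel_simps partial_inverse_TDir[OF assms] partial_TDir[OF assms]
        partial_if_inverse_TDir[OF assms] if_distrib if_distribR sum_distrib_left[symmetric] sum_distrib_right[symmetric] cong: if_cong)
  show "ricci G TDir I P = 0" "ricci G I TDir P = 0"
    using TT TM MT TR RT by (cases I; simp)+
qed

lemma smooth_ricci_G: "smooth_on \<Omega> (ricci G I J)"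
  by (rule smooth_on_ricci[OF open_dom smooth_G matrix_inv_G(1)])

section \<open>The Laplacian and the order of vanishing\<close>

lemma laplacian_G:
  assumes "P \<in> \<Omega>"
  shows "laplacian G f P = (\<Sum>I\<in>UNIV. \<Sum>J\<in>UNIV. ginv P I J *
    (partial I (\<lambda>y. partial J f y) P - (\<Sum>K\<in>UNIV. christoffel K I J P * partial K f P)))"
  unfolding laplacian_def matrix_inv_G(2)[OF assms] levi_civita_G[OF assms] ..

lemma laplacian_ln:
  assumes "P \<in> \<Omega>"
  shows "laplacian G (\<lambda>P. ln (P $ TDir)) P = (inverse (P $ TDir))\<^sup>2 * (\<Sum>k\<in>UNIV. A k k P)"
proof -
  have t: "P $ TDir > 0" using dom_pos[OF assms] .
  have p: "partial I (\<lambda>P. ln (P $ TDir)) Q = (if I = TDir then inverse (Q $ TDir) else 0)"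
    if "Q \<in> \<Omega>" for I Q
    using partial_ln[OF smooth_on_coord[OF open_dom] that dom_pos[OF that], of I]
    by (auto simp: partial_coord divide_inverse)
  have pp: "partial I (\<lambda>y. partial J (\<lambda>P. ln (P $ TDir)) y) P =
      partial I (\<lambda>y. if J = TDir then inverse (y $ TDir) else 0) P" for I J
    by (rule partial_cong[OF open_dom assms p])
  have "laplacian G (\<lambda>P. ln (P $ TDir)) P =
      (\<Sum>i\<in>UNIV. \<Sum>j\<in>UNIV. hi i j P / (P $ TDir)\<^sup>2 * (P $ TDir * h' i j P / 2 * inverse (P $ TDir)))"
    unfolding laplacian_G[OF assms] pp p[OF assms] partial_if_inverse_TDir[OF assms]
    by (simp add: sum_ambient_index ginv_def christoffel_simps)
  also have "\<dots> = (inverse (P $ TDir))\<^sup>2 * (\<Sum>k\<in>UNIV. A k k P)"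
    unfolding A_def sum_distrib_left sum_divide_distrib
    using t by (intro sum.cong refl) (simp add: field_simps power2_eq_square)
  finally show ?thesis .
qed

lemma smooth_ginv: "smooth_on \<Omega> (\<lambda>P. ginv P I J)"
  by (cases I; cases J; simp add: ginv_def)
    (auto intro!: smooth_on_const smooth_on_mult smooth_on_minus smooth_on_divide smooth_on_power
      smooth_on_coord smooth_hi open_dom dest: dom_pos)

lemma vanishes_laplacian:
  assumes f: "vanishes (Suc k) \<Omega> RhoDir f"
  shows "vanishes k \<Omega> RhoDir (laplacian G f)"
proof -
  note sf = vanishes_smooth_on[OF f]
  have term1: "vanishes k \<Omega> RhoDir (\<lambda>P. ginv P I J * partial I (\<lambda>y. partial J f y) P)" for I J
  proof (cases "I = RhoDir \<and> J = RhoDir")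
    case False
    \<comment> \<open>At most one of the two derivatives is across the hypersurface, so only one
      order is lost.\<close>
    have "vanishes k \<Omega> RhoDir (\<lambda>P. partial I (\<lambda>y. partial J f y) P)"
    proof (cases "J = RhoDir")
      case True
      then have "I \<noteq> RhoDir" using False by simp
      from vanishes_partial[OF open_dom vanishes_partial_any[OF open_dom f] this] show ?thesis .
    next
      case False
      show ?thesis
        by (rule vanishes_partial_any[OF open_dom vanishes_partial[OF open_dom f False]])
    qed
    then show ?thesis
      by (intro vanishes_mult_smooth_on smooth_ginv open_dom)
  next
    case True
    let ?g = "\<lambda>P. partial RhoDir (\<lambda>y. partial RhoDir f y) P"
    \<comment> \<open>Two \<rho>-derivatives cost two orders and the factor \<rho> regains one. For
      k = 0 there is only one order to give, but then mere smoothness is claimed.\<close>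
    have "vanishes k \<Omega> RhoDir (\<lambda>P. P $ RhoDir * ?g P)"
    proof (cases k)
      case 0
      then show ?thesis
        using sf by (simp add: smooth_on_mult open_dom smooth_on_coord smooth_on_partial)
    next
      case (Suc k')
      have "vanishes (Suc k') \<Omega> RhoDir (\<lambda>P. P $ RhoDir * ?g P)"
        using f unfolding Suc by (intro vanishes_coord_mult vanishes_partial_any open_dom)
      then show ?thesis unfolding Suc .
    qed
    note v = this
    have s: "smooth_on \<Omega> (\<lambda>P. - 2 / (P $ TDir)\<^sup>2)"
      by (auto intro!: smooth_on_const smooth_on_minus smooth_on_divide smooth_on_power
          smooth_on_coord open_dom dest: dom_pos)
    from vanishes_mult_smooth_on[OF open_dom s v] show ?thesis
      using True by (simp add: ginv_def mult_ac)
  qed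
  have term2: "vanishes k \<Omega> RhoDir (\<lambda>P. ginv P I J * (\<Sum>K\<in>UNIV. christoffel K I J P * partial K f P))" for I J
    by (intro vanishes_mult_smooth_on vanishes_sum smooth_ginv smooth_christoffel open_dom
        vanishes_partial_any f)
  have "vanishes k \<Omega> RhoDir (\<lambda>P. \<Sum>I\<in>UNIV. \<Sum>J\<in>UNIV. ginv P I J * partial I (\<lambda>y. partial J f y) P -
      ginv P I J * (\<Sum>K\<in>UNIV. christoffel K I J P * partial K f P))"
    by (intro vanishes_sum vanishes_diff term1 term2 open_dom)
  then show ?thesis
    by (subst vanishes_cong[OF open_dom laplacian_G]) (simp_all add: right_diff_distrib)
qed

lemma ambient_Q_eq_0:
  assumes "vanishes (CARD('m) div 2) \<Omega> RhoDir (\<lambda>P. \<Sum>k\<in>UNIV. A k k P)"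
    and "CARD('m) \<ge> 2" and "(x, 0) \<in> W"
  shows "ambient_Q \<gamma> x = 0"
proof -
  let ?n = "CARD('m) div 2"
  let ?ln = "\<lambda>P :: real^'m ambient_index. ln (P $ TDir)"
  \<comment> \<open>The exponent is \<open>Suc j\<close> against the order \<open>?n - j\<close>:
    the first Laplacian costs nothing, since by hypothesis its result already has order
    \<open>?n\<close>. Hence one order is left after all \<open>?n\<close> applications.\<close>
  have "vanishes (?n - j) \<Omega> RhoDir ((laplacian G ^^ Suc j) ?ln)" if "j < ?n" for j
    using that
  proof (induction j)
    case 0
    have "smooth_on \<Omega> (\<lambda>P. (inverse (P $ TDir))\<^sup>2)"
      by (auto intro!: smooth_on_power smooth_on_inverse smooth_on_coord open_dom dest: dom_pos)
    then have "vanishes ?n \<Omega> RhoDir (\<lambda>P. (inverse (P $ TDir))\<^sup>2 * (\<Sum>k\<in>UNIV. A k k P))"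
      by (intro vanishes_mult_smooth_on open_dom assms(1))
    then show ?case
      by (simp add: vanishes_cong[OF open_dom laplacian_ln])
  next
    case (Suc j)
    have "vanishes (Suc (?n - Suc j)) \<Omega> RhoDir ((laplacian G ^^ Suc j) ?ln)"
      using Suc by (simp add: Suc_diff_Suc del: vanishes.simps(2) funpow.simps)
    from vanishes_laplacian[OF this] show ?case
      by simp
  qed
  from this[of "?n - 1"] have "vanishes 1 \<Omega> RhoDir ((laplacian G ^^ ?n) ?ln)"
    using assms(2) by (simp del: vanishes.simps(2) funpow.simps)
  moreover have "ambient_point 1 x 0 \<in> \<Omega>"
    using assms(3) by (simp add: ambient_domain_def ambient_point_def base_point_def)
  ultimately show ?thesis
    unfolding ambient_Q_def by (auto simp: ambient_point_def)
qed

end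

section \<open>Uniqueness of the ambient metric up to the critical order\<close>

text \<open>Telescoping through the mixed product a' b; the smoothness assumptions concern just
  these two factors.\<close>

lemma vanishes_diff_mult:
  fixes a b a' b' :: "real^'k::finite \<Rightarrow> real"
  assumes "open S" "vanishes k S r (\<lambda>x. a x - a' x)" "vanishes k S r (\<lambda>x. b x - b' x)"
    and "smooth_on S a'" "smooth_on S b"
  shows "vanishes k S r (\<lambda>x. a x * b x - a' x * b' x)"
proof -
  have "vanishes k S r (\<lambda>x. b x * (a x - a' x) + a' x * (b x - b' x))"
    by (intro vanishes_add vanishes_mult_smooth_on assms)
  then show ?thesis
    by (simp add: algebra_simps)
qed

lemma vanishes_diff_sum:
  assumes "open S" "\<And>i. i \<in> I \<Longrightarrow> vanishes k S r (\<lambda>x. f i x - g i x)"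
  shows "vanishes k S r (\<lambda>x. (\<Sum>i\<in>I. f i x) - (\<Sum>i\<in>I. g i x))"
  using vanishes_sum[OF assms(1), of I k r "\<lambda>i x. f i x - g i x"] assms(2)
  by (simp add: sum_subtractf)

lemma vanishes_diff_partial:
  assumes "open S" "smooth_on S f" "smooth_on S g" "i \<noteq> r" "vanishes k S r (\<lambda>x. f x - g x)"
  shows "vanishes k S r (\<lambda>x. partial i f x - partial i g x)"
proof -
  have "vanishes k S r (\<lambda>x. partial i (\<lambda>x. f x - g x) x)"
    by (rule vanishes_partial[OF assms(1,5,4)])
  then show ?thesis
    by (subst (asm) vanishes_cong[OF assms(1) partial_diff[OF assms(2,3)]])
qed

lemma vanishes_diff_partial_Suc:
  assumes "open S" "smooth_on S f" "smooth_on S g" "vanishes (Suc k) S r (\<lambda>x. f x - g x)"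
  shows "vanishes k S r (\<lambda>x. partial r f x - partial r g x)"
proof -
  have "vanishes k S r (\<lambda>x. partial r (\<lambda>x. f x - g x) x)"
    using assms(4) by simp
  then show ?thesis
    by (subst (asm) vanishes_cong[OF assms(1) partial_diff[OF assms(2,3)]])
qed

text \<open>The metric \<gamma>0 is the reference. Both metrics live over the same W, so that
  differences of their tensors are functions on one domain.\<close>

locale ambient_pair = ambient \<gamma> W + B: ambient \<gamma>0 W
  for \<gamma> :: "real^'m::finite \<Rightarrow> real \<Rightarrow> real^'m^'m" and W and \<gamma>0
begin

abbreviation V :: "nat \<Rightarrow> (real^'m ambient_index \<Rightarrow> real) \<Rightarrow> bool" where
  "V k \<equiv> vanishes k \<Omega> RhoDir"

text \<open>When the metrics agree to order \<open>Suc k'\<close>, the leading term of this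
  difference, of order k', is the first one not yet known to vanish.\<close>

definition E' :: "'m \<Rightarrow> 'm \<Rightarrow> real^'m ambient_index \<Rightarrow> real" where
  "E' i j P = h' i j P - B.h' i j P"

definition T :: "real^'m ambient_index \<Rightarrow> real" where
  "T P = (\<Sum>k\<in>UNIV. \<Sum>l\<in>UNIV. hi k l P * E' k l P)"

section \<open>Linearization at a given order of agreement\<close>

context
  fixes k' :: nat
  assumes E: "\<And>i j. V (Suc k') (\<lambda>P. h i j P - B.h i j P)"
begin

text \<open>The resolvent identity: the difference of two inverses is minus the difference of the
  matrices, multiplied by one inverse on each side.\<close>

lemma E_hi: "V (Suc k') (\<lambda>P. hi i j P - B.hi i j P)"
proof -
  have "V (Suc k') (\<lambda>P. \<Sum>l\<in>UNIV. \<Sum>m\<in>UNIV. hi i l P * (B.hi m j P * (h l m P - B.h l m P)))"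
    by (intro vanishes_sum vanishes_mult_smooth_on E open_dom smooth_hi B.smooth_hi)
  note vanishes_minus[OF open_dom this]
  moreover have "hi i j P - B.hi i j P =
      - (\<Sum>l\<in>UNIV. \<Sum>m\<in>UNIV. hi i l P * (B.hi m j P * (h l m P - B.h l m P)))" if "P \<in> \<Omega>" for P
  proof -
    have "(\<Sum>l\<in>UNIV. \<Sum>m\<in>UNIV. hi i l P * (B.hi m j P * h l m P)) =
        (\<Sum>m\<in>UNIV. B.hi m j P * (\<Sum>l\<in>UNIV. hi i l P * h l m P))"
      by (subst sum.swap) (simp add: sum_distrib_left mult_ac)
    also have "\<dots> = B.hi i j P"
      by (simp add: hi_h[OF that] if_distrib cong: if_cong)
    finally have 1: "(\<Sum>l\<in>UNIV. \<Sum>m\<in>UNIV. hi i l P * (B.hi m j P * h l m P)) = B.hi i j P" .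
    have "(\<Sum>l\<in>UNIV. \<Sum>m\<in>UNIV. hi i l P * (B.hi m j P * B.h l m P)) =
        (\<Sum>l\<in>UNIV. hi i l P * (\<Sum>m\<in>UNIV. B.h l m P * B.hi m j P))"
      by (simp add: sum_distrib_left mult_ac)
    also have "\<dots> = hi i j P"
      by (simp add: B.h_hi[OF that] if_distrib cong: if_cong)
    finally show ?thesis
      using 1 by (simp add: right_diff_distrib sum_subtractf)
  qed
  ultimately show ?thesis
    by (subst vanishes_cong[OF open_dom])
qed

text \<open>No order is lost, as the symbols of the slices contain only derivatives in base
  directions.\<close>

lemma E_C: "V (Suc k') (\<lambda>P. C k i j P - B.C k i j P)"
proof -
  let ?D = "\<lambda>l P. partial (MDir i) (h j l) P + partial (MDir j) (h i l) P - partial (MDir l) (h i j) P"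
  let ?DB = "\<lambda>l P. partial (MDir i) (B.h j l) P + partial (MDir j) (B.h i l) P - partial (MDir l) (B.h i j) P"
  have p: "V (Suc k') (\<lambda>P. partial (MDir m) (h i j) P - partial (MDir m) (B.h i j) P)" for m i j
    by (rule vanishes_diff_partial[OF open_dom smooth_h B.smooth_h _ E]) simp
  have "V (Suc k') (\<lambda>P. ?D l P - ?DB l P)" for l
    using vanishes_diff[OF open_dom vanishes_add[OF open_dom p[where m = i and i = j and j = l]
        p[where m = j and i = i and j = l]] p[where m = l and i = i and j = j]]
    by (simp add: algebra_simps del: vanishes.simps)
  then have "V (Suc k') (\<lambda>P. (\<Sum>l\<in>UNIV. hi k l P * ?D l P) - (\<Sum>l\<in>UNIV. B.hi k l P * ?DB l P))"
    by (intro vanishes_diff_sum vanishes_diff_mult E_hi open_dom B.smooth_hi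
        smooth_on_diff smooth_on_add smooth_on_partial smooth_h)
  from vanishes_cmult[OF open_dom this, of "1/2"] show ?thesis
    by (simp add: C_def B.C_def diff_divide_distrib del: vanishes.simps)
qed

lemma E_RicC: "V (Suc k') (\<lambda>P. RicC i j P - B.RicC i j P)"
proof -
  have p: "V (Suc k') (\<lambda>P. partial (MDir m) (C k i j) P - partial (MDir m) (B.C k i j) P)" for m k i j
    by (rule vanishes_diff_partial[OF open_dom smooth_C B.smooth_C _ E_C]) simp
  have 1: "V (Suc k') (\<lambda>P. (\<Sum>k\<in>UNIV. partial (MDir k) (C k i j) P) - (\<Sum>k\<in>UNIV. partial (MDir k) (B.C k i j) P))"
    by (intro vanishes_diff_sum p open_dom)
  have 2: "V (Suc k') (\<lambda>P. (\<Sum>k\<in>UNIV. partial (MDir j) (C k i k) P) - (\<Sum>k\<in>UNIV. partial (MDir j) (B.C k i k) P))"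
    by (intro vanishes_diff_sum p open_dom)
  have 3: "V (Suc k') (\<lambda>P. (\<Sum>l\<in>UNIV. (\<Sum>k\<in>UNIV. C k k l P) * C l i j P)
      - (\<Sum>l\<in>UNIV. (\<Sum>k\<in>UNIV. B.C k k l P) * B.C l i j P))"
    by (intro vanishes_diff_sum vanishes_diff_mult E_C open_dom smooth_on_sum smooth_C B.smooth_C)
  have 4: "V (Suc k') (\<lambda>P. (\<Sum>k\<in>UNIV. \<Sum>l\<in>UNIV. C k j l P * C l i k P)
      - (\<Sum>k\<in>UNIV. \<Sum>l\<in>UNIV. B.C k j l P * B.C l i k P))"
    by (intro vanishes_diff_sum vanishes_diff_mult E_C open_dom smooth_C B.smooth_C)
  from vanishes_diff[OF open_dom vanishes_add[OF open_dom vanishes_diff[OF open_dom 1 2] 3] 4]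
  show ?thesis
    by (simp add: RicC_def B.RicC_def algebra_simps del: vanishes.simps)
qed

lemma E_h': "V k' (E' i j)"
  unfolding E'_def h'_def B.h'_def
  by (rule vanishes_diff_partial_Suc[OF open_dom smooth_h B.smooth_h E])

text \<open>One order is lost here to the \<rho>-derivative in \<open>A\<close>.\<close>

lemma E_A: "V k' (\<lambda>P. A k j P - B.A k j P)"
proof -
  have "V k' (\<lambda>P. (\<Sum>l\<in>UNIV. hi k l P * h' j l P) - (\<Sum>l\<in>UNIV. B.hi k l P * B.h' j l P))"
    using E_h' unfolding E'_def
    by (intro vanishes_diff_sum vanishes_diff_mult vanishes_SucD[OF E_hi] open_dom B.smooth_hi smooth_h')
  from vanishes_cmult[OF open_dom this, of "1/2"] show ?thesis
    by (simp add: A_def B.A_def diff_divide_distrib)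
qed

text \<open>Unlike single entries of \<open>A\<close>, the trace is controlled to the full order
  once T / 2 is split off: the rest is the \<rho>-derivative of the reference metric contracted with
  the difference of the inverses.\<close>

lemma E_trace: "V (Suc k') (\<lambda>P. (\<Sum>k\<in>UNIV. A k k P) - (\<Sum>k\<in>UNIV. B.A k k P) - T P / 2)"
proof -
  have "V (Suc k') (\<lambda>P. \<Sum>k\<in>UNIV. \<Sum>l\<in>UNIV. B.h' k l P * (hi k l P - B.hi k l P))"
    by (intro vanishes_sum vanishes_mult_smooth_on E_hi open_dom B.smooth_h')
  from vanishes_cmult[OF open_dom this, of "1/2"] show ?thesis
    by (simp add: A_def B.A_def T_def E'_def sum_subtractf sum_divide_distrib sum_distrib_left
        algebra_simps diff_divide_distrib del: vanishes.simps)
qed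

text \<open>Linearization of the ambient Ricci tensor in the first coefficient in which two ambient
  metrics may differ: the derivative terms in the base directions are of higher order.\<close>

lemma ricci_diff:
  "V (Suc k') (\<lambda>P. ricci G (MDir i) (MDir j) P - ricci B.G (MDir i) (MDir j) P
     - ((real (Suc k') - real CARD('m) / 2) * E' i j P - T P / 2 * h i j P))"
proof -
  let ?r = "\<lambda>P :: real^'m ambient_index. P $ RhoDir"
  let ?a = "\<lambda>P. \<Sum>k\<in>UNIV. A k k P"
  let ?b = "\<lambda>P. \<Sum>k\<in>UNIV. B.A k k P"
  have smE: "smooth_on \<Omega> (E' i j)"
    by (rule vanishes_smooth_on[OF E_h'])
  \<comment> \<open>Since \<open>E'\<close> has order k', its \<rho>-derivative times \<rho> may be
    replaced by k' times \<open>E'\<close>. With the term -(m/2 - 1) \<open>h'\<close> of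
    \<open>ricci_MM\<close> this gives the coefficient \<open>Suc k'\<close> - m/2.\<close>
  have 1: "V (Suc k') (\<lambda>P. ?r P * partial RhoDir (E' i j) P - real k' * E' i j P)"
    by (rule vanishes_euler[OF open_dom E_h'])
  have 2: "V (Suc k') (\<lambda>P. ?r P * (?a P * h' i j P - ?b P * B.h' i j P))"
    using E_h' unfolding E'_def
    by (intro vanishes_coord_mult vanishes_diff_mult vanishes_diff_sum E_A open_dom smooth_on_sum
        B.smooth_A smooth_h')
  have 3: "V (Suc k') (\<lambda>P. h i j P * (?a P - ?b P - T P / 2))"
    by (intro vanishes_mult_smooth_on E_trace open_dom smooth_h)
  have 4: "V (Suc k') (\<lambda>P. ?b P * (h i j P - B.h i j P))"
    by (intro vanishes_mult_smooth_on E open_dom smooth_on_sum B.smooth_A)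
  have AE: "V k' (\<lambda>P. A k j P * h' i l P - B.A k j P * B.h' i l P)" for k i j l
    using E_h' unfolding E'_def
    by (intro vanishes_diff_mult E_A open_dom B.smooth_A smooth_h')
  have "V k' (\<lambda>P. (A k j P * h' i k P + A k i P * h' j k P)
      - (B.A k j P * B.h' i k P + B.A k i P * B.h' j k P))" for k
    using vanishes_add[OF open_dom AE[of k j i k] AE[of k i j k]] by (simp add: algebra_simps)
  then have 5: "V (Suc k') (\<lambda>P. ?r P * ((\<Sum>k\<in>UNIV. A k j P * h' i k P + A k i P * h' j k P)
      - (\<Sum>k\<in>UNIV. B.A k j P * B.h' i k P + B.A k i P * B.h' j k P)))"
    by (intro vanishes_coord_mult vanishes_diff_sum open_dom)
  have "V (Suc k') (\<lambda>P. (?r P * partial RhoDir (E' i j) P - real k' * E' i j P)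
      + ?r P * (?a P * h' i j P - ?b P * B.h' i j P)
      - h i j P * (?a P - ?b P - T P / 2) - ?b P * (h i j P - B.h i j P)
      - ?r P * ((\<Sum>k\<in>UNIV. A k j P * h' i k P + A k i P * h' j k P)
      - (\<Sum>k\<in>UNIV. B.A k j P * B.h' i k P + B.A k i P * B.h' j k P))
      + (RicC i j P - B.RicC i j P))"
    by (rule vanishes_add[OF open_dom vanishes_diff[OF open_dom vanishes_diff[OF open_dom
          vanishes_diff[OF open_dom vanishes_add[OF open_dom 1 2] 3] 4] 5] E_RicC])
  moreover have "?r P * partial RhoDir (E' i j) P =
      ?r P * partial RhoDir (h' i j) P - ?r P * partial RhoDir (B.h' i j) P"
    if "P \<in> \<Omega>" for P
    unfolding E'_def partial_diff[OF smooth_h' B.smooth_h' that] by (rule right_diff_distrib)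
  ultimately show ?thesis
    by (subst vanishes_cong[OF open_dom])
      (simp_all add: ricci_MM B.ricci_MM E'_def algebra_simps del: vanishes.simps)
qed

lemma contract_linearization:
  assumes "P \<in> \<Omega>"
  shows "(\<Sum>i\<in>UNIV. \<Sum>j\<in>UNIV. hi i j P * (c * E' i j P - T P / 2 * h i j P)) =
    (c - real CARD('m) / 2) * T P"
proof -
  have "(\<Sum>i\<in>UNIV. \<Sum>j\<in>UNIV. hi i j P * (c * E' i j P - T P / 2 * h i j P)) =
      c * (\<Sum>i\<in>UNIV. \<Sum>j\<in>UNIV. hi i j P * E' i j P) -
      T P / 2 * (\<Sum>i\<in>UNIV. \<Sum>j\<in>UNIV. hi i j P * h i j P)"
    by (simp add: right_diff_distrib sum_subtractf sum_distrib_left mult_ac)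
  also have "(\<Sum>i\<in>UNIV. \<Sum>j\<in>UNIV. hi i j P * E' i j P) = T P"
    by (simp only: T_def)
  also have "(\<Sum>i\<in>UNIV. \<Sum>j\<in>UNIV. hi i j P * h i j P) = real CARD('m)"
    by (simp add: hi_h2[OF assms])
  finally show ?thesis by (simp add: algebra_simps)
qed

text \<open>Contracting the linearization leaves (\<open>Suc k'\<close> - m) T, so m is the only
  excluded order. In particular the critical order m/2 is covered, at which the coefficient of
  \<open>E'\<close> itself is 0.\<close>

lemma trace_vanishes:
  assumes tr: "V (Suc k') (\<lambda>P. \<Sum>i\<in>UNIV. \<Sum>j\<in>UNIV. hi i j P *
      (ricci G (MDir i) (MDir j) P - ricci B.G (MDir i) (MDir j) P))"
    and k: "Suc k' \<noteq> CARD('m)"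
  shows "V (Suc k') T"
proof -
  let ?c = "real (Suc k') - real CARD('m) / 2"
  have "V (Suc k') (\<lambda>P. \<Sum>i\<in>UNIV. \<Sum>j\<in>UNIV. hi i j P *
      (ricci G (MDir i) (MDir j) P - ricci B.G (MDir i) (MDir j) P
       - (?c * E' i j P - T P / 2 * h i j P)))"
    by (intro vanishes_sum vanishes_mult_smooth_on ricci_diff open_dom smooth_hi)
  note vanishes_diff[OF open_dom tr this]
  then have "V (Suc k') (\<lambda>P. \<Sum>i\<in>UNIV. \<Sum>j\<in>UNIV. hi i j P * (?c * E' i j P - T P / 2 * h i j P))"
    by (simp add: right_diff_distrib sum_subtractf del: vanishes.simps)
  then have "V (Suc k') (\<lambda>P. (?c - real CARD('m) / 2) * T P)"
    by (subst (asm) vanishes_cong[OF open_dom contract_linearization])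
  from vanishes_cmult[OF open_dom this, of "inverse (?c - real CARD('m) / 2)"]
  have "V (Suc k') (\<lambda>P. inverse (?c - real CARD('m) / 2) * (?c - real CARD('m) / 2) * T P)"
    by (simp only: mult.assoc)
  moreover have "inverse (?c - real CARD('m) / 2) * (?c - real CARD('m) / 2) = 1"
    using k by (intro left_inverse) (simp add: algebra_simps flip: of_nat_Suc)
  ultimately show ?thesis
    by (simp only: mult_1_left)
qed

text \<open>With T under control, the coefficient \<open>Suc k'\<close> - m/2 can be divided out
  below the critical order. Then \<open>E'\<close> gains one order, and so do the metrics, which
  already agree on \<rho> = 0.\<close>

lemma vanishes_step:
  assumes R: "\<And>i j. V (Suc k') (\<lambda>P. ricci G (MDir i) (MDir j) P - ricci B.G (MDir i) (MDir j) P)"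
    and k: "2 * Suc k' < CARD('m)"
  shows "V (Suc (Suc k')) (\<lambda>P. h i j P - B.h i j P)"
proof -
  let ?c = "real (Suc k') - real CARD('m) / 2"
  have T: "V (Suc k') T"
    using k by (intro trace_vanishes vanishes_sum vanishes_mult_smooth_on R open_dom smooth_hi) auto
  have "V (Suc k') (\<lambda>P. h i j P * T P)"
    by (intro vanishes_mult_smooth_on T open_dom smooth_h)
  note T2 = vanishes_cmult[OF open_dom this, of "1/2"]
  from vanishes_add[OF open_dom vanishes_diff[OF open_dom R[of i j] ricci_diff[of i j]] T2]
  have "V (Suc k') (\<lambda>P. ?c * E' i j P)"
    by (simp add: algebra_simps del: vanishes.simps)
  from vanishes_cmult[OF open_dom this, of "inverse ?c"]
  have "V (Suc k') (\<lambda>P. inverse ?c * ?c * E' i j P)"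
    by (simp only: mult.assoc)
  moreover have "inverse ?c * ?c = 1"
  proof (rule left_inverse)
    have "real (2 * Suc k') < real CARD('m)"
      using k by (simp only: of_nat_less_iff)
    then show "?c \<noteq> 0" by simp
  qed
  ultimately have "V (Suc k') (E' i j)"
    by (simp only: mult_1_left)
  moreover have "E' i j P = partial RhoDir (\<lambda>P. h i j P - B.h i j P) P" if "P \<in> \<Omega>" for P
    unfolding E'_def h'_def B.h'_def
    by (rule partial_diff[OF smooth_h B.smooth_h that, symmetric])
  ultimately have "V (Suc k') (\<lambda>P. partial RhoDir (\<lambda>P. h i j P - B.h i j P) P)"
    by (subst (asm) vanishes_cong[OF open_dom])
  then show ?thesis
    using E[of i j] unfolding vanishes.simps(2)[of "Suc k'"] by simp
qed

end

text \<open>Agreement can be pushed up to order n, where \<open>vanishes_step\<close> ends. There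
  the trace condition still yields T to order n, and \<open>E_trace\<close> turns this into the
  trace of \<open>A\<close>, that of the reference metric being 0.\<close>

lemma trace_vanishes_flat:
  assumes init: "\<And>i j P. P \<in> \<Omega> \<Longrightarrow> P $ RhoDir = 0 \<Longrightarrow> h i j P = B.h i j P"
    and flat: "\<And>i j P. P \<in> \<Omega> \<Longrightarrow> ricci B.G (MDir i) (MDir j) P = 0"
    and trace: "\<And>P. P \<in> \<Omega> \<Longrightarrow> (\<Sum>k\<in>UNIV. B.A k k P) = 0"
    and R: "\<And>i j. V (n - 1) (ricci G (MDir i) (MDir j))"
    and tr: "V n (\<lambda>P. \<Sum>i\<in>UNIV. \<Sum>j\<in>UNIV. hi i j P * ricci G (MDir i) (MDir j) P)"
    and n: "CARD('m) = 2 * n" "n \<ge> 1"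
  shows "V n (\<lambda>P. \<Sum>k\<in>UNIV. A k k P)"
proof -
  have E: "V (Suc k) (\<lambda>P. h i j P - B.h i j P)" if "k < n" for k i j
    using that
  proof (induction k arbitrary: i j)
    case 0
    then show ?case
      using init by (simp add: smooth_on_diff smooth_h B.smooth_h open_dom smooth_on_partial)
  next
    case (Suc k)
    show ?case
    proof (rule vanishes_step)
      show "V (Suc k) (\<lambda>P. h i j P - B.h i j P)" for i j
        using Suc by simp
      have "V (Suc k) (ricci G (MDir i) (MDir j))" for i j
        by (rule vanishes_mono[OF R]) (use Suc.prems in simp)
      then show "V (Suc k) (\<lambda>P. ricci G (MDir i) (MDir j) P - ricci B.G (MDir i) (MDir j) P)" for i j
        by (subst vanishes_cong[OF open_dom]) (simp_all add: flat del: vanishes.simps)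
      show "2 * Suc k < CARD('m)"
        using Suc.prems n by simp
    qed
  qed
  obtain k where k: "n = Suc k"
    using n(2) by (cases n) auto
  have Ek: "V (Suc k) (\<lambda>P. h i j P - B.h i j P)" for i j
    by (rule E) (simp add: k)
  have "V (Suc k) (\<lambda>P. \<Sum>i\<in>UNIV. \<Sum>j\<in>UNIV. hi i j P *
      (ricci G (MDir i) (MDir j) P - ricci B.G (MDir i) (MDir j) P))"
    using tr unfolding k by (subst vanishes_cong[OF open_dom]) (simp_all add: flat del: vanishes.simps)
  then have "V (Suc k) T"
    by (rule trace_vanishes[OF Ek]) (use n k in simp_all)
  from vanishes_add[OF open_dom E_trace[OF Ek] vanishes_cmult[OF open_dom this, of "1/2"]]
  have "V (Suc k) (\<lambda>P. (\<Sum>k\<in>UNIV. A k k P) - (\<Sum>k\<in>UNIV. B.A k k P))"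
    by (simp del: vanishes.simps)
  then show ?thesis
    unfolding k by (subst (asm) vanishes_cong[OF open_dom]) (simp_all add: trace del: vanishes.simps)
qed

end

section \<open>A Ricci-flat ambient metric of the Patterson--Walker metric\<close>

lemma sum_UNIV_Plus:
  "(\<Sum>I\<in>UNIV. f I) = (\<Sum>a\<in>UNIV. f (Inl a)) + (\<Sum>b\<in>UNIV. f (Inr b))"
  for f :: "'a::finite + 'b::finite \<Rightarrow> real"
  by (simp add: UNIV_Plus_UNIV[symmetric] sum.Plus del: UNIV_Plus_UNIV)

definition inl_part :: "real^('n::finite + 'n) \<Rightarrow> real^'n" where
  "inl_part y = (\<chi> a. y $ Inl a)"

lemma bounded_linear_inl_part: "bounded_linear inl_part"
  unfolding linear_conv_bounded_linear[symmetric]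
  by (rule linearI) (auto simp: inl_part_def vec_eq_iff)

lemma inl_part_add_axis:
  "inl_part (base_point (P + s *\<^sub>R axis TDir 1)) = inl_part (base_point P)"
  "inl_part (base_point (P + s *\<^sub>R axis RhoDir 1)) = inl_part (base_point P)"
  "inl_part (base_point (P + s *\<^sub>R axis (MDir (Inr a)) 1)) = inl_part (base_point P)"
  by (auto simp: inl_part_def base_point_def vec_eq_iff axis_def)

lemma inl_part_axis: "inl_part (base_point (axis (MDir (Inl a)) 1)) = axis a 1"
  by (auto simp: inl_part_def base_point_def vec_eq_iff axis_def)

locale patterson_walker =
  fixes X :: "(real^'n::finite) set"
    and \<Gamma> :: "real^'n \<Rightarrow> 'n \<Rightarrow> 'n \<Rightarrow> 'n \<Rightarrow> real"
    and W :: "((real^('n + 'n)) \<times> real) set"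
  assumes open_X: "open X"
    and smooth_\<Gamma>: "smooth_on X (\<lambda>x. \<Gamma> x a k b)"
    and open_pw_W: "open W"
    and W_X: "(y, \<rho>) \<in> W \<Longrightarrow> inl_part y \<in> X"
    and card_n: "CARD('n) \<ge> 2"
begin

text \<open>The combination of Christoffel symbols that \<open>pw_matrix\<close> contains; the
  middle index is the upper one.\<close>

definition sym\<Gamma> :: "'n \<Rightarrow> 'n \<Rightarrow> 'n \<Rightarrow> real^'n \<Rightarrow> real" where
  "sym\<Gamma> a k b x = (\<Gamma> x a k b + \<Gamma> x b k a) / 2"

text \<open>\<open>2 / (n - 1)\<close> times the symmetrized Ricci tensor of the connection \<open>sym\<Gamma>\<close>:\<close>

definition Schouten :: "'n \<Rightarrow> 'n \<Rightarrow> real^'n \<Rightarrow> real" where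
  "Schouten a b x =
     (2 * (\<Sum>c\<in>UNIV. partial c (sym\<Gamma> a c b) x) - (\<Sum>c\<in>UNIV. partial a (sym\<Gamma> b c c) x)
      - (\<Sum>c\<in>UNIV. partial b (sym\<Gamma> a c c) x)
      + 2 * (\<Sum>c\<in>UNIV. \<Sum>d\<in>UNIV. sym\<Gamma> c c d x * sym\<Gamma> a d b x)
      - 2 * (\<Sum>c\<in>UNIV. \<Sum>d\<in>UNIV. sym\<Gamma> b c d x * sym\<Gamma> a d c x)) / (real CARD('n) - 1)"

definition \<gamma>0 :: "real^('n + 'n) \<Rightarrow> real \<Rightarrow> real^('n + 'n)^('n + 'n)" where
  "\<gamma>0 y \<rho> = (\<chi> I J. pw_matrix (\<Gamma> (inl_part y)) (\<lambda>a. y $ Inr a) I J +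
     (case (I, J) of (Inl a, Inl b) \<Rightarrow> \<rho> * Schouten a b (inl_part y) | _ \<Rightarrow> 0))"

lemma sym\<Gamma>_commute: "sym\<Gamma> a k b = sym\<Gamma> b k a"
  by (simp add: sym\<Gamma>_def fun_eq_iff)

lemma Schouten_commute: "Schouten a b x = Schouten b a x"
proof -
  have "(\<Sum>c\<in>UNIV. \<Sum>d\<in>UNIV. sym\<Gamma> b c d x * sym\<Gamma> a d c x) =
      (\<Sum>c\<in>UNIV. \<Sum>d\<in>UNIV. sym\<Gamma> a c d x * sym\<Gamma> b d c x)"
    by (subst sum.swap) (simp add: mult.commute)
  then show ?thesis
    by (simp add: Schouten_def sym\<Gamma>_commute[of a _ b])
qed

lemma smooth_sym\<Gamma>: "smooth_on X (sym\<Gamma> a k b)"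
  unfolding sym\<Gamma>_def
  by (intro smooth_on_divide smooth_on_add smooth_on_const smooth_\<Gamma> open_X) auto

lemma smooth_Schouten: "smooth_on X (Schouten a b)"
  unfolding Schouten_def
  by (intro smooth_on_divide smooth_on_add smooth_on_diff smooth_on_mult smooth_on_sum
      smooth_on_partial smooth_on_const smooth_sym\<Gamma> open_X) (use card_n in simp)

lemma \<gamma>0_entries:
  "\<gamma>0 y \<rho> $ Inl a $ Inl b =
    \<rho> * Schouten a b (inl_part y) - 2 * (\<Sum>k\<in>UNIV. sym\<Gamma> a k b (inl_part y) * y $ Inr k)"
  "\<gamma>0 y \<rho> $ Inl a $ Inr b = (if a = b then 1 else 0)"
  "\<gamma>0 y \<rho> $ Inr a $ Inl b = (if a = b then 1 else 0)"
  "\<gamma>0 y \<rho> $ Inr a $ Inr b = 0"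
  by (simp_all add: \<gamma>0_def pw_matrix_def sym\<Gamma>_def sum_distrib_left)

text \<open>A block matrix ((M, 1), (1, 0)) has the inverse ((0, 1), (1, -M)). Its zero block, which
  pairs dx with dx, is the source of the later cancellations.\<close>

definition \<gamma>0_inv :: "real^('n + 'n) \<Rightarrow> real \<Rightarrow> real^('n + 'n)^('n + 'n)" where
  "\<gamma>0_inv y \<rho> = (\<chi> I J. case (I, J) of
      (Inl a, Inl b) \<Rightarrow> 0
    | (Inl a, Inr b) \<Rightarrow> (if a = b then 1 else 0)
    | (Inr a, Inl b) \<Rightarrow> (if a = b then 1 else 0)
    | (Inr a, Inr b) \<Rightarrow> - \<gamma>0 y \<rho> $ Inl a $ Inl b)"

lemma \<gamma>0_inv_entries:
  "\<gamma>0_inv y \<rho> $ Inl a $ Inl b = 0"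
  "\<gamma>0_inv y \<rho> $ Inl a $ Inr b = (if a = b then 1 else 0)"
  "\<gamma>0_inv y \<rho> $ Inr a $ Inl b = (if a = b then 1 else 0)"
  "\<gamma>0_inv y \<rho> $ Inr a $ Inr b = - \<gamma>0 y \<rho> $ Inl a $ Inl b"
  by (simp_all add: \<gamma>0_inv_def)

lemma \<gamma>0_inverse: "\<gamma>0 y \<rho> ** \<gamma>0_inv y \<rho> = mat 1"
proof -
  have "(\<Sum>L\<in>UNIV. \<gamma>0 y \<rho> $ I $ L * \<gamma>0_inv y \<rho> $ L $ J) = (if I = J then 1 else 0)" for I J
    by (cases I; cases J)
      (simp_all add: sum_UNIV_Plus \<gamma>0_entries(2-4) \<gamma>0_inv_entries mult_delta_left mult_delta_right
        sum_negf)
  then show ?thesis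
    by (simp add: matrix_matrix_mult_def mat_def vec_eq_iff)
qed

end

sublocale patterson_walker \<subseteq> ambient \<gamma>0 W
proof
  show "open W" by (rule open_pw_W)
  have smooth_inl: "smooth_on W (\<lambda>(y, \<rho>). f (inl_part y))" if "smooth_on X f" for f :: "real^'n \<Rightarrow> real"
  proof -
    have "bounded_linear (\<lambda>z. inl_part (fst z))"
      by (rule bounded_linear_compose[OF bounded_linear_inl_part bounded_linear_fst])
    then have "smooth_on W (\<lambda>z. f (inl_part (fst z)))"
      using W_X by (intro smooth_on_compose[OF open_pw_W open_X _ smooth_on_linear_map that]
          open_pw_W) auto
    then show ?thesis by (simp add: case_prod_beta')
  qed
  have "smooth_on W (\<lambda>z. (\<lambda>(y, \<rho>). \<gamma>0 y \<rho>) z $ I $ J)" for I J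
  proof (cases I; cases J)
    fix a b assume [simp]: "I = Inl a" "J = Inl b"
    have "bounded_linear (\<lambda>z :: (real^('n + 'n)) \<times> real. fst z $ Inr k)" for k
      by (rule bounded_linear_compose[OF bounded_linear_vec_nth bounded_linear_fst])
    then have "smooth_on W (\<lambda>z. snd z * (\<lambda>(y, \<rho>). Schouten a b (inl_part y)) z -
        2 * (\<Sum>k\<in>UNIV. (\<lambda>(y, \<rho>). sym\<Gamma> a k b (inl_part y)) z * fst z $ Inr k))"
      by (intro smooth_on_diff smooth_on_mult smooth_on_sum smooth_on_const smooth_inl open_pw_W
          smooth_on_linear_map smooth_sym\<Gamma> smooth_Schouten bounded_linear_snd)
    then show ?thesis
      by (simp add: case_prod_beta' \<gamma>0_entries)
  qed (auto simp: case_prod_beta' \<gamma>0_entries intro: smooth_on_const)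
  then show "smooth_on W (\<lambda>(y, \<rho>). \<gamma>0 y \<rho>)"
    by (intro smooth_on_vec open_pw_W)
  show "transpose (\<gamma>0 y \<rho>) = \<gamma>0 y \<rho>" for y \<rho>
  proof -
    have "\<gamma>0 y \<rho> $ J $ I = \<gamma>0 y \<rho> $ I $ J" for I J
    proof (cases I; cases J)
      fix a b assume "I = Inl a" "J = Inl b"
      then show ?thesis
        by (simp add: \<gamma>0_entries Schouten_commute[of a b] sym\<Gamma>_commute[of a _ b])
    qed (auto simp: \<gamma>0_entries)
    then show ?thesis by (simp add: transpose_def vec_eq_iff)
  qed
  show "invertible (\<gamma>0 y \<rho>)" for y \<rho>
    by (rule matrix_inv_unique(1)[OF \<gamma>0_inverse])
qed

section \<open>Curvature of the explicit ambient metric\<close>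

context patterson_walker
begin

definition g :: "'n \<Rightarrow> 'n \<Rightarrow> 'n \<Rightarrow> real^('n + 'n) ambient_index \<Rightarrow> real" where
  "g a k b P = sym\<Gamma> a k b (inl_part (base_point P))"

definition s :: "'n \<Rightarrow> 'n \<Rightarrow> real^('n + 'n) ambient_index \<Rightarrow> real" where
  "s a b P = Schouten a b (inl_part (base_point P))"

abbreviation M where "M a b \<equiv> h (Inl a) (Inl b)"

lemma g_commute: "g a k b = g b k a"
  unfolding fun_eq_iff g_def sym\<Gamma>_commute[of a k b] by simp

lemma dom_X: "P \<in> \<Omega> \<Longrightarrow> inl_part (base_point P) \<in> X"
  using W_X by (auto simp: ambient_domain_def)

lemma bounded_linear_inl_base: "bounded_linear (\<lambda>P. inl_part (base_point P))"
  by (rule bounded_linear_compose[OF bounded_linear_inl_part bounded_linear_base_point])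

lemma smooth_pullback:
  assumes "smooth_on X f"
  shows "smooth_on \<Omega> (\<lambda>P. f (inl_part (base_point P)))"
  by (rule smooth_on_compose[OF open_dom open_X _
        smooth_on_linear_map[OF open_dom bounded_linear_inl_base] assms])
    (auto intro: dom_X)

lemma partial_pullback:
  fixes f :: "real^'n \<Rightarrow> real"
  assumes "smooth_on X f" "P \<in> \<Omega>"
  shows "partial (MDir (Inl a)) (\<lambda>P. f (inl_part (base_point P))) P =
      partial a f (inl_part (base_point P))"
    "partial (MDir (Inr a)) (\<lambda>P. f (inl_part (base_point P))) P = 0"
    "partial RhoDir (\<lambda>P. f (inl_part (base_point P))) P = 0"
proof -
  have "((\<lambda>P. f (inl_part (base_point P))) has_derivative
      (\<lambda>v. frechet_derivative f (at (inl_part (base_point P))) (inl_part (base_point v)))) (at P)"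
    using diff_chain_at[OF bounded_linear_imp_has_derivative[OF bounded_linear_inl_base]
        smooth_on_has_derivative[OF assms(1) dom_X[OF assms(2)]]]
    by (simp add: o_def)
  from frechet_derivative_eq[OF this]
  show "partial (MDir (Inl a)) (\<lambda>P. f (inl_part (base_point P))) P =
      partial a f (inl_part (base_point P))"
    by (simp add: inl_part_axis)
  show "partial (MDir (Inr a)) (\<lambda>P. f (inl_part (base_point P))) P = 0"
    by (rule partial_eq_0_invariant[OF smooth_pullback[OF assms(1)] assms(2)])
      (simp only: inl_part_add_axis)
  show "partial RhoDir (\<lambda>P. f (inl_part (base_point P))) P = 0"
    by (rule partial_eq_0_invariant[OF smooth_pullback[OF assms(1)] assms(2)])
      (simp only: inl_part_add_axis)
qed

lemma smooth_g: "smooth_on \<Omega> (g a k b)"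
  unfolding g_def by (rule smooth_pullback[OF smooth_sym\<Gamma>])

lemma smooth_s: "smooth_on \<Omega> (s a b)"
  unfolding s_def by (rule smooth_pullback[OF smooth_Schouten])

lemma partial_g:
  assumes "P \<in> \<Omega>"
  shows "partial (MDir (Inl c)) (g a k b) P = partial c (sym\<Gamma> a k b) (inl_part (base_point P))"
    "partial (MDir (Inr c)) (g a k b) P = 0" "partial RhoDir (g a k b) P = 0"
  unfolding g_def using partial_pullback[OF smooth_sym\<Gamma> assms] by simp_all

lemma partial_s:
  assumes "P \<in> \<Omega>"
  shows "partial (MDir (Inr c)) (s a b) P = 0" "partial RhoDir (s a b) P = 0"
  unfolding s_def using partial_pullback[OF smooth_Schouten assms] by simp_all

lemma h_entries:
  "M a b = (\<lambda>P. P $ RhoDir * s a b P - 2 * (\<Sum>k\<in>UNIV. g a k b P * P $ MDir (Inr k)))"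
  "h (Inl a) (Inr b) = (\<lambda>_. if a = b then 1 else 0)"
  "h (Inr a) (Inl b) = (\<lambda>_. if a = b then 1 else 0)"
  "h (Inr a) (Inr b) = (\<lambda>_. 0)"
  by (simp_all add: fun_eq_iff h_def \<gamma>0_entries s_def g_def) (simp add: base_point_def)

lemma hi_entries:
  "hi (Inl a) (Inl b) P = 0"
  "hi (Inl a) (Inr b) P = (if a = b then 1 else 0)"
  "hi (Inr a) (Inl b) P = (if a = b then 1 else 0)"
  "hi (Inr a) (Inr b) P = - M a b P"
  unfolding hi_def matrix_inv_unique(2)[OF \<gamma>0_inverse] by (simp_all add: h_def \<gamma>0_inv_entries)

text \<open>The block M is affine in the fibre coordinates, and its \<rho>-term depends on the base
  point alone.\<close>

lemma partial_M_Inr: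
  assumes "P \<in> \<Omega>"
  shows "partial (MDir (Inr c)) (M a b) P = - 2 * g a c b P"
proof -
  note sm = smooth_on_coord[OF open_dom] smooth_g smooth_s
  have gp: "partial (MDir (Inr c)) (\<lambda>P. g a k b P * P $ MDir (Inr k)) P =
      (if k = c then g a k b P else 0)" for k
    by (subst partial_mult[OF sm(2,1) assms]) (simp add: partial_g[OF assms] partial_coord)
  have sg: "smooth_on \<Omega> (\<lambda>P. g a k b P * P $ MDir (Inr k))" for k
    by (intro smooth_on_mult sm open_dom)
  have "partial (MDir (Inr c)) (M a b) P =
      partial (MDir (Inr c)) (\<lambda>P. P $ RhoDir * s a b P) P -
      partial (MDir (Inr c)) (\<lambda>P. 2 * (\<Sum>k\<in>UNIV. g a k b P * P $ MDir (Inr k))) P"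
    unfolding h_entries
    by (intro partial_diff[OF _ _ assms] smooth_on_mult smooth_on_const smooth_on_sum sg sm open_dom)
  also have "partial (MDir (Inr c)) (\<lambda>P. P $ RhoDir * s a b P) P = 0"
    by (subst partial_mult[OF sm(1,3) assms]) (simp add: partial_s[OF assms] partial_coord)
  also have "partial (MDir (Inr c)) (\<lambda>P. 2 * (\<Sum>k\<in>UNIV. g a k b P * P $ MDir (Inr k))) P = 2 * g a c b P"
    by (subst partial_cmult[OF smooth_on_sum[OF open_dom sg] assms], subst partial_sum[OF sg assms])
      (simp add: gp)
  finally show ?thesis by simp
qed

lemma h'_entries:
  assumes "P \<in> \<Omega>"
  shows "h' (Inl a) (Inl b) P = s a b P"
    "h' (Inl a) (Inr b) P = 0" "h' (Inr a) (Inl b) P = 0" "h' (Inr a) (Inr b) P = 0"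
proof -
  note sm = smooth_on_coord[OF open_dom] smooth_g smooth_s
  have gp: "partial RhoDir (\<lambda>P. g a k b P * P $ MDir (Inr k)) P = 0" for k
    by (subst partial_mult[OF sm(2,1) assms]) (simp add: partial_g[OF assms] partial_coord)
  have sg: "smooth_on \<Omega> (\<lambda>P. g a k b P * P $ MDir (Inr k))" for k
    by (intro smooth_on_mult sm open_dom)
  have "partial RhoDir (M a b) P =
      partial RhoDir (\<lambda>P. P $ RhoDir * s a b P) P -
      partial RhoDir (\<lambda>P. 2 * (\<Sum>k\<in>UNIV. g a k b P * P $ MDir (Inr k))) P"
    unfolding h_entries
    by (intro partial_diff[OF _ _ assms] smooth_on_mult smooth_on_const smooth_on_sum sg sm open_dom)
  also have "partial RhoDir (\<lambda>P. P $ RhoDir * s a b P) P = s a b P"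
    by (subst partial_mult[OF sm(1,3) assms]) (simp add: partial_s[OF assms] partial_coord)
  also have "partial RhoDir (\<lambda>P. 2 * (\<Sum>k\<in>UNIV. g a k b P * P $ MDir (Inr k))) P = 0"
    by (subst partial_cmult[OF smooth_on_sum[OF open_dom sg] assms], subst partial_sum[OF sg assms])
      (simp add: gp)
  finally show "h' (Inl a) (Inl b) P = s a b P"
    unfolding h'_def by simp
qed (simp_all add: h'_def h_entries)

lemma partial_h_const:
  "partial I (h (Inl a) (Inr b)) P = 0" "partial I (h (Inr a) (Inl b)) P = 0"
  "partial I (h (Inr a) (Inr b)) P = 0"
  by (simp_all add: h_entries)

text \<open>The only nonzero entries lead from base to fibre directions. Hence \<open>A\<close> is
  nilpotent: its trace and its square vanish.\<close>

lemma A_entries: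
  assumes "P \<in> \<Omega>"
  shows "A (Inr c) (Inl a) P = s a c P / 2" "A (Inl c) j P = 0" "A k (Inr a) P = 0"
proof -
  show "A (Inr c) (Inl a) P = s a c P / 2"
    by (simp add: A_def sum_UNIV_Plus hi_entries h'_entries[OF assms] mult_delta_left mult_delta_right)
  have "h' j (Inr d) P = 0" for d
    by (cases j) (simp_all add: h'_entries[OF assms])
  then show "A (Inl c) j P = 0"
    by (simp add: A_def sum_UNIV_Plus hi_entries)
  have "h' (Inr a) l P = 0" for l
    by (cases l) (simp_all add: h'_entries[OF assms])
  then show "A k (Inr a) P = 0"
    by (simp add: A_def)
qed

lemma C_entries:
  assumes "P \<in> \<Omega>"
  shows "C (Inl c) (Inl a) (Inl b) P = g a c b P"
    "C (Inr c) (Inl a) (Inl b) P =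
      (partial (MDir (Inl a)) (M b c) P + partial (MDir (Inl b)) (M a c) P
       - partial (MDir (Inl c)) (M a b) P) / 2 - (\<Sum>d\<in>UNIV. M c d P * g a d b P)"
    "C (Inl c) (Inl a) (Inr b) P = 0" "C (Inl c) (Inr b) (Inl a) P = 0"
    "C (Inr c) (Inl a) (Inr b) P = - g a b c P" "C (Inr c) (Inr b) (Inl a) P = - g a b c P"
    "C k (Inr a) (Inr b) P = 0"
proof -
  note simps = C_def sum_UNIV_Plus hi_entries partial_h_const partial_M_Inr[OF assms]
  show "C (Inl c) (Inl a) (Inl b) P = g a c b P"
    "C (Inl c) (Inl a) (Inr b) P = 0" "C (Inl c) (Inr b) (Inl a) P = 0"
    "C (Inr c) (Inl a) (Inr b) P = - g a b c P" "C (Inr c) (Inr b) (Inl a) P = - g a b c P"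
    by (simp_all add: simps mult_delta_left mult_delta_right sum_negf)
  show "C k (Inr a) (Inr b) P = 0"
    by (simp add: simps)
  show "C (Inr c) (Inl a) (Inl b) P =
      (partial (MDir (Inl a)) (M b c) P + partial (MDir (Inl b)) (M a c) P
       - partial (MDir (Inl c)) (M a b) P) / 2 - (\<Sum>d\<in>UNIV. M c d P * g a d b P)"
    by (simp add: simps mult_delta_left mult_delta_right sum_negf sum_divide_distrib mult.assoc
        sum_distrib_left[symmetric] diff_divide_distrib)
qed

text \<open>Exchanging the derivatives avoids an explicit formula for the base derivatives of M; the
  fibre derivative is simple and contains neither p nor \<rho>.\<close>

lemma partial_partial_M:
  assumes "P \<in> \<Omega>"
  shows "partial (MDir (Inr d)) (\<lambda>P. partial (MDir (Inl c)) (M a b) P) P =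
    - 2 * partial c (sym\<Gamma> a d b) (inl_part (base_point P))"
proof -
  have "partial (MDir (Inr d)) (\<lambda>P. partial (MDir (Inl c)) (M a b) P) P =
      partial (MDir (Inl c)) (\<lambda>P. partial (MDir (Inr d)) (M a b) P) P"
    by (rule partial_commute[OF open_dom smooth_h assms])
  also have "\<dots> = partial (MDir (Inl c)) (\<lambda>P. - 2 * g a d b P) P"
    by (rule partial_cong[OF open_dom assms partial_M_Inr])
  also have "\<dots> = - 2 * partial (MDir (Inl c)) (g a d b) P"
    by (rule partial_cmult[OF smooth_g assms])
  finally show ?thesis
    by (simp only: partial_g[OF assms])
qed

lemma partial_C_entries:
  assumes "P \<in> \<Omega>"
  shows "partial I (C (Inl c) (Inl a) (Inl b)) P = partial I (g a c b) P"
    "partial (MDir (Inr e)) (C (Inr c) (Inl a) (Inl b)) P =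
      - partial a (sym\<Gamma> b e c) (inl_part (base_point P))
      - partial b (sym\<Gamma> a e c) (inl_part (base_point P))
      + partial c (sym\<Gamma> a e b) (inl_part (base_point P))
      + 2 * (\<Sum>d\<in>UNIV. g c e d P * g a d b P)"
    "partial I (C (Inl c) (Inl a) (Inr b)) P = 0" "partial I (C (Inl c) (Inr b) (Inl a)) P = 0"
    "partial I (C (Inr c) (Inl a) (Inr b)) P = - partial I (g a b c) P"
    "partial I (C (Inr c) (Inr b) (Inl a)) P = - partial I (g a b c) P"
    "partial I (C k (Inr a) (Inr b)) P = 0"
proof -
  have c: "partial I (C k i j) P = partial I f P" if "\<And>Q. Q \<in> \<Omega> \<Longrightarrow> C k i j Q = f Q" for I k i j f
    by (rule partial_cong[OF open_dom assms that])
  show "partial I (C (Inl c) (Inl a) (Inl b)) P = partial I (g a c b) P"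
    by (rule c[OF C_entries(1)])
  show "partial I (C (Inl c) (Inl a) (Inr b)) P = 0" "partial I (C (Inl c) (Inr b) (Inl a)) P = 0"
    "partial I (C k (Inr a) (Inr b)) P = 0"
    using c[OF C_entries(3)] c[OF C_entries(4)] c[OF C_entries(7)] by simp_all
  have "partial I (\<lambda>P. - g a b c P) P = - partial I (g a b c) P"
    by (rule partial_minus[OF smooth_g assms])
  then show "partial I (C (Inr c) (Inl a) (Inr b)) P = - partial I (g a b c) P"
    "partial I (C (Inr c) (Inr b) (Inl a)) P = - partial I (g a b c) P"
    using c[where I = I and k = "Inr c" and i = "Inl a" and j = "Inr b", OF C_entries(5)]
      c[where I = I and k = "Inr c" and i = "Inr b" and j = "Inl a", OF C_entries(6)] by simp_all
  let ?I = "MDir (Inr e)"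
  let ?d = "\<lambda>c a b P. partial (MDir (Inl c)) (M a b) P"
  have smd: "smooth_on \<Omega> (\<lambda>P. ?d c a b P)" for c a b
    by (intro smooth_on_partial smooth_h)
  have sMg: "smooth_on \<Omega> (\<lambda>P. M c d P * g a d b P)" for d
    by (intro smooth_on_mult smooth_h smooth_g open_dom)
  have "partial ?I (C (Inr c) (Inl a) (Inl b)) P =
      partial ?I (\<lambda>P. 1 / 2 * (?d a b c P + ?d b a c P - ?d c a b P) - (\<Sum>d\<in>UNIV. M c d P * g a d b P)) P"
    by (rule c) (simp add: C_entries)
  also have "\<dots> = partial ?I (\<lambda>P. 1 / 2 * (?d a b c P + ?d b a c P - ?d c a b P)) P -
      partial ?I (\<lambda>P. \<Sum>d\<in>UNIV. M c d P * g a d b P) P"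
    by (rule partial_diff[OF _ _ assms])
      (intro smooth_on_mult smooth_on_const smooth_on_diff smooth_on_add smooth_on_sum smd sMg open_dom)+
  also have "partial ?I (\<lambda>P. 1 / 2 * (?d a b c P + ?d b a c P - ?d c a b P)) P =
      1 / 2 * partial ?I (\<lambda>P. ?d a b c P + ?d b a c P - ?d c a b P) P"
    by (rule partial_cmult[OF _ assms]) (intro smooth_on_diff smooth_on_add smd open_dom)
  also have "partial ?I (\<lambda>P. ?d a b c P + ?d b a c P - ?d c a b P) P =
      partial ?I (\<lambda>P. ?d a b c P + ?d b a c P) P - partial ?I (\<lambda>P. ?d c a b P) P"
    by (rule partial_diff[OF smooth_on_add[OF open_dom smd smd] smd assms])
  also have "partial ?I (\<lambda>P. ?d a b c P + ?d b a c P) P =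
      partial ?I (\<lambda>P. ?d a b c P) P + partial ?I (\<lambda>P. ?d b a c P) P"
    by (rule partial_add[OF smd smd assms])
  also have "partial ?I (\<lambda>P. \<Sum>d\<in>UNIV. M c d P * g a d b P) P =
      (\<Sum>d\<in>UNIV. partial ?I (\<lambda>P. M c d P * g a d b P) P)"
    by (rule partial_sum[OF sMg assms])
  also have "\<dots> = (\<Sum>d\<in>UNIV. - 2 * g c e d P * g a d b P)"
    by (intro sum.cong refl)
      (simp add: partial_mult[OF smooth_h smooth_g assms] partial_M_Inr[OF assms] partial_g[OF assms])
  also have "\<dots> = - 2 * (\<Sum>d\<in>UNIV. g c e d P * g a d b P)"
    by (simp only: sum_distrib_left mult.assoc)
  finally show "partial ?I (C (Inr c) (Inl a) (Inl b)) P =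
      - partial a (sym\<Gamma> b e c) (inl_part (base_point P))
      - partial b (sym\<Gamma> a e c) (inl_part (base_point P))
      + partial c (sym\<Gamma> a e b) (inl_part (base_point P))
      + 2 * (\<Sum>d\<in>UNIV. g c e d P * g a d b P)"
    by (simp add: partial_partial_M[OF assms])
qed

text \<open>The determinant of ((M, 1), (1, 0)) is 1 or -1, so the volume density of the slices is
  constant in these coordinates. In the computation the base entries cancel against the fibre
  entries.\<close>

lemma trace_C:
  assumes "P \<in> \<Omega>"
  shows "(\<Sum>k\<in>UNIV. C k k l P) = 0" "(\<Sum>k\<in>UNIV. partial I (C k l k) P) = 0"
proof -
  show "(\<Sum>k\<in>UNIV. C k k l P) = 0"
  proof (cases l)
    case (Inl d)
    then show ?thesis
      by (simp add: sum_UNIV_Plus C_entries[OF assms] sum_negf g_commute[of _ _ d])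
  qed (simp add: sum_UNIV_Plus C_entries[OF assms])
  show "(\<Sum>k\<in>UNIV. partial I (C k l k) P) = 0"
    by (cases l) (simp_all add: sum_UNIV_Plus partial_C_entries[OF assms] sum_negf)
qed

text \<open>The slices have twice the symmetrized Ricci tensor of the connection, for every \<rho>:
  the entries of \<open>C\<close> containing M enter only through their fibre derivatives, to which
  the \<rho>-term does not contribute. The factor n - 1 matches m/2 - 1 in
  \<open>ricci_MM\<close>.\<close>

lemma RicC_eq:
  assumes "P \<in> \<Omega>"
  shows "RicC (Inl a) (Inl b) P = (real CARD('n) - 1) * s a b P"
    "RicC (Inl a) (Inr b) P = 0" "RicC (Inr a) (Inl b) P = 0" "RicC (Inr a) (Inr b) P = 0"
proof -
  note simps = RicC_def trace_C[OF assms] sum_UNIV_Plus partial_C_entries[OF assms]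
    C_entries[OF assms] partial_g[OF assms]
  show "RicC (Inl a) (Inr b) P = 0" "RicC (Inr a) (Inl b) P = 0" "RicC (Inr a) (Inr b) P = 0"
    by (simp_all add: simps)
  have "RicC (Inl a) (Inl b) P =
     2 * (\<Sum>c\<in>UNIV. partial c (sym\<Gamma> a c b) (inl_part (base_point P)))
     - (\<Sum>c\<in>UNIV. partial a (sym\<Gamma> b c c) (inl_part (base_point P)))
     - (\<Sum>c\<in>UNIV. partial b (sym\<Gamma> a c c) (inl_part (base_point P)))
     + 2 * (\<Sum>c\<in>UNIV. \<Sum>d\<in>UNIV. g c c d P * g a d b P)
     - 2 * (\<Sum>c\<in>UNIV. \<Sum>d\<in>UNIV. g b c d P * g a d c P)"
  proof -
    have "(\<Sum>c\<in>UNIV. \<Sum>d\<in>UNIV. g b d c P * g a c d P) = (\<Sum>c\<in>UNIV. \<Sum>d\<in>UNIV. g b c d P * g a d c P)"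
      by (rule sum.swap)
    then show ?thesis
      by (simp add: simps sum.distrib sum_subtractf sum_negf sum_distrib_left[symmetric])
  qed
  also have "\<dots> = (real CARD('n) - 1) * s a b P"
    using card_n by (simp add: s_def g_def Schouten_def)
  finally show "RicC (Inl a) (Inl b) P = (real CARD('n) - 1) * s a b P" .
qed

lemma trace_A:
  assumes "P \<in> \<Omega>"
  shows "(\<Sum>k\<in>UNIV. A k k P) = 0" "partial I (A k k) P = 0"
proof -
  have 0: "A k k Q = 0" if "Q \<in> \<Omega>" for k Q
    by (cases k) (simp_all add: A_entries[OF that])
  then show "(\<Sum>k\<in>UNIV. A k k P) = 0"
    using assms by simp
  have "partial I (A k k) P = partial I (\<lambda>_. 0) P"
    by (rule partial_cong[OF open_dom assms 0])
  then show "partial I (A k k) P = 0" by simp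
qed

text \<open>The nonzero entries point along the fibres but depend only on the base point.\<close>

lemma divergence_A:
  assumes "P \<in> \<Omega>"
  shows "(\<Sum>k\<in>UNIV. partial (MDir k) (A k i) P) = 0"
proof -
  have c: "partial I (A k i) P = partial I f P" if "\<And>Q. Q \<in> \<Omega> \<Longrightarrow> A k i Q = f Q" for I k f
    by (rule partial_cong[OF open_dom assms that])
  have "partial (MDir (Inl c)) (A (Inl c) i) P = 0" for c
    using c[OF A_entries(2)] by simp
  moreover have "partial (MDir (Inr c)) (A (Inr c) i) P = 0" for c
  proof (cases i)
    case (Inl a)
    have "partial (MDir (Inr c)) (A (Inr c) i) P = partial (MDir (Inr c)) (\<lambda>P. 1 / 2 * s a c P) P"
      by (rule c) (simp add: Inl A_entries)
    also have "\<dots> = 1 / 2 * partial (MDir (Inr c)) (s a c) P"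
      by (rule partial_cmult[OF smooth_s assms])
    finally show ?thesis
      by (simp add: partial_s[OF assms])
  next
    case (Inr a)
    then show ?thesis
      using c[of "Inr c" "\<lambda>_. 0" "MDir (Inr c)"] by (simp add: A_entries)
  qed
  ultimately show ?thesis
    by (simp add: sum_UNIV_Plus)
qed

lemma partial_h':
  assumes "P \<in> \<Omega>"
  shows "partial RhoDir (h' i j) P = 0"
proof -
  have c: "partial RhoDir (h' i j) P = partial RhoDir f P" if "\<And>Q. Q \<in> \<Omega> \<Longrightarrow> h' i j Q = f Q" for f
    by (rule partial_cong[OF open_dom assms that])
  show ?thesis
  proof (cases "\<exists>a b. i = Inl a \<and> j = Inl b")
    case True
    then obtain a b where "i = Inl a" "j = Inl b" by blast
    then show ?thesis
      using c[of "s a b"] by (simp add: h'_entries partial_s[OF assms])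
  next
    case False
    have "h' i j Q = 0" if "Q \<in> \<Omega>" for Q
      using False by (cases i; cases j) (simp_all add: h'_entries[OF that])
    then show ?thesis
      using c[of "\<lambda>_. 0"] by simp
  qed
qed

text \<open>In \<open>ricci_MM\<close> the slice curvature cancels -(m/2 - 1) \<open>h'\<close>.
  Linearity in \<rho> removes the second derivative, and the position of the zero entries of
  \<open>A\<close>, \<open>C\<close> and \<open>h'\<close> removes the products.\<close>

theorem ricci_flat:
  assumes "P \<in> \<Omega>"
  shows "ricci G I J P = 0"
proof -
  have Ah: "(\<Sum>k\<in>UNIV. A k i P * h' j k P + A k j P * h' i k P) = 0" for i j
  proof -
    have "A k i P * h' j k P = 0" for k i j
      by (cases k; cases i; cases j) (simp_all add: A_entries[OF assms] h'_entries[OF assms])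
    then show ?thesis unfolding sum.distrib by (simp only: sum.neutral_const add_0)
  qed
  have MM: "ricci G (MDir i) (MDir j) P = 0" for i j
    unfolding ricci_MM[OF assms] partial_h'[OF assms] trace_A[OF assms] Ah
    by (cases i; cases j) (simp_all add: RicC_eq[OF assms] h'_entries[OF assms])
  have AC: "A k l P * C l i k P = 0" "A k l P * A l k P = 0" "C k i l P * A l k P = 0" for k l i
    by (cases k; cases l; cases i; simp add: A_entries[OF assms] C_entries[OF assms])+
  have MR: "ricci G (MDir i) RhoDir P = 0" "ricci G RhoDir (MDir i) P = 0" for i
    unfolding ricci_MR[OF assms] ricci_RM[OF assms] divergence_A[OF assms] trace_C[OF assms]
      trace_A[OF assms] AC by simp_all
  have RR: "ricci G RhoDir RhoDir P = 0"
    unfolding ricci_RR[OF assms] trace_A[OF assms] AC by simp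
  show ?thesis
    using MM MR RR ricci_T[OF assms] by (cases I; cases J) simp_all
qed

end

section \<open>Existence of an ambient metric, and the value for an arbitrary one\<close>

lemma add_axis_RhoDir:
  assumes "P $ RhoDir = 0"
  shows "P + s *\<^sub>R axis RhoDir 1 = ambient_point (P $ TDir) (base_point P) s"
proof -
  have "(P + s *\<^sub>R axis RhoDir 1) $ I = ambient_point (P $ TDir) (base_point P) s $ I" for I
    using assms by (cases I) (simp_all add: ambient_point_def base_point_def axis_def)
  then show ?thesis by (simp add: vec_eq_iff)
qed

lemma ambient_point_simps [simp]:
  "ambient_point t x \<rho> $ TDir = t" "ambient_point t x \<rho> $ RhoDir = \<rho>"
  "base_point (ambient_point t x \<rho>) = x"
  by (simp_all add: ambient_point_def base_point_def)

lemma fg_ambient_pw: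
  fixes X :: "(real^'n::finite) set"
  assumes "open X" "\<And>a k b. smooth_on X (\<lambda>x. \<Gamma> x a k b)" "CARD('n) \<ge> 2"
    and V: "open V" "\<And>y. y \<in> V \<Longrightarrow> inl_part y \<in> X"
    and H: "\<And>y I J. y \<in> V \<Longrightarrow> H y $ I $ J = pw_matrix (\<Gamma> (inl_part y)) (\<lambda>a. y $ Inr a) I J"
  shows "fg_ambient V H (patterson_walker.\<gamma>0 \<Gamma>)"
proof -
  interpret patterson_walker X \<Gamma> "V \<times> UNIV"
    using assms by unfold_locales (auto intro: open_Times)
  have "\<gamma>0 x 0 = H x" if "x \<in> V" for x
    using H[OF that] by (simp add: vec_eq_iff \<gamma>0_def split: sum.split)
  moreover have "ricci (ambient_metric \<gamma>0) I J (ambient_point t x \<rho>) = 0" if "t > 0" "x \<in> V" for t x \<rho> I J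
    using that by (intro ricci_flat) (simp add: ambient_domain_def)
  moreover have "\<exists>W. open W \<and> V \<times> {0} \<subseteq> W \<and> W \<subseteq> V \<times> UNIV \<and>
      smooth_on W (\<lambda>(x, \<rho>). \<gamma>0 x \<rho>) \<and>
      (\<forall>(x, \<rho>)\<in>W. transpose (\<gamma>0 x \<rho>) = \<gamma>0 x \<rho> \<and> invertible (\<gamma>0 x \<rho>))"
    using open_W smooth_\<gamma> symmetric_\<gamma> invertible_\<gamma>
    by (intro exI[of _ "V \<times> UNIV"]) auto
  ultimately show ?thesis
    unfolding fg_ambient_def Let_def by simp
qed

lemma ambient_Q_pw:
  fixes X :: "(real^'n::finite) set"
  assumes "open X" "\<And>a k b. smooth_on X (\<lambda>x. \<Gamma> x a k b)" "CARD('n) \<ge> 2"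
    and V: "open V" "\<And>y. y \<in> V \<Longrightarrow> inl_part y \<in> X"
    and H: "\<And>y I J. y \<in> V \<Longrightarrow> H y $ I $ J = pw_matrix (\<Gamma> (inl_part y)) (\<lambda>a. y $ Inr a) I J"
    and fg: "fg_ambient V H \<gamma>" and "x \<in> V"
  shows "ambient_Q \<gamma> x = 0"
proof -
  let ?n = "CARD('n)"
  have card: "CARD('n + 'n) = 2 * ?n" by simp
  have div: "CARD('n + 'n) div 2 = ?n" unfolding card by simp
  note fg' = fg[unfolded fg_ambient_def Let_def div]
  obtain W where "open W \<and> V \<times> {0} \<subseteq> W \<and> W \<subseteq> V \<times> UNIV \<and>
      smooth_on W (\<lambda>(x, \<rho>). \<gamma> x \<rho>) \<and>
      (\<forall>(x, \<rho>)\<in>W. transpose (\<gamma> x \<rho>) = \<gamma> x \<rho> \<and> invertible (\<gamma> x \<rho>))"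
    using conjunct1[OF fg'] by (rule exE)
  then have W: "open W" "V \<times> {0} \<subseteq> W" "W \<subseteq> V \<times> UNIV" "smooth_on W (\<lambda>(x, \<rho>). \<gamma> x \<rho>)"
    "\<And>x \<rho>. (x, \<rho>) \<in> W \<Longrightarrow> transpose (\<gamma> x \<rho>) = \<gamma> x \<rho> \<and> invertible (\<gamma> x \<rho>)"
    by auto
  have \<gamma>H: "\<gamma> x 0 = H x" if "x \<in> V" for x
    using conjunct1[OF conjunct2[OF fg']] that by (rule bspec)
  note ric = conjunct2[OF conjunct2[OF fg'], rule_format]
  note R = conjunct1[OF ric, rule_format] and tr = conjunct2[OF ric]
  \<comment> \<open>The explicit metric is defined for all \<rho>; here it is restricted to the
    neighbourhood on which the given one is smooth and invertible.\<close>
  interpret B: patterson_walker X \<Gamma> W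
    using assms(1-3) V(2) W by unfold_locales auto
  interpret ambient_pair \<gamma> W "patterson_walker.\<gamma>0 \<Gamma>"
    using W by unfold_locales auto
  have dom: "P $ TDir > 0" "base_point P \<in> V" if "P \<in> \<Omega>" for P
    using that W(3) by (auto simp: ambient_domain_def)
  have "vanishes ?n \<Omega> RhoDir (\<lambda>P. \<Sum>k\<in>UNIV. A k k P)"
  proof (rule trace_vanishes_flat)
    show "h i j P = B.h i j P" if "P \<in> \<Omega>" "P $ RhoDir = 0" for i j P
    proof -
      have "B.\<gamma>0 (base_point P) 0 $ i $ j = H (base_point P) $ i $ j"
        using H[OF dom(2)[OF that(1)]] by (simp add: B.\<gamma>0_def split: sum.split)
      then show ?thesis
        using \<gamma>H[OF dom(2)[OF that(1)]] that(2) by (simp add: h_def B.h_def)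
    qed
    show "ricci (ambient_metric (patterson_walker.\<gamma>0 \<Gamma>)) (MDir i) (MDir j) P = 0" if "P \<in> \<Omega>" for i j P
      by (rule B.ricci_flat[OF that])
    show "(\<Sum>k\<in>UNIV. B.A k k P) = 0" if "P \<in> \<Omega>" for P
      by (rule B.trace_A[OF that])
    show "vanishes (?n - 1) \<Omega> RhoDir (ricci G (MDir i) (MDir j))" for i j
    proof (rule vanishes_bigo[OF open_dom smooth_ricci_G])
      fix P assume "P \<in> \<Omega>" "P $ RhoDir = 0"
      then show "(\<lambda>s. ricci G (MDir i) (MDir j) (P + s *\<^sub>R axis RhoDir 1)) \<in> O[at 0](\<lambda>s. s ^ (?n - 1))"
        using R[OF dom] by (simp add: add_axis_RhoDir)
    qed
    show "vanishes ?n \<Omega> RhoDir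
        (\<lambda>P. \<Sum>i\<in>UNIV. \<Sum>j\<in>UNIV. hi i j P * ricci G (MDir i) (MDir j) P)"
    proof (rule vanishes_bigo[OF open_dom])
      show "smooth_on \<Omega> (\<lambda>P. \<Sum>i\<in>UNIV. \<Sum>j\<in>UNIV. hi i j P * ricci G (MDir i) (MDir j) P)"
        by (intro smooth_on_sum smooth_on_mult smooth_hi smooth_ricci_G open_dom)
      fix P assume P: "P \<in> \<Omega>" "P $ RhoDir = 0"
      let ?P = "\<lambda>s. P + s *\<^sub>R axis RhoDir 1"
      let ?R = "\<lambda>i j s. ricci G (MDir i) (MDir j) (?P s)"
      have hi0: "hi i j P = matrix_inv (H (base_point P)) $ i $ j" for i j
        using \<gamma>H[OF dom(2)[OF P(1)]] P(2) by (simp add: hi_def)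
      have 1: "(\<lambda>s. \<Sum>i\<in>UNIV. \<Sum>j\<in>UNIV. hi i j P * ?R i j s) \<in> O[at 0](\<lambda>s. s ^ ?n)"
        using tr[OF dom[OF P(1)]] P(2) by (simp add: add_axis_RhoDir hi0)
      \<comment> \<open>\<open>fg_ambient\<close> takes the trace with the inverse metric at \<rho>
        = 0, the uniqueness argument with the one at \<rho>. The error is O(\<rho>) times a Ricci
        component of order \<open>?n - 1\<close>, which is within the required order.\<close>
      have "(\<lambda>s. (hi i j (?P s) - hi i j P) * ?R i j s) \<in> O[at 0](\<lambda>s. s * s ^ (?n - 1))" for i j
        using R[OF dom[OF P(1)]] P(2)
        by (intro landau_o.big.mult bigo_line_diff[OF smooth_hi P(1)]) (simp add: add_axis_RhoDir)
      moreover have "s * s ^ (?n - 1) = s ^ ?n" for s :: real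
        using assms(3) by (cases ?n) auto
      ultimately have "(\<lambda>s. \<Sum>i\<in>UNIV. \<Sum>j\<in>UNIV. (hi i j (?P s) - hi i j P) * ?R i j s) \<in> O[at 0](\<lambda>s. s ^ ?n)"
        by (intro big_sum_in_bigo) simp
      from sum_in_bigo(1)[OF 1 this]
      show "(\<lambda>s. \<Sum>i\<in>UNIV. \<Sum>j\<in>UNIV. hi i j (?P s) * ?R i j s) \<in> O[at 0](\<lambda>s. s ^ ?n)"
        by (simp add: left_diff_distrib sum_subtractf)
    qed
    show "CARD('n + 'n) = 2 * ?n" by (rule card)
    show "?n \<ge> 1" using assms(3) by simp
  qed
  then show ?thesis
    using assms(3,8) W(2) by (intro ambient_Q_eq_0) (auto simp: div)
qed

section \<open>Charts\<close>

locale charts =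
  fixes A :: "('a, 'n::finite) atlas"
  assumes smooth_atlas: "smooth_atlas A"
begin

lemma chart_inv_chart: "c \<in> A \<Longrightarrow> z \<in> fst c \<Longrightarrow> chart_inv c (snd c z) = z"
  using smooth_atlas unfolding smooth_atlas_def by (auto intro: inv_into_f_f)

lemma transition_chart: "c \<in> A \<Longrightarrow> z \<in> fst c \<Longrightarrow> transition c d (snd c z) = snd d z"
  by (simp add: transition_def chart_inv_chart)

lemma open_chart_image: "c \<in> A \<Longrightarrow> d \<in> A \<Longrightarrow> open (chart_image c (fst d))"
  using smooth_atlas unfolding smooth_atlas_def by blast

lemma smooth_transition:
  "c \<in> A \<Longrightarrow> d \<in> A \<Longrightarrow> smooth_on (chart_image c (fst d)) (transition c d)"
  using smooth_atlas unfolding smooth_atlas_def by blast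

lemma transition_has_derivative:
  assumes "c \<in> A" "d \<in> A" "z \<in> fst c" "z \<in> fst d"
  shows "(transition c d has_derivative frechet_derivative (transition c d) (at (snd c z))) (at (snd c z))"
  using assms by (intro smooth_on_has_derivative[OF smooth_transition]) auto

lemma frechet_derivative_transition_self:
  assumes "c \<in> A" "z \<in> fst c"
  shows "frechet_derivative (transition c c) (at (snd c z)) = (\<lambda>v. v)"
proof -
  have "frechet_derivative (transition c c) (at (snd c z)) = frechet_derivative (\<lambda>v. v) (at (snd c z))"
    by (rule frechet_derivative_cong_open[OF open_chart_image[OF assms(1) assms(1)]])
      (use assms in \<open>auto simp: transition_chart\<close>)
  then show ?thesis by simp
qed

text \<open>The cocycle identity of the Jacobians, which makes coordinate vectors compatible
  families in the sense of \<open>tangent_space\<close>.\<close>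

lemma frechet_derivative_transition_trans:
  assumes "c \<in> A" "d \<in> A" "e \<in> A" "z \<in> fst c" "z \<in> fst d" "z \<in> fst e"
  shows "frechet_derivative (transition c e) (at (snd c z)) v =
    frechet_derivative (transition d e) (at (snd d z)) (frechet_derivative (transition c d) (at (snd c z)) v)"
proof -
  let ?S = "chart_image c (fst d) \<inter> chart_image c (fst e)"
  have "transition c e y = transition d e (transition c d y)" if "y \<in> ?S" for y
  proof -
    from that obtain p q where p: "p \<in> fst d" "p \<in> fst c" "y = snd c p"
      and q: "q \<in> fst e" "q \<in> fst c" "y = snd c q" by auto
    have "p = q"
      using chart_inv_chart[OF assms(1) p(2)] chart_inv_chart[OF assms(1) q(2)] p(3) q(3) by simp
    then show ?thesis
      using p q assms by (simp add: transition_chart)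
  qed
  then have "frechet_derivative (transition c e) (at (snd c z)) =
      frechet_derivative (\<lambda>y. transition d e (transition c d y)) (at (snd c z))"
    by (intro frechet_derivative_cong_open[of ?S] open_Int open_chart_image assms) (use assms in auto)
  also have "(transition d e \<circ> transition c d has_derivative
      frechet_derivative (transition d e) (at (snd d z)) \<circ> frechet_derivative (transition c d) (at (snd c z)))
      (at (snd c z))"
    using diff_chain_at[OF transition_has_derivative[OF assms(1,2,4,5)]]
      transition_has_derivative[OF assms(2,3,5,6)] transition_chart[OF assms(1,4)] by simp
  from frechet_derivative_eq[OF this]
  have "frechet_derivative (\<lambda>y. transition d e (transition c d y)) (at (snd c z)) =
      (\<lambda>v. frechet_derivative (transition d e) (at (snd d z))
        (frechet_derivative (transition c d) (at (snd c z)) v))"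
    by (simp only: o_def)
  finally show ?thesis by simp
qed

lemma coord_vec_self: "c \<in> A \<Longrightarrow> z \<in> fst c \<Longrightarrow> coord_vec A c i z c = axis i 1"
  by (simp add: coord_vec_def frechet_derivative_transition_self)

lemma coord_vec_tangent:
  assumes "c \<in> A" "z \<in> fst c"
  shows "coord_vec A c i z \<in> tangent_space A z"
  unfolding tangent_space_def
proof (rule CollectI, intro conjI ballI allI impI)
  fix d e assume "d \<in> A" "e \<in> A" "z \<in> fst d" "z \<in> fst e"
  then show "coord_vec A c i z e =
      frechet_derivative (transition d e) (at (snd d z)) (coord_vec A c i z d)"
    using frechet_derivative_transition_trans[OF assms(1) \<open>d \<in> A\<close> \<open>e \<in> A\<close> assms(2), of "axis i 1"]
    by (simp add: coord_vec_def)
qed (auto simp: coord_vec_def)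

lemma coord_vec_field:
  assumes "c \<in> A"
  shows "coord_vec A c i \<in> vector_fields A (fst c)"
proof -
  have "smooth_on (chart_image d (fst c)) (\<lambda>y. coord_vec A c i (chart_inv d y) d)" if d: "d \<in> A" for d
  proof -
    \<comment> \<open>In the chart d the components form a column of the Jacobian of the transition
      from c, evaluated after moving the point back to c.\<close>
    let ?F = "\<lambda>x. frechet_derivative (transition c d) (at x) (axis i 1)"
    have "smooth_on (chart_image d (fst c)) (\<lambda>y. ?F (transition d c y))"
      by (rule smooth_on_compose[OF open_chart_image[OF d assms] open_chart_image[OF assms d] _
            smooth_transition[OF d assms] smooth_on_frechet_derivative[OF smooth_transition[OF assms d]]])
        (use d in \<open>auto simp: transition_chart\<close>)
    then show ?thesis
      by (subst smooth_on_cong[OF open_chart_image[OF d assms], where g = "\<lambda>y. ?F (transition d c y)"])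
        (use d in \<open>auto simp: transition_chart chart_inv_chart coord_vec_def\<close>)
  qed
  then show ?thesis
    unfolding vector_fields_def using coord_vec_tangent[OF assms] by blast
qed

lemma openin_chart_domain: "c \<in> A \<Longrightarrow> openin (atlas_topology A) (fst c)"
  using open_chart_image
  by (auto simp: openin_atlas_topology[OF smooth_atlas] atlas_open_def carrier_of_def)

lemma smooth_christoffel:
  assumes "affine_connection A D" "c \<in> A"
  shows "smooth_on (snd c ` fst c) (\<lambda>x. christoffel_symbol A D c (chart_inv c x) a k b)"
proof -
  have "D (coord_vec A c a) (coord_vec A c b) \<in> vector_fields A (fst c)"
    using assms openin_chart_domain coord_vec_field unfolding affine_connection_def by blast
  then have "smooth_on (chart_image c (fst c)) (\<lambda>y. D (coord_vec A c a) (coord_vec A c b) (chart_inv c y) c)"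
    using assms(2) unfolding vector_fields_def by blast
  then show ?thesis
    using open_chart_image[OF assms(2) assms(2)] unfolding christoffel_symbol_def
    by (intro smooth_on_vec_nth) simp_all
qed

section \<open>The cotangent bundle in induced charts\<close>

text \<open>Covectors take arbitrary values on the coordinate vectors, so the fibre coordinates are
  unrestricted. The explicit ambient metric can therefore be used over the whole chart image, which
  is open.\<close>

lemma cotangent_chart_image:
  assumes "c \<in> A"
  shows "snd (cotangent_chart A c) ` fst (cotangent_chart A c) = {y. inl_part y \<in> snd c ` fst c}"
proof (intro equalityI subsetI)
  fix y assume "y \<in> snd (cotangent_chart A c) ` fst (cotangent_chart A c)"
  then obtain z \<alpha> where "z \<in> fst c" "y = snd (cotangent_chart A c) (z, \<alpha>)"
    by (auto simp: cotangent_chart_def)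
  then show "y \<in> {y. inl_part y \<in> snd c ` fst c}"
    by (auto simp: cotangent_chart_def inl_part_def vec_eq_iff intro!: image_eqI[of _ _ z])
next
  fix y :: "real^('n + 'n)" assume "y \<in> {y. inl_part y \<in> snd c ` fst c}"
  then obtain z where z: "z \<in> fst c" "inl_part y = snd c z" by auto
  \<comment> \<open>The covector with prescribed fibre coordinates, read off from the components in
    the chart c. The value 0 off the tangent space is what \<open>cotangent_space\<close>
    demands.\<close>
  define \<alpha> where "\<alpha> u = (if u \<in> tangent_space A z then \<Sum>a\<in>UNIV. y $ Inr a * u c $ a else 0)" for u
  let ?F = "\<lambda>d e. frechet_derivative (transition d e) (at (snd d z))"
  have lin: "linear (?F d e)" if "d \<in> A" "e \<in> A" "z \<in> fst d" "z \<in> fst e" for d e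
    by (rule has_derivative_linear[OF transition_has_derivative[OF that]])
  have tangentI: "u \<in> tangent_space A z"
    if "\<And>d e. d \<in> A \<Longrightarrow> e \<in> A \<Longrightarrow> z \<in> fst d \<Longrightarrow> z \<in> fst e \<Longrightarrow> u e = ?F d e (u d)"
      "\<And>d. \<not> (d \<in> A \<and> z \<in> fst d) \<Longrightarrow> u d = 0" for u
    using that unfolding tangent_space_def by blast
  have tangentD: "u e = ?F d e (u d)"
    if "u \<in> tangent_space A z" "d \<in> A" "e \<in> A" "z \<in> fst d" "z \<in> fst e" for u d e
    using that unfolding tangent_space_def by blast
  have tangent0: "u d = 0" if "u \<in> tangent_space A z" "\<not> (d \<in> A \<and> z \<in> fst d)" for u d
    using that unfolding tangent_space_def by blast
  have add: "tadd u v \<in> tangent_space A z" if "u \<in> tangent_space A z" "v \<in> tangent_space A z" for u v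
  proof (rule tangentI)
    fix d e assume de: "d \<in> A" "e \<in> A" "z \<in> fst d" "z \<in> fst e"
    show "u e + v e = ?F d e (u d + v d)"
      unfolding linear_add[OF lin[OF de]]
      by (rule arg_cong2[OF tangentD[OF that(1) de] tangentD[OF that(2) de]])
  qed (simp add: tangent0[OF that(1)] tangent0[OF that(2)])
  have scale: "tscale r u \<in> tangent_space A z" if "u \<in> tangent_space A z" for r u
  proof (rule tangentI)
    fix d e assume de: "d \<in> A" "e \<in> A" "z \<in> fst d" "z \<in> fst e"
    show "r *\<^sub>R u e = ?F d e (r *\<^sub>R u d)"
      unfolding linear_cmul[OF lin[OF de]] by (rule arg_cong[OF tangentD[OF that de]])
  qed (simp add: tangent0[OF that])
  have "\<alpha> \<in> cotangent_space A z"
    unfolding cotangent_space_def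
    by (auto simp: \<alpha>_def add scale distrib_left sum.distrib sum_distrib_left mult_ac)
  then have "(z, \<alpha>) \<in> fst (cotangent_chart A c)"
    using z by (simp add: cotangent_chart_def)
  moreover have "\<alpha> (coord_vec A c a z) = y $ Inr a" for a
    by (simp add: \<alpha>_def coord_vec_tangent[OF assms z(1)] coord_vec_self[OF assms z(1)] axis_def
        mult_delta_right)
  moreover have "snd c z $ a = y $ Inl a" for a
    by (simp add: z(2)[symmetric] inl_part_def)
  ultimately have "snd (cotangent_chart A c) (z, \<alpha>) = y"
    by (simp add: cotangent_chart_def vec_eq_iff split: sum.split)
  from image_eqI[where f = "snd (cotangent_chart A c)", OF this[symmetric] \<open>(z, \<alpha>) \<in> fst (cotangent_chart A c)\<close>]
  show "y \<in> snd (cotangent_chart A c) ` fst (cotangent_chart A c)" .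
qed

lemma pw_components:
  assumes "patterson_walker_metric A D g" "c \<in> A"
    and "y \<in> snd (cotangent_chart A c) ` fst (cotangent_chart A c)"
  shows "metric_components (cotangent_bundle A) g (cotangent_chart A c) y $ I $ J =
    pw_matrix (christoffel_symbol A D c (chart_inv c (inl_part y))) (\<lambda>a. y $ Inr a) I J"
proof -
  let ?C = "cotangent_chart A c"
  obtain z \<alpha> where w: "chart_inv ?C y = (z, \<alpha>)" by (rule prod.exhaust)
  have C: "(z, \<alpha>) \<in> fst ?C"
    using inv_into_into[OF assms(3)] w by simp
  have "y = snd ?C (z, \<alpha>)"
    using f_inv_into_f[OF assms(3)] w by simp
  then have y: "inl_part y = snd c z" "y $ Inr a = \<alpha> (coord_vec A c a z)" for a
    by (simp_all add: cotangent_chart_def inl_part_def vec_eq_iff)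
  have z: "chart_inv c (inl_part y) = z"
    using chart_inv_chart[OF assms(2)] C y(1) by (simp add: cotangent_chart_def)
  have "\<forall>(z, \<alpha>)\<in>fst ?C. \<forall>I J.
      g (z, \<alpha>) (coord_vec (cotangent_bundle A) ?C I (z, \<alpha>)) (coord_vec (cotangent_bundle A) ?C J (z, \<alpha>)) =
        pw_matrix (christoffel_symbol A D c z) (\<lambda>a. \<alpha> (coord_vec A c a z)) I J"
    by (rule bspec[OF conjunct2[OF assms(1)[unfolded patterson_walker_metric_def]] assms(2)])
  from bspec[OF this C] show ?thesis
    by (simp add: metric_components_def w y(2) z)
qed

end

theorem theorem3:
  fixes N :: "('a, 'n::finite) atlas"
    and D :: "('a, 'n) vfield \<Rightarrow> ('a, 'n) vfield \<Rightarrow> ('a, 'n) vfield"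
    and \<mu> :: "'a \<Rightarrow> ('n \<Rightarrow> ('a, 'n) tvec) \<Rightarrow> real"
    and g :: "('a \<times> (('a, 'n) tvec \<Rightarrow> real), 'n + 'n) metric"
  assumes "smooth_manifold N"
    and "CARD('n) \<ge> 2"
    and "affine_connection N D"
    and "torsion_free N D"
    and "volume_form N \<mu>"
    and "preserves_volume N D \<mu>"
    and "patterson_walker_metric N D g"
  shows "\<forall>w\<in>carrier_of (cotangent_bundle N). Q_curvature (cotangent_bundle N) g w = 0"
proof
  fix w assume w: "w \<in> carrier_of (cotangent_bundle N)"
  interpret charts N
    using assms(1) by unfold_locales (simp add: smooth_manifold_def)
  let ?B = "cotangent_bundle N"
  let ?\<Gamma> = "\<lambda>c x. christoffel_symbol N D c (chart_inv c x)"
  have X: "open (snd c ` fst c)" if "c \<in> N" for c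
    using open_chart_image[OF that that] by simp
  \<comment> \<open>The uniqueness half of \<open>Q_curvature\<close>: every chart, neighbourhood
    and ambient metric gives the value 0.\<close>
  have Q0: "ambient_Q \<gamma> (snd (cotangent_chart N c) w) = 0"
    if "c \<in> N" "open V" "snd (cotangent_chart N c) w \<in> V"
      "V \<subseteq> snd (cotangent_chart N c) ` fst (cotangent_chart N c)"
      "fg_ambient V (metric_components ?B g (cotangent_chart N c)) \<gamma>" for c V \<gamma>
  proof (rule ambient_Q_pw[OF X[OF that(1)] _ assms(2) that(2) _ _ that(5,3)])
    show "smooth_on (snd c ` fst c) (\<lambda>x. ?\<Gamma> c x a k b)" for a k b
      by (rule smooth_christoffel[OF assms(3) that(1)])
    show "inl_part y \<in> snd c ` fst c" if "y \<in> V" for y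
      using subsetD[OF \<open>V \<subseteq> _\<close> that] unfolding cotangent_chart_image[OF \<open>c \<in> N\<close>] by simp
    show "metric_components ?B g (cotangent_chart N c) y $ I $ J =
        pw_matrix (?\<Gamma> c (inl_part y)) (\<lambda>a. y $ Inr a) I J" if "y \<in> V" for y I J
      by (rule pw_components[OF assms(7) \<open>c \<in> N\<close> subsetD[OF \<open>V \<subseteq> _\<close> that]])
  qed
  obtain c where c: "c \<in> N" "w \<in> fst (cotangent_chart N c)"
    using w by (auto simp: carrier_of_def cotangent_bundle_def)
  let ?V = "snd (cotangent_chart N c) ` fst (cotangent_chart N c)"
  let ?\<gamma> = "patterson_walker.\<gamma>0 (?\<Gamma> c)"
  have V: "open ?V"
    unfolding cotangent_chart_image[OF c(1)]
    using open_vimage[OF X[OF c(1)] linear_continuous_on[OF bounded_linear_inl_part]]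
    by (simp add: vimage_def)
  \<comment> \<open>The existence half: one admissible ambient metric, so that the definite
    description in \<open>Q_curvature\<close> denotes 0.\<close>
  have fg: "fg_ambient ?V (metric_components ?B g (cotangent_chart N c)) ?\<gamma>"
  proof (rule fg_ambient_pw[OF X[OF c(1)] _ assms(2) V])
    show "smooth_on (snd c ` fst c) (\<lambda>x. ?\<Gamma> c x a k b)" for a k b
      by (rule smooth_christoffel[OF assms(3) c(1)])
    show "inl_part y \<in> snd c ` fst c" if "y \<in> ?V" for y
      using that unfolding cotangent_chart_image[OF c(1)] by simp
    show "metric_components ?B g (cotangent_chart N c) y $ I $ J =
        pw_matrix (?\<Gamma> c (inl_part y)) (\<lambda>a. y $ Inr a) I J" if "y \<in> ?V" for y I J
      by (rule pw_components[OF assms(7) c(1) that])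
  qed
  show "Q_curvature ?B g w = 0"
    unfolding Q_curvature_def
  proof (rule the_equality)
    show "\<exists>C\<in>?B. w \<in> fst C \<and> (\<exists>V \<gamma>. open V \<and> snd C w \<in> V \<and> V \<subseteq> snd C ` fst C \<and>
        fg_ambient V (metric_components ?B g C) \<gamma> \<and> 0 = ambient_Q \<gamma> (snd C w))"
    proof (rule bexI[of _ "cotangent_chart N c"], intro conjI exI)
      show "w \<in> fst (cotangent_chart N c)" by (rule c(2))
      show "open ?V" by (rule V)
      show "snd (cotangent_chart N c) w \<in> ?V" using c(2) by blast
      show "?V \<subseteq> ?V" ..
      show "fg_ambient ?V (metric_components ?B g (cotangent_chart N c)) ?\<gamma>" by (rule fg)
      show "0 = ambient_Q ?\<gamma> (snd (cotangent_chart N c) w)"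
        using Q0[OF c(1) V _ _ fg] c(2) by simp
    qed (use c(1) in \<open>simp add: cotangent_bundle_def\<close>)
  next
    fix q
    assume "\<exists>C\<in>?B. w \<in> fst C \<and> (\<exists>V \<gamma>. open V \<and> snd C w \<in> V \<and> V \<subseteq> snd C ` fst C \<and>
        fg_ambient V (metric_components ?B g C) \<gamma> \<and> q = ambient_Q \<gamma> (snd C w))"
    then obtain c V \<gamma> where "c \<in> N" "open V" "snd (cotangent_chart N c) w \<in> V"
      "V \<subseteq> snd (cotangent_chart N c) ` fst (cotangent_chart N c)"
      "fg_ambient V (metric_components ?B g (cotangent_chart N c)) \<gamma>"
      "q = ambient_Q \<gamma> (snd (cotangent_chart N c) w)"
      unfolding cotangent_bundle_def by blast
    then show "q = 0" using Q0 by simp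
  qed
qed

end
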